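(* Assume Hypotheses 1 and 2 (stated in the context). Then there exists $\alpha_0\in(0,\alpha^*]$ such that the following is true: there exists a function $\sigma:\ell^1\times[0,\alpha_0]\to\ell^1$ such that the set $$\{(s,\psi):\ s=\sigma(\psi,\alpha),\ \psi\in\ell^1\}$$ is an invariant manifold of the system $$\dot s=F(s,\psi,\alpha),\qquad \dot\psi=\alpha\,G(s,\psi,\alpha)\qquad(\ast)$$ for all $\alpha\in[0,\alpha_0]$. The function $\sigma$ satisfies $$\sigma(0,\alpha)=0,\qquad \sup_{\psi\in\ell^1}\|\sigma(\psi,\alpha)\|_\infty\le\sqrt{\alpha},\qquad \|\sigma(\psi,\alpha)-\sigma(\tilde\psi,\alpha)\|_p\le\sqrt{\alpha}\,Q_p(\psi-\tilde\psi)$$ for all $p\in[1,\infty]$, $\psi,\tilde\psi\in\ell^1$ and $\alpha\in[0,\alpha_0]$. This invariant manifold is asymptotically exponentially stable; that is, there exist $\delta^*,\beta>0$ such that for all $\delta\in(0,\delta^*]$ and all $\alpha\in[0,\alpha_0]$, if a solution $(s(t),\psi(t))$ of $(\ast)$ satisfies $\|s(0)-\sigma(\psi(0),\alpha)\|_1\le\delta$, then $$\|s(t)-\sigma(\psi(t),\alpha)\|_1\le 2\delta e^{-\beta t}\quad\text{for all } t\ge0.$$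
   Context: Spaces. For $p\in[1,\infty]$, $\ell^p=\ell^p(\mathbb{Z}^2)$ is the space of real sequences $x=\{x_{i,j}\}_{(i,j)\in\mathbb{Z}^2}$ with finite norm $\|x\|_p$ (usual $p$-norm or sup norm). For $(i,j)\in\mathbb{Z}^2$, $\sum_{i',j'}$ denotes the sum over the four nearest neighbours $(i',j')\in\{(i\pm1,j),(i,j\pm1)\}$. For $p\in[1,\infty)$, $Q_p(x)=\big(\sum_{(i,j)\in\mathbb{Z}^2}\sum_{i',j'}|x_{i',j'}-x_{i,j}|^p\big)^{1/p}$, and $Q_\infty(x)=\sup_{(i,j)\in\mathbb{Z}^2}\sum_{i',j'}|x_{i',j'}-x_{i,j}|$. Hypothesis 1. (1) $\lambda:[0,\infty)\to\mathbb{R}$ is continuously differentiable and there is $a>0$ with $\lambda(a)=0$ and $\lambda'(a)<0$. (2) $\omega(R,\alpha)=\omega_0(\alpha)+\alpha\,\omega_1(R,\alpha)$ for some functions $\omega_0:\mathbb{R}\to\mathbb{R}$ and $\omega_1:[0,\infty)\times\mathbb{R}\to\mathbb{R}$, with $\omega_1$ twice continuously differentiable and $\omega_1(a,\alpha)=0$ for all $\alpha\in\mathbb{R}$. Hypothesis 2. There exists $\alpha^*>0$ such that for all $\alpha\in[0,\alpha^*]$ there are real sequences $\{\bar r_{i,j}(\alpha)\}$, $\{\bar\theta_{i,j}(\alpha)\}$ indexed by $\mathbb{Z}^2$ with, for all $(i,j)$, $$0=\alpha\sum_{i',j'}\big(\bar r_{i',j'}(\alpha)\cos(\bar\theta_{i',j'}(\alpha)-\bar\theta_{i,j}(\alpha))-\bar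 r_{i,j}(\alpha)\big)+\bar r_{i,j}(\alpha)\lambda(\bar r_{i,j}(\alpha)),$$ $$0=\sum_{i',j'}\frac{\bar r_{i',j'}(\alpha)}{\bar r_{i,j}(\alpha)}\sin(\bar\theta_{i',j'}(\alpha)-\bar\theta_{i,j}(\alpha))+\omega_1(\bar r_{i,j}(\alpha),\alpha).$$ Moreover $\bar r_{i,j}(0)=a$ and there is a constant $C_r>0$ with $|\bar r_{i,j}(\alpha)-a|\le C_r\alpha$ for all $(i,j)$ and $\alpha\in[0,\alpha^*]$. Throughout, $\alpha^*$ is taken small enough that $|\bar r_{i,j}(\alpha)-a|\le a/2$ for all $(i,j)$ and $\alpha\in[0,\alpha^*]$. The functions $F=\{F_{i,j}\}$ and $G=\{G_{i,j}\}$ are $$F_{i,j}(s,\psi,\alpha)=\alpha\sum_{i',j'}\Big[(\bar r_{i',j'}(\alpha)+s_{i',j'})\cos(\bar\theta_{i',j'}(\alpha)+\psi_{i',j'}-\bar\theta_{i,j}(\alpha)-\psi_{i,j})-(\bar r_{i,j}(\alpha)+s_{i,j})\Big]+(\bar r_{i,j}(\alpha)+s_{i,j})\lambda(\bar r_{i,j}(\alpha)+s_{i,j}),$$ $$G_{i,j}(s,\psi,\alpha)=\sum_{i',j'}\frac{\bar r_{i',j'}(\alpha)+s_{i',j'}}{\bar r_{i,j}(\alpha)+s_{i,j}}\sin(\bar\theta_{i',j'}(\alpha)+\psi_{i',j'}-\bar\theta_{i,j}(\alpha)-\psi_{i,j})+\omega_1(\bar r_{i,j}(\alpha)+s_{i,j},\alpha).$$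 *)

theory Defs
  imports "HOL-Analysis.Analysis"
begin

section \<open>Sequence spaces over the planar lattice\<close>

type_synonym site = "int \<times> int"
type_synonym lattice_seq = "site \<Rightarrow> real"

definition nbrs :: "site \<Rightarrow> site set" where
  "nbrs k = {(fst k + 1, snd k), (fst k - 1, snd k), (fst k, snd k + 1), (fst k, snd k - 1)}"

text \<open>The exponent ranges over \<open>1 \<le> p \<le> \<infinity>\<close> in \<^typ>\<open>ereal\<close>. The real-valued
  \<open>lnorm p x\<close> and \<open>Q p x\<close> are meaningful for \<open>x \<in> ell p\<close> only.\<close>

definition ell :: "ereal \<Rightarrow> lattice_seq set" where
  "ell p = (if p = \<infinity> then {x. bounded (range x)}
            else {x. (\<lambda>k. \<bar>x k\<bar> powr real_of_ereal p) summable_on UNIV})"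

definition lnorm :: "ereal \<Rightarrow> lattice_seq \<Rightarrow> real" where
  "lnorm p x = (if p = \<infinity> then (SUP k. \<bar>x k\<bar>)
                else (\<Sum>\<^sub>\<infinity>k. \<bar>x k\<bar> powr real_of_ereal p) powr (1 / real_of_ereal p))"

definition Q :: "ereal \<Rightarrow> lattice_seq \<Rightarrow> real" where
  "Q p x = (if p = \<infinity> then (SUP k. \<Sum>k'\<in>nbrs k. \<bar>x k' - x k\<bar>)
            else (\<Sum>\<^sub>\<infinity>k. \<Sum>k'\<in>nbrs k. \<bar>x k' - x k\<bar> powr real_of_ereal p)
                   powr (1 / real_of_ereal p))"

section \<open>Hypotheses\<close>

text \<open>Continuous differentiability on a set, with derivatives taken within the set (hence
  one-sided on the boundary of \<open>[0,\<infinity>)\<close> and of \<open>[0,\<infinity>) \<times> \<real>\<close>).\<close>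

definition c1_on :: "('a::real_normed_vector \<Rightarrow> 'b::real_normed_vector) \<Rightarrow> 'a set \<Rightarrow> bool" where
  "c1_on f S \<longleftrightarrow> (\<exists>f'. (\<forall>x\<in>S. (f has_derivative blinfun_apply (f' x)) (at x within S))
                        \<and> continuous_on S f')"

definition c2_on :: "('a::real_normed_vector \<Rightarrow> 'b::real_normed_vector) \<Rightarrow> 'a set \<Rightarrow> bool" where
  "c2_on f S \<longleftrightarrow> (\<exists>f'. (\<forall>x\<in>S. (f has_derivative blinfun_apply (f' x)) (at x within S))
                        \<and> c1_on f' S)"

definition hypothesis1 ::
  "(real \<Rightarrow> real) \<Rightarrow> (real \<Rightarrow> real \<Rightarrow> real) \<Rightarrow> (real \<Rightarrow> real) \<Rightarrow> (real \<Rightarrow> real \<Rightarrow> real)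
    \<Rightarrow> real \<Rightarrow> bool" where
  "hypothesis1 lam om om0 om1 a \<longleftrightarrow>
     c1_on lam {0..} \<and> a > 0 \<and> lam a = 0 \<and> deriv lam a < 0 \<and>
     (\<forall>R\<ge>0. \<forall>\<alpha>. om R \<alpha> = om0 \<alpha> + \<alpha> * om1 R \<alpha>) \<and>
     c2_on (\<lambda>(R, \<alpha>). om1 R \<alpha>) ({0..} \<times> UNIV) \<and>
     (\<forall>\<alpha>. om1 a \<alpha> = 0)"

definition hypothesis2 ::
  "(real \<Rightarrow> real) \<Rightarrow> (real \<Rightarrow> real \<Rightarrow> real) \<Rightarrow> real
    \<Rightarrow> (real \<Rightarrow> lattice_seq) \<Rightarrow> (real \<Rightarrow> lattice_seq) \<Rightarrow> real \<Rightarrow> bool" where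
  "hypothesis2 lam om1 a rb tb as \<longleftrightarrow>
     as > 0 \<and>
     (\<forall>\<alpha>\<in>{0..as}. \<forall>k.
        0 = \<alpha> * (\<Sum>k'\<in>nbrs k. rb \<alpha> k' * cos (tb \<alpha> k' - tb \<alpha> k) - rb \<alpha> k)
              + rb \<alpha> k * lam (rb \<alpha> k) \<and>
        0 = (\<Sum>k'\<in>nbrs k. rb \<alpha> k' / rb \<alpha> k * sin (tb \<alpha> k' - tb \<alpha> k)) + om1 (rb \<alpha> k) \<alpha>) \<and>
     (\<forall>k. rb 0 k = a) \<and>
     (\<exists>C>0. \<forall>\<alpha>\<in>{0..as}. \<forall>k. \<bar>rb \<alpha> k - a\<bar> \<le> C * \<alpha>) \<and>
     (\<forall>\<alpha>\<in>{0..as}. \<forall>k. \<bar>rb \<alpha> k - a\<bar> \<le> a / 2)"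

section \<open>The system and its solutions\<close>

definition F ::
  "(real \<Rightarrow> real) \<Rightarrow> (real \<Rightarrow> lattice_seq) \<Rightarrow> (real \<Rightarrow> lattice_seq)
    \<Rightarrow> lattice_seq \<Rightarrow> lattice_seq \<Rightarrow> real \<Rightarrow> lattice_seq" where
  "F lam rb tb s \<psi> \<alpha> = (\<lambda>k.
     \<alpha> * (\<Sum>k'\<in>nbrs k. (rb \<alpha> k' + s k') * cos (tb \<alpha> k' + \<psi> k' - tb \<alpha> k - \<psi> k)
                          - (rb \<alpha> k + s k))
     + (rb \<alpha> k + s k) * lam (rb \<alpha> k + s k))"

definition G ::
  "(real \<Rightarrow> real \<Rightarrow> real) \<Rightarrow> (real \<Rightarrow> lattice_seq) \<Rightarrow> (real \<Rightarrow> lattice_seq)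
    \<Rightarrow> lattice_seq \<Rightarrow> lattice_seq \<Rightarrow> real \<Rightarrow> lattice_seq" where
  "G om1 rb tb s \<psi> \<alpha> = (\<lambda>k.
     (\<Sum>k'\<in>nbrs k. (rb \<alpha> k' + s k') / (rb \<alpha> k + s k)
                       * sin (tb \<alpha> k' + \<psi> k' - tb \<alpha> k - \<psi> k))
     + om1 (rb \<alpha> k + s k) \<alpha>)"

text \<open>Differentiability of a curve in \<open>\<ell>\<^sup>1\<close>: the difference quotients converge in the
  \<open>\<ell>\<^sup>1\<close> norm, not merely site by site.\<close>

definition has_l1_derivative ::
  "(real \<Rightarrow> lattice_seq) \<Rightarrow> lattice_seq \<Rightarrow> real \<Rightarrow> real set \<Rightarrow> bool" where
  "has_l1_derivative x d t J \<longleftrightarrow> d \<in> ell 1 \<and>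
     ((\<lambda>\<tau>. lnorm 1 (\<lambda>k. (x \<tau> k - x t k) / (\<tau> - t) - d k)) \<longlongrightarrow> 0) (at t within J)"

text \<open>A solution on the time interval \<open>J\<close> is a curve in \<open>\<ell>\<^sup>1 \<times> \<ell>\<^sup>1\<close> that stays in the region
  where the right-hand side is defined: the radii \<open>rb \<alpha> k + s t k\<close> are denominators in \<open>G\<close> and
  arguments of functions on \<open>[0,\<infinity>)\<close>, so they have to be positive.\<close>

definition solution ::
  "(real \<Rightarrow> real) \<Rightarrow> (real \<Rightarrow> real \<Rightarrow> real) \<Rightarrow> (real \<Rightarrow> lattice_seq) \<Rightarrow> (real \<Rightarrow> lattice_seq)
    \<Rightarrow> real \<Rightarrow> real set \<Rightarrow> (real \<Rightarrow> lattice_seq) \<Rightarrow> (real \<Rightarrow> lattice_seq) \<Rightarrow> bool" where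
  "solution lam om1 rb tb \<alpha> J s \<psi> \<longleftrightarrow>
     (\<forall>t\<in>J. s t \<in> ell 1 \<and> \<psi> t \<in> ell 1 \<and> (\<forall>k. rb \<alpha> k + s t k > 0) \<and>
        has_l1_derivative s (F lam rb tb (s t) (\<psi> t) \<alpha>) t J \<and>
        has_l1_derivative \<psi> (\<lambda>k. \<alpha> * G om1 rb tb (s t) (\<psi> t) \<alpha> k) t J)"

section \<open>Invariant manifolds\<close>

definition lipschitz_graph :: "(lattice_seq \<times> lattice_seq) set \<Rightarrow> bool" where
  "lipschitz_graph M \<longleftrightarrow> (\<exists>h L. M = {(h \<psi>, \<psi>) |\<psi>. \<psi> \<in> ell 1} \<and>
     (\<forall>\<psi>\<in>ell 1. h \<psi> \<in> ell 1) \<and>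
     (\<forall>\<psi>\<in>ell 1. \<forall>\<phi>\<in>ell 1. lnorm 1 (\<lambda>k. h \<psi> k - h \<phi> k) \<le> L * lnorm 1 (\<lambda>k. \<psi> k - \<phi> k)))"

text \<open>\<open>sol J s \<psi>\<close> says that \<open>(s, \<psi>)\<close> is a solution on \<open>J\<close>. The manifolds considered are Lipschitz
  graphs over the \<open>\<psi>\<close>-space. Invariance is in both time directions: through every point of \<open>M\<close>
  there is a solution on all of \<open>\<real>\<close> lying in \<open>M\<close>, and no solution that meets \<open>M\<close> at time \<open>0\<close>
  leaves it (the system is autonomous, so time \<open>0\<close> is no restriction).\<close>

definition invariant_manifold ::
  "(real set \<Rightarrow> (real \<Rightarrow> lattice_seq) \<Rightarrow> (real \<Rightarrow> lattice_seq) \<Rightarrow> bool)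
    \<Rightarrow> (lattice_seq \<times> lattice_seq) set \<Rightarrow> bool" where
  "invariant_manifold sol M \<longleftrightarrow>
     lipschitz_graph M \<and>
     (\<forall>(s0, \<psi>0)\<in>M. \<exists>s \<psi>. sol UNIV s \<psi> \<and> s 0 = s0 \<and> \<psi> 0 = \<psi>0 \<and> (\<forall>t. (s t, \<psi> t) \<in> M)) \<and>
     (\<forall>J s \<psi>. is_interval J \<and> 0 \<in> J \<and> sol J s \<psi> \<and> (s 0, \<psi> 0) \<in> M \<longrightarrow> (\<forall>t\<in>J. (s t, \<psi> t) \<in> M))"

text \<open>The estimate claimed for all \<open>t \<ge> 0\<close> includes that the solution exists for all \<open>t \<ge> 0\<close>. So
  every solution on a forward time interval \<open>J\<close> containing \<open>0\<close> that starts \<open>\<delta>\<close>-close to the graph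
  of \<open>h\<close> is required to extend to a solution on \<open>[0,\<infinity>)\<close> that obeys the estimate; for
  \<open>J = [0,\<infinity>)\<close> this is the estimate for the given solution itself.\<close>

definition attracted ::
  "(real set \<Rightarrow> (real \<Rightarrow> lattice_seq) \<Rightarrow> (real \<Rightarrow> lattice_seq) \<Rightarrow> bool)
    \<Rightarrow> (lattice_seq \<Rightarrow> lattice_seq) \<Rightarrow> real \<Rightarrow> real \<Rightarrow> bool" where
  "attracted sol h \<delta> \<beta> \<longleftrightarrow>
     (\<forall>J s \<psi>. is_interval J \<and> 0 \<in> J \<and> J \<subseteq> {0..} \<and> sol J s \<psi> \<and>
        lnorm 1 (\<lambda>k. s 0 k - h (\<psi> 0) k) \<le> \<delta> \<longrightarrow>
        (\<exists>s' \<psi>'. sol {0..} s' \<psi>' \<and> (\<forall>t\<in>J. s' t = s t \<and> \<psi>' t = \<psi> t) \<and>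
           (\<forall>t\<ge>0. lnorm 1 (\<lambda>k. s' t k - h (\<psi>' t) k) \<le> 2 * \<delta> * exp (- \<beta> * t))))"

end

theory Submission
  imports Defs
begin

text \<open>The amplitudes \<open>s\<close> are strongly damped at a rate close to
  \<open>\<mu> = - a \<lambda>'(a) > 0\<close>, while the phases \<open>\<psi>\<close> move at speed \<open>O(\<alpha>)\<close>. For small
  \<open>\<alpha>\<close> the amplitudes are therefore slaved to the phases, and the invariant manifold is the set of
  points whose complete orbit does not grow backwards in time like \<open>exp (\<mu> \<bar>t\<bar>)\<close>.

  Clipping \<open>s\<close> at a small height \<open>\<rho>\<close> turns the system into
  \<open>s' = - \<mu> s + N s \<psi>\<close>, \<open>\<psi>' = g s \<psi>\<close> with \<open>N\<close> and \<open>g\<close>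
  globally Lipschitz on \<open>\<ell>\<^sup>1 \<times> \<ell>\<^sup>1\<close> with small constants (locale \<open>fast_slow\<close>). A
  contraction argument of Lyapunov-Perron type in the space of curves that grow at most like
  \<open>cosh (\<mu> t / 2)\<close> yields, for each \<open>\<xi>\<close>, such an orbit on the whole time axis with
  \<open>\<psi>(0) = \<xi>\<close> (\<open>ancient_exists\<close>); its value \<open>s(0)\<close> is \<open>\<sigma>(\<xi>)\<close>.

  All the quantitative properties come from one differential inequality (\<open>ancient_cone\<close>). Let
  \<open>S\<close> and \<open>P\<close> be seminorms for the differences of the fast and the slow components of two
  such orbits. In reversed time \<open>W = \<kappa> P - S\<close> satisfies \<open>W' \<le> \<nu> W\<close> with
  \<open>\<nu> > \<mu> / 2\<close>. If \<open>W(0)\<close> were negative, \<open>S\<close> would grow faster than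
  \<open>cosh (\<mu> t / 2)\<close>; hence \<open>S \<le> \<kappa> P\<close>. With the norms of \<open>\<ell>\<^sup>1\<close> this
  says that \<open>\<sigma>\<close> is well defined, with \<open>S = \<parallel>\<cdot>\<parallel>\<^sub>p\<close>,
  \<open>P = Q\<^sub>p\<close> and \<open>\<kappa> = \<surd>\<alpha>\<close> it is the Lipschitz estimate for every \<open>p\<close> at once, and with
  \<open>P = 1\<close> it is the bound on \<open>\<parallel>\<sigma>\<parallel>\<^sub>\<infinity>\<close>. The phases enter the equations only through
  differences of neighbours, which is why \<open>Q\<^sub>p\<close> rather than \<open>\<parallel>\<cdot>\<parallel>\<^sub>p\<close> appears.

  For the attraction (\<open>slaved_attracts\<close>) a solution is compared, at each instant, with the orbit
  on the manifold that has the same phases at that instant. This shows that the distance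
  \<open>\<parallel>s - \<sigma>(\<psi>)\<parallel>\<^sub>1\<close> decays at rate \<open>\<mu> / 2\<close>. Both on the manifold and near it the amplitudes
  stay below \<open>\<rho>\<close>, where the clipped and the original system agree; a uniqueness theorem that
  does not presuppose this of the given solution (\<open>ode_unique_in_open\<close>) transfers the results
  to the original system.\<close>

section \<open>Summable sequences as a Banach space\<close>

text \<open>Completeness is expressed by a type class, so the space of summable sequences is made a type.
  The maps \<open>seq\<close> and \<open>L1\<close> lead to and from plain sequences.\<close>

typedef 'i l1 = "{x :: 'i \<Rightarrow> real. (\<lambda>k. \<bar>x k\<bar>) summable_on UNIV}"
  morphisms seq L1
proof
  show "(\<lambda>_. 0) \<in> {x :: 'i \<Rightarrow> real. (\<lambda>k. \<bar>x k\<bar>) summable_on UNIV}" by simp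
qed

lemma summable_seq [simp, intro]: "(\<lambda>k. \<bar>seq x k\<bar>) summable_on UNIV"
  using seq[of x] by simp

lemma seq_L1: "(\<lambda>k. \<bar>x k\<bar>) summable_on UNIV \<Longrightarrow> seq (L1 x) = x"
  by (simp add: L1_inverse)

lemma l1_eqI: "(\<And>k. seq x k = seq y k) \<Longrightarrow> x = y"
  by (metis ext seq_inject)

lemma summable_abs_le:
  fixes x y :: "'i \<Rightarrow> real"
  assumes "y summable_on UNIV" "\<And>k. \<bar>x k\<bar> \<le> y k"
  shows "(\<lambda>k. \<bar>x k\<bar>) summable_on UNIV"
  by (rule summable_on_comparison_test[OF assms(1)]) (use assms(2) in auto)

instantiation l1 :: (type) real_vector
begin

definition "0 = L1 (\<lambda>_. 0)"
definition "x + y = L1 (\<lambda>k. seq x k + seq y k)"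
definition "- x = L1 (\<lambda>k. - seq x k)"
definition "x - y = L1 (\<lambda>k. seq x k - seq y k)"
definition "r *\<^sub>R x = L1 (\<lambda>k. r * seq x k)"

lemma seq_zero [simp]: "seq 0 = (\<lambda>_. 0)"
  by (simp add: zero_l1_def seq_L1)

lemma seq_plus [simp]: "seq (x + y) = (\<lambda>k. seq x k + seq y k)"
  unfolding plus_l1_def
  by (intro seq_L1 summable_abs_le[OF summable_on_add[OF summable_seq[of x] summable_seq[of y]]]
        abs_triangle_ineq)

lemma seq_minus [simp]: "seq (x - y) = (\<lambda>k. seq x k - seq y k)"
  unfolding minus_l1_def
  by (intro seq_L1 summable_abs_le[OF summable_on_add[OF summable_seq[of x] summable_seq[of y]]]
        abs_triangle_ineq4)

lemma seq_uminus [simp]: "seq (- x) = (\<lambda>k. - seq x k)"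
  unfolding uminus_l1_def by (intro seq_L1) simp

lemma seq_scaleR [simp]: "seq (r *\<^sub>R x) = (\<lambda>k. r * seq x k)"
  unfolding scaleR_l1_def
  by (intro seq_L1) (simp add: abs_mult summable_on_cmult_right)

instance
  by standard (rule l1_eqI; simp add: algebra_simps)+

end

instantiation l1 :: (type) real_normed_vector
begin

definition "norm x = (\<Sum>\<^sub>\<infinity>k. \<bar>seq x k\<bar>)"
definition "sgn (x :: 'a l1) = x /\<^sub>R norm x"
definition "dist x y = norm (x - y :: 'a l1)"
definition [code del]:
  "(uniformity :: ('a l1 \<times> 'a l1) filter) = (INF e\<in>{0<..}. principal {(x, y). dist x y < e})"
definition [code del]:
  "open (U :: 'a l1 set) \<longleftrightarrow> (\<forall>x\<in>U. \<forall>\<^sub>F (x', y) in uniformity. x' = x \<longrightarrow> y \<in> U)"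

instance
proof
  fix x y :: "'a l1" and r :: real
  show "(norm x = 0) = (x = 0)"
  proof
    assume "norm x = 0"
    then have "\<bar>seq x k\<bar> = 0" for k
      by (intro nonneg_infsum_le_0D[of "\<lambda>k. \<bar>seq x k\<bar>" UNIV]) (auto simp: norm_l1_def)
    then show "x = 0" by (intro l1_eqI) simp
  qed (simp add: norm_l1_def)
  show "norm (x + y) \<le> norm x + norm y"
  proof -
    have "norm (x + y) \<le> (\<Sum>\<^sub>\<infinity>k. \<bar>seq x k\<bar> + \<bar>seq y k\<bar>)"
      unfolding norm_l1_def
      by (intro infsum_mono summable_seq summable_on_add) (auto intro: abs_triangle_ineq)
    also have "\<dots> = norm x + norm y" unfolding norm_l1_def by (intro infsum_add summable_seq)
    finally show ?thesis .
  qed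
  show "norm (r *\<^sub>R x) = \<bar>r\<bar> * norm x"
    by (simp add: norm_l1_def abs_mult infsum_cmult_right')
qed (fact sgn_l1_def dist_l1_def uniformity_l1_def open_l1_def)+

end

lemma abs_seq_le_norm: "\<bar>seq x k\<bar> \<le> norm x"
  using finite_sum_le_infsum[of "\<lambda>k. \<bar>seq x k\<bar>" UNIV "{k}"] by (simp add: norm_l1_def)

lemma sum_abs_seq_le_norm: "finite A \<Longrightarrow> (\<Sum>k\<in>A. \<bar>seq x k\<bar>) \<le> norm x"
  unfolding norm_l1_def by (rule finite_sum_le_infsum) auto

text \<open>A Cauchy sequence converges site by site. Its finite partial sums are uniformly Cauchy, so the
  bound survives in the site-wise limit for every finite set of sites, hence for the whole sum.\<close>

instance l1 :: (type) banach
proof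
  fix X :: "nat \<Rightarrow> 'a l1"
  assume X: "Cauchy X"
  have "Cauchy (\<lambda>n. seq (X n) k)" for k
  proof (rule metric_CauchyI)
    fix e :: real assume "e > 0"
    then obtain M where M: "\<And>m n. m \<ge> M \<Longrightarrow> n \<ge> M \<Longrightarrow> dist (X m) (X n) < e"
      using metric_CauchyD[OF X] by blast
    have "dist (seq (X m) k) (seq (X n) k) \<le> dist (X m) (X n)" for m n
      using abs_seq_le_norm[of "X m - X n" k] by (simp add: dist_norm)
    then show "\<exists>M. \<forall>m\<ge>M. \<forall>n\<ge>M. dist (seq (X m) k) (seq (X n) k) < e"
      using M by (meson le_less_trans)
  qed
  then have "\<exists>l. (\<lambda>n. seq (X n) k) \<longlonglongrightarrow> l" for k
    using Cauchy_convergent convergent_def by blast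
  then obtain x where x: "\<And>k. (\<lambda>n. seq (X n) k) \<longlonglongrightarrow> x k" by metis
  have part: "\<exists>M. \<forall>m\<ge>M. \<forall>A. finite A \<longrightarrow> (\<Sum>k\<in>A. \<bar>seq (X m) k - x k\<bar>) \<le> e" if "e > 0" for e
  proof -
    from that obtain M where M: "\<And>m n. m \<ge> M \<Longrightarrow> n \<ge> M \<Longrightarrow> dist (X m) (X n) < e"
      using metric_CauchyD[OF X] by blast
    have "(\<Sum>k\<in>A. \<bar>seq (X m) k - x k\<bar>) \<le> e" if "m \<ge> M" "finite A" for m A
    proof (rule tendsto_upperbound)
      show "(\<lambda>n. \<Sum>k\<in>A. \<bar>seq (X m) k - seq (X n) k\<bar>) \<longlonglongrightarrow> (\<Sum>k\<in>A. \<bar>seq (X m) k - x k\<bar>)"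
        by (intro tendsto_intros x)
      show "\<forall>\<^sub>F n in sequentially. (\<Sum>k\<in>A. \<bar>seq (X m) k - seq (X n) k\<bar>) \<le> e"
        using eventually_ge_at_top[of M]
      proof eventually_elim
        case (elim n)
        then show ?case
          using sum_abs_seq_le_norm[OF \<open>finite A\<close>, of "X m - X n"] M[of m n] that
          by (simp add: dist_norm)
      qed
    qed simp
    then show ?thesis by blast
  qed
  have diff_summable: "\<exists>M. \<forall>m\<ge>M. (\<lambda>k. \<bar>seq (X m) k - x k\<bar>) summable_on UNIV
      \<and> (\<Sum>\<^sub>\<infinity>k. \<bar>seq (X m) k - x k\<bar>) \<le> e" if e: "e > 0" for e
  proof -
    from part[OF that] obtain M
      where M: "\<And>m A. m \<ge> M \<Longrightarrow> finite A \<Longrightarrow> (\<Sum>k\<in>A. \<bar>seq (X m) k - x k\<bar>) \<le> e" by blast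
    have "(\<lambda>k. \<bar>seq (X m) k - x k\<bar>) summable_on UNIV" if "m \<ge> M" for m
      by (rule nonneg_bdd_above_summable_on) (auto intro!: bdd_aboveI2[of _ _ e] M that)
    moreover have "(\<Sum>\<^sub>\<infinity>k. \<bar>seq (X m) k - x k\<bar>) \<le> e" if "m \<ge> M" for m
      by (rule infsum_le_finite_sums) (use calculation that M in auto)
    ultimately show ?thesis by blast
  qed
  obtain m where m: "(\<lambda>k. \<bar>seq (X m) k - x k\<bar>) summable_on UNIV"
    using diff_summable[of 1] by auto
  have sx: "(\<lambda>k. \<bar>x k\<bar>) summable_on UNIV"
    by (rule summable_abs_le[OF summable_on_add[OF m summable_seq[of "X m"]]]) auto
  have "X \<longlonglongrightarrow> L1 x"
  proof (rule metric_LIMSEQ_I)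
    fix r :: real assume "r > 0"
    then obtain M where M: "\<And>m. m \<ge> M \<Longrightarrow> (\<Sum>\<^sub>\<infinity>k. \<bar>seq (X m) k - x k\<bar>) \<le> r / 2"
      using diff_summable[of "r/2"] by auto
    have "dist (X n) (L1 x) < r" if "n \<ge> M" for n
      using M[OF that] \<open>r > 0\<close> by (simp add: dist_norm norm_l1_def seq_L1[OF sx])
    then show "\<exists>no. \<forall>n\<ge>no. dist (X n) (L1 x) < r" by blast
  qed
  then show "convergent X" by (auto simp: convergent_def)
qed

section \<open>Growth estimates for seminorms along curves\<close>

text \<open>The upper right Dini derivative of \<open>f\<close> at \<open>t\<close> is at most \<open>D\<close>. A norm along a differentiable curve
  need not be differentiable, but it obeys bounds of this kind, and they suffice for comparison.\<close>

definition dini_le :: "(real \<Rightarrow> real) \<Rightarrow> real \<Rightarrow> real \<Rightarrow> bool" where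
  "dini_le f t D \<longleftrightarrow> (\<forall>e>0. \<forall>\<^sub>F h in at_right 0. f (t + h) \<le> f t + h * (D + e))"

lemma dini_leD: "dini_le f t D \<Longrightarrow> e > 0 \<Longrightarrow> \<forall>\<^sub>F h in at_right 0. f (t + h) \<le> f t + h * (D + e)"
  unfolding dini_le_def by blast

text \<open>For every slope \<open>e > 0\<close>, the set of times up to which \<open>f\<close> stays below the line of slope \<open>e\<close>
  through its initial value is closed, and the Dini bound extends it a little beyond any of its
  points. Then \<open>e\<close> tends to \<open>0\<close>.\<close>

lemma dini_le_nonpos_imp_le:
  fixes f :: "real \<Rightarrow> real"
  assumes cont: "continuous_on {a..b} f" and ab: "a \<le> b"
    and dini: "\<And>t. a \<le> t \<Longrightarrow> t < b \<Longrightarrow> dini_le f t 0"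
  shows "f b \<le> f a"
proof -
  have "f b \<le> f a + e * (b - a)" if e: "e > 0" for e
  proof -
    define A where "A = {t \<in> {a..b}. f t \<le> f a + e * (t - a)}"
    have closed: "closed A"
      unfolding A_def by (intro continuous_on_closed_Collect_le) (auto intro!: continuous_intros cont)
    define S where "S = {t \<in> {a..b}. {a..t} \<subseteq> A}"
    have "a \<in> S" using ab by (auto simp: S_def A_def)
    have bdd: "bdd_above S" by (auto simp: S_def)
    define c where "c = Sup S"
    have "c \<le> b" unfolding c_def using \<open>a \<in> S\<close> by (intro cSup_least) (auto simp: S_def)
    moreover have "a \<le> c" unfolding c_def using \<open>a \<in> S\<close> bdd by (rule cSup_upper)
    ultimately have c: "a \<le> c" "c \<le> b" by auto
    have sub: "{a..<c} \<subseteq> A"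
    proof
      fix x assume x: "x \<in> {a..<c}"
      then obtain t where "t \<in> S" "x < t"
        unfolding c_def using less_cSup_iff[OF _ bdd] \<open>a \<in> S\<close> by force
      then show "x \<in> A" using x by (auto simp: S_def)
    qed
    have "c \<in> A"
    proof (cases "c = a")
      case True then show ?thesis using ab by (auto simp: A_def)
    next
      case False
      then have "c \<in> closure {a..<c}" using c by simp
      then show ?thesis using closure_minimal[OF sub closed] by blast
    qed
    have "c = b"
    proof (rule ccontr)
      assume "c \<noteq> b"
      then have "c < b" using c by simp
      from dini_leD[OF dini[OF c(1) this] e]
      obtain d where d: "d > 0" "\<And>h. 0 < h \<Longrightarrow> h < d \<Longrightarrow> f (c + h) \<le> f c + h * e"
        unfolding eventually_at_right_field by auto
      define h where "h = min (d / 2) (b - c)"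
      have h: "0 < h" "h < d" "c + h \<le> b" using d(1) \<open>c < b\<close> by (auto simp: h_def)
      have "x \<in> A" if "x \<in> {a..c + h}" for x
      proof (cases "x \<le> c")
        case True
        then show ?thesis using that sub \<open>c \<in> A\<close> by (cases "x = c") auto
      next
        case False
        then have "f x \<le> f c + (x - c) * e" using d(2)[of "x - c"] that h by auto
        also have "\<dots> \<le> f a + e * (x - a)" using \<open>c \<in> A\<close> by (auto simp: A_def algebra_simps)
        finally show ?thesis using that h by (auto simp: A_def)
      qed
      then have "c + h \<in> S" using h c by (auto simp: S_def)
      then have "c + h \<le> c" unfolding c_def using bdd by (rule cSup_upper)
      then show False using h by simp
    qed
    then show ?thesis using \<open>c \<in> A\<close> by (simp add: A_def)
  qed
  note * = this
  show ?thesis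
  proof (rule field_le_epsilon)
    fix e :: real assume e: "e > 0"
    have "f b \<le> f a + e / (b - a + 1) * (b - a)"
      using *[of "e / (b - a + 1)"] e ab by simp
    also have "e / (b - a + 1) * (b - a) \<le> e"
      using e ab by (simp add: field_simps)
    finally show "f b \<le> f a + e" by simp
  qed
qed

lemma dini_le_I_eventually:
  assumes "\<And>e. e > 0 \<Longrightarrow> \<forall>\<^sub>F h in at_right 0. f (t + h) \<le> f t + h * D + h * e"
  shows "dini_le f t D"
  using assms unfolding dini_le_def by (simp add: algebra_simps)

text \<open>The function \<open>g t = exp (- c (t - a)) f t\<close> has Dini derivative at most \<open>0\<close>: it lies below \<open>m\<close>, whose
  slope at \<open>t\<close> is as small as desired. This does not use the sign of \<open>f\<close>, which is negative in the
  cone argument below.\<close>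

lemma dini_le_exp_bound:
  fixes f :: "real \<Rightarrow> real"
  assumes cont: "continuous_on {a..b} f" and ab: "a \<le> b"
    and dini: "\<And>t. a \<le> t \<Longrightarrow> t < b \<Longrightarrow> dini_le f t (c * f t)"
  shows "f b \<le> exp (c * (b - a)) * f a"
proof -
  define g where "g = (\<lambda>t. exp (- c * (t - a)) * f t)"
  have "g b \<le> g a"
  proof (rule dini_le_nonpos_imp_le[OF _ ab])
    show "continuous_on {a..b} g" unfolding g_def by (intro continuous_intros cont)
    fix t assume t: "a \<le> t" "t < b"
    show "dini_le g t 0"
    proof (rule dini_le_I_eventually)
      fix e :: real assume e: "e > 0"
      define E where "E = exp (- c * (t - a))"
      define e' where "e' = e / (2 * E)"
      have E: "E > 0" "e' > 0" using e by (auto simp: E_def e'_def)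
      define m where "m = (\<lambda>h. exp (- c * (t + h - a)) * (f t + h * (c * f t + e')))"
      have "(m has_real_derivative (e / 2)) (at 0)"
        unfolding m_def
        by (rule derivative_eq_intros refl | simp)+ (use E in \<open>simp add: e'_def E_def field_simps\<close>)
      then have "((\<lambda>h. (m (0 + h) - m 0) / h) \<longlongrightarrow> e / 2) (at_right 0)"
        unfolding DERIV_def by (rule filterlim_mono[OF _ order_refl at_le]) auto
      then have "\<forall>\<^sub>F h in at_right 0. (m h - m 0) / h < e"
        using order_tendstoD(2)[of _ "e / 2" "at_right 0" e] e by simp
      then show "\<forall>\<^sub>F h in at_right 0. g (t + h) \<le> g t + h * 0 + h * e"
        using dini_leD[OF dini[OF t] E(2)] eventually_at_right_less[of 0]
      proof eventually_elim
        case (elim h)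
        have "g (t + h) \<le> m h" unfolding g_def m_def using elim by (intro mult_left_mono) auto
        moreover have "m h \<le> m 0 + h * e" using elim by (simp add: field_simps)
        moreover have "m 0 = g t" by (simp add: m_def g_def)
        ultimately show ?case by simp
      qed
    qed
  qed
  then have "exp (c * (b - a)) * g b \<le> exp (c * (b - a)) * g a" by (intro mult_left_mono) auto
  then show ?thesis
    by (simp add: g_def mult.assoc[symmetric] exp_add[symmetric])
qed

text \<open>One argument is to serve the \<open>\<ell>\<^sup>1\<close> norm, all \<open>p\<close>-norms and the difference seminorms \<open>Q p\<close>.
  Their common feature is that they are continuous with respect to the norm of the space.\<close>

definition bounded_seminorm :: "('a::real_normed_vector \<Rightarrow> real) \<Rightarrow> bool" where
  "bounded_seminorm S \<longleftrightarrow> (\<forall>x y. S (x + y) \<le> S x + S y) \<and> (\<forall>r x. S (r *\<^sub>R x) = \<bar>r\<bar> * S x)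
     \<and> (\<exists>K. \<forall>x. S x \<le> K * norm x)"

lemma bounded_seminormD:
  assumes "bounded_seminorm S"
  shows "S (x + y) \<le> S x + S y" "S (r *\<^sub>R x) = \<bar>r\<bar> * S x" "0 \<le> S x" "S (- x) = S x" "S 0 = 0"
    "S (x - y) \<le> S x + S y" "S x - S y \<le> S (x - y)"
proof -
  show *: "S (x + y) \<le> S x + S y" "S (r *\<^sub>R x) = \<bar>r\<bar> * S x" for x y r
    using assms by (auto simp: bounded_seminorm_def)
  show m: "S (- x) = S x" for x using *(2)[of "-1" x] by simp
  show z: "S 0 = 0" using *(2)[of 0 x] by simp
  show "0 \<le> S x" using *(1)[of x "- x"] m[of x] z by simp
  show "S (x - y) \<le> S x + S y" using *(1)[of x "- y"] m[of y] by simp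
  show "S x - S y \<le> S (x - y)" using *(1)[of "x - y" y] by simp
qed

lemma bounded_seminorm_bound:
  assumes "bounded_seminorm S" obtains K where "K > 0" "\<And>x. S x \<le> K * norm x"
proof -
  obtain K where K: "\<And>x. S x \<le> K * norm x" using assms by (auto simp: bounded_seminorm_def)
  have "S x \<le> (\<bar>K\<bar> + 1) * norm x" for x
    using K[of x] by (smt (verit, best) mult_right_mono norm_ge_zero)
  then show ?thesis by (intro that[of "\<bar>K\<bar> + 1"]) auto
qed

lemma bounded_seminorm_norm: "bounded_seminorm norm"
  unfolding bounded_seminorm_def by (auto intro: norm_triangle_ineq exI[of _ 1])

lemma bounded_seminorm_continuous:
  assumes "bounded_seminorm S" shows "continuous_on A S"
proof -
  obtain K where K: "K > 0" "\<And>x. S x \<le> K * norm x" using bounded_seminorm_bound[OF assms] by blast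
  have "dist (S x) (S y) \<le> K * dist x y" for x y
    using bounded_seminormD(7)[OF assms, of x y] bounded_seminormD(7)[OF assms, of y x]
      K(2)[of "x - y"] K(2)[of "y - x"] by (simp add: dist_norm norm_minus_commute)
  then show ?thesis
    by (intro lipschitz_on_continuous_on[of K] lipschitz_onI) (use K in auto)
qed

text \<open>The first order Taylor remainder of the curve is \<open>o(h)\<close> in norm, hence also in \<open>S\<close>.\<close>

lemma seminorm_along_curve:
  fixes x :: "real \<Rightarrow> 'a::real_normed_vector"
  assumes S: "bounded_seminorm S" and e: "e > 0"
    and x: "(x has_vector_derivative v) (at t within X)"
    and X: "\<forall>\<^sub>F h in at_right 0. t + h \<in> X"
  shows "\<forall>\<^sub>F h in at_right 0. S (x (t + h) - (x t + h *\<^sub>R v)) \<le> h * e"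
proof -
  obtain K where K: "K > 0" "\<And>x. S x \<le> K * norm x" using bounded_seminorm_bound[OF S] by blast
  have "\<exists>d>0. \<forall>y\<in>X. norm (y - t) < d \<longrightarrow> norm (x y - x t - (y - t) *\<^sub>R v) \<le> e / K * norm (y - t)"
    using x e K(1) unfolding has_vector_derivative_def has_derivative_within_alt
    by (meson divide_pos_pos)
  then obtain d where d: "d > 0"
    "\<And>y. y \<in> X \<Longrightarrow> norm (y - t) < d \<Longrightarrow> norm (x y - x t - (y - t) *\<^sub>R v) \<le> e / K * norm (y - t)"
    by blast
  have "\<forall>\<^sub>F h in at_right 0. h < d" using d(1) by (simp add: eventually_at_right_field) blast
  then show ?thesis
    using X eventually_at_right_less[of 0]
  proof eventually_elim
    case (elim h)
    have "S (x (t + h) - (x t + h *\<^sub>R v)) \<le> K * norm (x (t + h) - (x t + h *\<^sub>R v))" by (rule K)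
    also have "\<dots> \<le> K * (e / K * h)"
      using d(2)[of "t + h"] elim K(1) by (intro mult_left_mono) (auto simp: algebra_simps)
    finally show ?case using K(1) by (simp add: mult.commute)
  qed
qed

lemma dini_le_majorant:
  assumes "dini_le q t D" "f t = q t" "\<forall>\<^sub>F h in at_right 0. f (t + h) \<le> q (t + h)"
  shows "dini_le f t D"
proof (rule dini_le_I_eventually)
  fix e :: real assume "e > 0"
  from dini_leD[OF assms(1) this] assms(3)
  show "\<forall>\<^sub>F h in at_right 0. f (t + h) \<le> f t + h * D + h * e"
    by eventually_elim (simp add: assms(2) algebra_simps)
qed

lemma dini_le_mono: "dini_le f t D \<Longrightarrow> D \<le> D' \<Longrightarrow> dini_le f t D'"
proof (rule dini_le_I_eventually)
  fix e :: real assume "e > 0" "dini_le f t D" "D \<le> D'"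
  from dini_leD[OF this(2,1)] eventually_at_right_less[of 0]
  show "\<forall>\<^sub>F h in at_right 0. f (t + h) \<le> f t + h * D' + h * e"
  proof eventually_elim
    case (elim h)
    then have "f (t + h) \<le> f t + h * D + h * e" by (simp add: distrib_left)
    moreover have "h * D \<le> h * D'" using \<open>D \<le> D'\<close> elim(2) by (intro mult_left_mono) auto
    ultimately show ?case by linarith
  qed
qed

lemma dini_le_add_cmult:
  assumes f: "dini_le f t D" and g: "dini_le g t E" and \<kappa>: "\<kappa> \<ge> 0"
  shows "dini_le (\<lambda>t. f t + \<kappa> * g t) t (D + \<kappa> * E)"
proof (rule dini_le_I_eventually)
  fix e :: real assume e: "e > 0"
  define e' where "e' = e / (1 + \<kappa>)"
  have "e' > 0" using e \<kappa> by (simp add: e'_def)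
  from dini_leD[OF f this] dini_leD[OF g this]
  show "\<forall>\<^sub>F h in at_right 0. f (t + h) + \<kappa> * g (t + h) \<le> f t + \<kappa> * g t + h * (D + \<kappa> * E) + h * e"
  proof eventually_elim
    case (elim h)
    have "f (t + h) + \<kappa> * g (t + h) \<le> f t + h * (D + e') + \<kappa> * (g t + h * (E + e'))"
      using elim \<kappa> by (intro add_mono mult_left_mono)
    also have "\<dots> = f t + \<kappa> * g t + h * (D + \<kappa> * E) + h * (e' * (1 + \<kappa>))" by (simp add: algebra_simps)
    also have "e' * (1 + \<kappa>) = e" using \<kappa> by (simp add: e'_def)
    finally show ?case .
  qed
qed

text \<open>Pulling the linear part of the velocity out of the seminorm, as \<open>(1 + h c) S(x) + h S(n)\<close>, keeps
  the sign of \<open>c\<close>. The triangle inequality alone would replace \<open>c\<close> by its absolute value and lose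
  the damping.\<close>

lemma dini_le_seminorm:
  fixes x :: "real \<Rightarrow> 'a::real_normed_vector"
  assumes S: "bounded_seminorm S"
    and x: "(x has_vector_derivative (c *\<^sub>R x t + n)) (at t within X)"
    and X: "\<forall>\<^sub>F h in at_right 0. t + h \<in> X"
  shows "dini_le (\<lambda>t. S (x t)) t (c * S (x t) + S n)"
proof (rule dini_le_I_eventually)
  fix e :: real assume e: "e > 0"
  have "\<forall>\<^sub>F h in at_right 0. h < 1 / (\<bar>c\<bar> + 1)"
    using order_tendstoD(2)[OF tendsto_ident_at[of 0 "{0<..}"], of "1 / (\<bar>c\<bar> + 1)"] by simp
  then show "\<forall>\<^sub>F h in at_right 0. S (x (t + h)) \<le> S (x t) + h * (c * S (x t) + S n) + h * e"
    using seminorm_along_curve[OF S e x X] eventually_at_right_less[of 0]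
  proof eventually_elim
    case (elim h)
    have "h * (\<bar>c\<bar> + 1) < 1" using elim(1) by (simp add: pos_less_divide_eq)
    then have "h * \<bar>c\<bar> \<le> 1" using elim(3) by (simp add: algebra_simps)
    moreover have "\<bar>h * c\<bar> = h * \<bar>c\<bar>" using elim(3) by (simp add: abs_mult)
    ultimately have hc: "1 + h * c \<ge> 0" by linarith
    define y where "y = x t + h *\<^sub>R (c *\<^sub>R x t + n)"
    have "S (x (t + h)) \<le> S (x (t + h) - y) + S y" using bounded_seminormD(1)[OF S, of "x (t + h) - y" y] by simp
    also have "S y = S ((1 + h * c) *\<^sub>R x t + h *\<^sub>R n)" by (simp add: y_def algebra_simps)
    also have "\<dots> \<le> (1 + h * c) * S (x t) + h * S n"
      using bounded_seminormD(1)[OF S, of "(1 + h * c) *\<^sub>R x t" "h *\<^sub>R n"] hc elim(3)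
      by (simp add: bounded_seminormD(2)[OF S])
    finally show ?case using elim(2) by (simp add: y_def algebra_simps)
  qed
qed

text \<open>The lower bound that corresponds to \<open>dini_le_seminorm\<close>: an expanding linear part makes the
  seminorm grow.\<close>

lemma dini_le_minus_seminorm:
  fixes x :: "real \<Rightarrow> 'a::real_normed_vector"
  assumes S: "bounded_seminorm S"
    and x: "(x has_vector_derivative (c *\<^sub>R x t - n)) (at t within X)"
    and X: "\<forall>\<^sub>F h in at_right 0. t + h \<in> X"
  shows "dini_le (\<lambda>t. - S (x t)) t (S n - c * S (x t))"
proof (rule dini_le_I_eventually)
  fix e :: real assume e: "e > 0"
  show "\<forall>\<^sub>F h in at_right 0. - S (x (t + h)) \<le> - S (x t) + h * (S n - c * S (x t)) + h * e"
    using seminorm_along_curve[OF S e x X] eventually_at_right_less[of 0]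
  proof eventually_elim
    case (elim h)
    define y where "y = x t + h *\<^sub>R (c *\<^sub>R x t - n)"
    have "(1 + h * c) * S (x t) \<le> S ((1 + h * c) *\<^sub>R x t)"
      by (simp add: bounded_seminormD(2)[OF S] mult_right_mono bounded_seminormD(3)[OF S])
    also have "\<dots> = S (y + h *\<^sub>R n)" by (simp add: y_def algebra_simps)
    also have "\<dots> \<le> S y + h * S n"
      using bounded_seminormD(1)[OF S, of y "h *\<^sub>R n"] elim(2) by (simp add: bounded_seminormD(2)[OF S])
    also have "S y \<le> S (x (t + h)) + S (x (t + h) - y)"
      using bounded_seminormD(6)[OF S, of "x (t + h)" "x (t + h) - y"] by simp
    finally show ?case using elim(1) by (simp add: y_def algebra_simps)
  qed
qed

lemma cosh_le_exp: "x \<ge> 0 \<Longrightarrow> cosh (- x) \<le> exp x" for x :: real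
  by (simp add: cosh_field_def)

text \<open>A negative \<open>W 0\<close> would force \<open>W t \<le> exp (\<nu> t) W 0\<close>, which is more negative than the growth
  hypothesis permits.\<close>

lemma cosh_growth_excludes_faster:
  assumes W: "continuous_on {0..} W" "\<And>t. t \<ge> 0 \<Longrightarrow> dini_le W t (\<nu> * W t)"
    and \<nu>: "\<nu> > \<gamma>" "\<gamma> \<ge> 0" and growth: "\<And>t. t \<ge> 0 \<Longrightarrow> - W t \<le> K * cosh (\<gamma> * t)"
  shows "W 0 \<ge> 0"
proof (rule tendsto_upperbound)
  have le: "W 0 \<ge> - (\<bar>K\<bar> * exp (- (\<nu> - \<gamma>)) ^ n)" for n
  proof -
    have "W (real n) \<le> exp (\<nu> * (real n - 0)) * W 0"
      by (rule dini_le_exp_bound) (use W in \<open>auto intro: continuous_on_subset\<close>)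
    moreover have "- W (real n) \<le> \<bar>K\<bar> * exp (\<gamma> * real n)"
    proof -
      have "- W (real n) \<le> K * cosh (\<gamma> * real n)" by (rule growth) simp
      also have "\<dots> \<le> \<bar>K\<bar> * exp (\<gamma> * real n)"
        using cosh_le_exp[of "\<gamma> * real n"] \<nu> by (intro mult_mono) auto
      finally show ?thesis .
    qed
    ultimately have "exp (- (\<nu> * real n)) * (- (\<bar>K\<bar> * exp (\<gamma> * real n))) \<le> exp (- (\<nu> * real n)) * (exp (\<nu> * real n) * W 0)"
      by (intro mult_left_mono) auto
    also have "\<dots> = W 0" by (simp add: mult.assoc[symmetric] exp_add[symmetric])
    also have "exp (- (\<nu> * real n)) * (- (\<bar>K\<bar> * exp (\<gamma> * real n))) = - (\<bar>K\<bar> * (exp (- (\<nu> * real n)) * exp (\<gamma> * real n)))"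
      by simp
    also have "exp (- (\<nu> * real n)) * exp (\<gamma> * real n) = exp (- (\<nu> - \<gamma>)) ^ n"
      by (simp add: exp_add[symmetric] exp_of_nat_mult[symmetric] algebra_simps)
    finally show ?thesis .
  qed
  then show "\<forall>\<^sub>F n in sequentially. - (\<bar>K\<bar> * exp (- (\<nu> - \<gamma>)) ^ n) \<le> W 0" by simp
  have "(\<lambda>n. exp (- (\<nu> - \<gamma>)) ^ n) \<longlonglongrightarrow> 0"
    by (rule LIMSEQ_power_zero) (use \<nu> in simp)
  from tendsto_minus[OF tendsto_mult_right_zero[OF this, of "\<bar>K\<bar>"]]
  show "(\<lambda>n. - (\<bar>K\<bar> * exp (- (\<nu> - \<gamma>)) ^ n)) \<longlonglongrightarrow> 0" by simp
qed simp

section \<open>Fixed points in weighted spaces of curves\<close>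

text \<open>The two integrals make this the primitive that vanishes at \<open>0\<close> on both sides of \<open>0\<close>, since an
  integral over an empty interval is \<open>0\<close>.\<close>

definition primitive :: "(real \<Rightarrow> 'a::banach) \<Rightarrow> real \<Rightarrow> 'a" where
  "primitive f t = integral {0..t} f - integral {t..0} f"

lemma primitive_0 [simp]: "primitive f 0 = 0"
  by (simp add: primitive_def)

lemma primitive_diff:
  assumes "continuous_on UNIV f" "continuous_on UNIV g"
  shows "primitive (\<lambda>r. f r - g r) t = primitive f t - primitive g t"
proof -
  have "integral {a..b} (\<lambda>r. f r - g r) = integral {a..b} f - integral {a..b} g" for a b
    by (intro integral_diff integrable_continuous_real) (use assms continuous_on_subset in blast)+
  then show ?thesis by (simp add: primitive_def)
qed

lemma primitive_has_vector_derivative: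
  assumes f: "continuous_on UNIV f"
  shows "(primitive f has_vector_derivative f t) (at t)"
proof -
  define n where "n = \<bar>t\<bar> + 1"
  have n: "- n < t" "t < n" "0 < n" by (auto simp: n_def)
  have fc: "continuous_on A f" for A using f continuous_on_subset by blast
  have eq: "integral {- n..u} f - integral {- n..0} f = primitive f u" if "u \<in> {- n<..<n}" for u
  proof (cases "u \<ge> 0")
    case True
    then have "integral {- n..0} f + integral {0..u} f = integral {- n..u} f"
      using n by (intro Henstock_Kurzweil_Integration.integral_combine integrable_continuous_real fc) auto
    then show ?thesis using True by (cases "u = 0") (auto simp: primitive_def algebra_simps)
  next
    case False
    then have "integral {- n..u} f + integral {u..0} f = integral {- n..0} f"
      using n that by (intro Henstock_Kurzweil_Integration.integral_combine integrable_continuous_real fc) auto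
    then show ?thesis using False by (auto simp: primitive_def algebra_simps)
  qed
  have "((\<lambda>u. integral {- n..u} f) has_vector_derivative f t) (at t within {- n..n})"
    using n by (intro integral_has_vector_derivative fc) auto
  then have "((\<lambda>u. integral {- n..u} f) has_vector_derivative f t) (at t within {- n<..<n})"
    by (rule has_vector_derivative_within_subset) auto
  then have "((\<lambda>u. integral {- n..u} f) has_vector_derivative f t) (at t)"
    using n by (subst (asm) has_vector_derivative_within_open) auto
  then have "((\<lambda>u. integral {- n..u} f - integral {- n..0} f) has_vector_derivative f t) (at t)"
    by (auto intro!: derivative_eq_intros)
  then show ?thesis
    by (rule has_vector_derivative_transform_within_open[of _ _ _ "{- n<..<n}"]) (use n eq in auto)
qed

lemma primitive_continuous: "continuous_on UNIV f \<Longrightarrow> continuous_on A (primitive f)"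
  by (meson primitive_has_vector_derivative has_vector_derivative_continuous
      continuous_at_imp_continuous_on)

lemma norm_diff_le_of_derivative:
  fixes x :: "real \<Rightarrow> 'a::real_normed_vector"
  assumes ab: "a \<le> b"
    and x: "\<And>t. (x has_vector_derivative v t) (at t)"
    and \<phi>: "\<And>t. (\<phi> has_real_derivative \<phi>' t) (at t)"
    and le: "\<And>t. norm (v t) \<le> \<phi>' t"
  shows "norm (x b - x a) \<le> \<phi> b - \<phi> a"
proof (cases "a = b")
  case False
  show ?thesis
  proof (rule differentiable_bound_general)
    show "a < b" using ab False by simp
    show "continuous_on {a..b} x"
      using x by (meson has_vector_derivative_continuous continuous_at_imp_continuous_on)
    show "continuous_on {a..b} \<phi>"
      using \<phi> by (meson DERIV_isCont continuous_at_imp_continuous_on)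
    show "(\<phi> has_vector_derivative \<phi>' t) (at t)" for t
      using \<phi>[of t] by (simp add: has_real_derivative_iff_has_vector_derivative)
  qed (use x le in auto)
qed simp

text \<open>The weight \<open>cosh (\<gamma> t)\<close> stands in for \<open>exp (\<gamma> \<bar>t\<bar>)\<close>. It is smooth with smooth primitive
  \<open>sinh (\<gamma> t) / \<gamma>\<close>, so bounds for integrals reduce to a comparison of derivatives.\<close>

lemma norm_primitive_le:
  fixes f :: "real \<Rightarrow> 'a::banach"
  assumes f: "continuous_on UNIV f" and \<gamma>: "\<gamma> > 0"
    and le: "\<And>t. norm (f t) \<le> K * cosh (\<gamma> * t)"
  shows "norm (primitive f t) \<le> K / \<gamma> * cosh (\<gamma> * t)"
proof -
  have K: "K \<ge> 0" using le[of 0] by (simp add: norm_ge_zero[THEN order_trans])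
  have d: "((\<lambda>t. K / \<gamma> * sinh (\<gamma> * t)) has_real_derivative K * cosh (\<gamma> * t)) (at t)" for t
    using \<gamma> by (auto intro!: derivative_eq_intros)
  have *: "norm (primitive f b - primitive f a) \<le> K / \<gamma> * sinh (\<gamma> * b) - K / \<gamma> * sinh (\<gamma> * a)" if "a \<le> b" for a b
    by (rule norm_diff_le_of_derivative[OF that primitive_has_vector_derivative[OF f] d le])
  have s: "sinh x \<le> cosh x" "- sinh x \<le> cosh x" for x :: real
    using sinh_le_cosh_real[of x] sinh_le_cosh_real[of "- x"] by auto
  show ?thesis
  proof (cases "t \<ge> 0")
    case True
    have "norm (primitive f t) \<le> K / \<gamma> * sinh (\<gamma> * t)" using *[OF True] by simp
    also have "\<dots> \<le> K / \<gamma> * cosh (\<gamma> * t)" using K \<gamma> by (intro mult_left_mono s) auto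
    finally show ?thesis .
  next
    case False
    then have "norm (primitive f t) \<le> K / \<gamma> * (- sinh (\<gamma> * t))" using *[of t 0] by simp
    also have "\<dots> \<le> K / \<gamma> * cosh (\<gamma> * t)" using K \<gamma> by (intro mult_left_mono s) auto
    finally show ?thesis .
  qed
qed

text \<open>Banach's fixed point theorem for curves bounded by a multiple of \<open>w\<close>. Division by \<open>w\<close> identifies
  these curves with the bounded continuous functions.\<close>

lemma weighted_fixpoint:
  fixes T :: "(real \<Rightarrow> 'z::banach) \<Rightarrow> real \<Rightarrow> 'z" and w :: "real \<Rightarrow> real"
  assumes w: "continuous_on UNIV w" "\<And>t. w t > 0"
    and cont: "\<And>u K. continuous_on UNIV u \<Longrightarrow> (\<And>t. norm (u t) \<le> K * w t) \<Longrightarrow> continuous_on UNIV (T u)"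
    and bound: "\<And>t. norm (T (\<lambda>_. 0) t) \<le> K0 * w t"
    and contr: "\<And>u v C C' K t. continuous_on UNIV u \<Longrightarrow> (\<And>t. norm (u t) \<le> C * w t) \<Longrightarrow>
      continuous_on UNIV v \<Longrightarrow> (\<And>t. norm (v t) \<le> C' * w t) \<Longrightarrow>
      (\<And>t. norm (u t - v t) \<le> K * w t) \<Longrightarrow> norm (T u t - T v t) \<le> K / 2 * w t"
  obtains u K where "continuous_on UNIV u" "\<And>t. norm (u t) \<le> K * w t" "\<And>t. T u t = u t"
proof -
  define U where "U v = (\<lambda>r. w r *\<^sub>R apply_bcontfun v r)" for v :: "real \<Rightarrow>\<^sub>C 'z"
  have U_cont: "continuous_on UNIV (U v)" for v
    unfolding U_def by (intro continuous_intros w) auto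
  have U_bound: "norm (U v t) \<le> norm v * w t" for v t
    using norm_bounded[of v t] w(2)[of t] by (simp add: U_def mult.commute)
  have U_diff: "norm (U v t - U v' t) \<le> dist v v' * w t" for v v' t
  proof -
    have "U v t - U v' t = w t *\<^sub>R (apply_bcontfun v t - apply_bcontfun v' t)"
      by (simp add: U_def scaleR_diff_right)
    then have "norm (U v t - U v' t) = w t * dist (apply_bcontfun v t) (apply_bcontfun v' t)"
      using w(2)[of t] by (simp add: dist_norm)
    also have "\<dots> \<le> w t * dist v v'" using w(2)[of t] by (intro mult_left_mono dist_bounded) auto
    finally show ?thesis by (simp add: mult.commute)
  qed
  have T_bound: "norm (T (U v) t) \<le> (norm v / 2 + K0) * w t" for v t
  proof -
    have "norm (T (U v) t - T (\<lambda>_. 0) t) \<le> norm v / 2 * w t"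
      by (rule contr[OF U_cont U_bound, of "\<lambda>_. 0" 0]) (auto simp: U_bound)
    then show ?thesis using bound[of t] norm_triangle_sub[of "T (U v) t" "T (\<lambda>_. 0) t"]
      by (simp add: algebra_simps)
  qed
  define B where "B v = Bcontfun (\<lambda>t. T (U v) t /\<^sub>R w t)" for v
  have B: "apply_bcontfun (B v) = (\<lambda>t. T (U v) t /\<^sub>R w t)" for v
    unfolding B_def
  proof (rule Bcontfun_inverse, rule bcontfun_normI)
    show "continuous_on UNIV (\<lambda>t. T (U v) t /\<^sub>R w t)"
      by (intro continuous_intros w cont[OF U_cont U_bound]) (use w(2) in \<open>metis less_irrefl\<close>)
    fix t
    show "norm (T (U v) t /\<^sub>R w t) \<le> norm v / 2 + K0"
      using T_bound[of v t] w(2)[of t] by (simp add: field_simps)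
  qed
  have "dist (B v) (B v') \<le> 1/2 * dist v v'" for v v'
  proof (rule dist_bound)
    fix t
    have "norm (T (U v) t - T (U v') t) \<le> dist v v' / 2 * w t"
      by (rule contr[OF U_cont U_bound U_cont U_bound U_diff])
    moreover have "apply_bcontfun (B v) t - apply_bcontfun (B v') t = (T (U v) t - T (U v') t) /\<^sub>R w t"
      by (simp add: B scaleR_diff_right)
    then have "dist (apply_bcontfun (B v) t) (apply_bcontfun (B v') t) = norm (T (U v) t - T (U v') t) / w t"
      using w(2)[of t] by (simp add: dist_norm divide_inverse mult.commute)
    ultimately show "dist (apply_bcontfun (B v) t) (apply_bcontfun (B v') t) \<le> 1/2 * dist v v'"
      using w(2)[of t] by (simp add: pos_divide_le_eq)
  qed
  then obtain v where v: "B v = v" using banach_fix_type[of "1/2" B] by auto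
  have "T (U v) t = U v t" for t
    using fun_cong[OF B[of v], of t] v w(2)[of t] by (simp add: U_def)
  then show ?thesis by (intro that[of "U v", OF U_cont U_bound])
qed

text \<open>The weight \<open>cosh (c t)\<close> with \<open>c > 2 L\<close> makes the Picard operator a contraction on the whole line at
  once, so no gluing of local solutions is needed.\<close>

lemma lipschitz_ivp:
  fixes H :: "'z::banach \<Rightarrow> 'z"
  assumes L: "\<And>x y. norm (H x - H y) \<le> L * norm (x - y)"
  shows "\<exists>u. u 0 = z0 \<and> (\<forall>t. (u has_vector_derivative H (u t)) (at t))"
proof -
  define c where "c = 2 * \<bar>L\<bar> + 1"
  have c: "c > 0" by (simp add: c_def)
  have L': "norm (H x - H y) \<le> \<bar>L\<bar> * norm (x - y)" for x y
    by (rule order_trans[OF L]) (auto intro: mult_right_mono)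
  have "\<bar>L\<bar>-lipschitz_on UNIV H" by (rule lipschitz_onI) (use L' in \<open>auto simp: dist_norm\<close>)
  then have H: "continuous_on A H" for A
    using lipschitz_on_continuous_on lipschitz_on_subset by blast
  have Hu: "continuous_on UNIV (\<lambda>r. H (u r))" if "continuous_on UNIV u" for u :: "real \<Rightarrow> 'z"
    by (rule continuous_on_compose2[OF H that]) auto
  obtain u K where u: "continuous_on UNIV u" "\<And>t. z0 + primitive (\<lambda>r. H (u r)) t = u t"
  proof (rule weighted_fixpoint[of "\<lambda>t. cosh (c * t)" "\<lambda>u t. z0 + primitive (\<lambda>r. H (u r)) t"
        "norm z0 + norm (H 0) / c"])
    show "continuous_on UNIV (\<lambda>t. cosh (c * t))" by (intro continuous_intros)
    fix u :: "real \<Rightarrow> 'z" and K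
    assume u: "continuous_on UNIV u"
    show "continuous_on UNIV (\<lambda>t. z0 + primitive (\<lambda>r. H (u r)) t)"
      by (intro continuous_intros primitive_continuous Hu u)
  next
    fix t
    have le: "norm (H 0) \<le> norm (H 0) * cosh (c * r)" for r
      by (simp add: mult_le_cancel_left1 cosh_real_ge_1)
    have "norm (primitive (\<lambda>r. H 0) t) \<le> norm (H 0) / c * cosh (c * t)"
      using norm_primitive_le[OF _ c, of "\<lambda>_. H 0"] le by auto
    moreover have "norm z0 \<le> norm z0 * cosh (c * t)"
      by (simp add: mult_le_cancel_left1 cosh_real_ge_1)
    ultimately show "norm (z0 + primitive (\<lambda>r. H 0) t) \<le> (norm z0 + norm (H 0) / c) * cosh (c * t)"
      by (smt (verit) norm_triangle_ineq distrib_right)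
  next
    fix u v :: "real \<Rightarrow> 'z" and C C' K t
    assume uv: "continuous_on UNIV u" "continuous_on UNIV v"
      and d: "\<And>t. norm (u t - v t) \<le> K * cosh (c * t)"
    have K: "K \<ge> 0" using d[of 0] by (simp add: norm_ge_zero[THEN order_trans])
    have "norm (primitive (\<lambda>r. H (u r) - H (v r)) t) \<le> (\<bar>L\<bar> * K) / c * cosh (c * t)"
    proof (rule norm_primitive_le[OF _ c])
      show "continuous_on UNIV (\<lambda>r. H (u r) - H (v r))" by (intro continuous_intros Hu uv)
      fix r
      show "norm (H (u r) - H (v r)) \<le> \<bar>L\<bar> * K * cosh (c * r)"
        using L'[of "u r" "v r"] mult_left_mono[OF d[of r], of "\<bar>L\<bar>"] by (simp add: mult.assoc)
    qed
    also have "\<dots> \<le> K / 2 * cosh (c * t)"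
    proof (rule mult_right_mono)
      show "\<bar>L\<bar> * K / c \<le> K / 2" using K c by (simp add: c_def field_simps)
    qed simp
    finally show "norm (z0 + primitive (\<lambda>r. H (u r)) t - (z0 + primitive (\<lambda>r. H (v r)) t)) \<le> K / 2 * cosh (c * t)"
      using primitive_diff[OF Hu Hu, OF uv] by simp
  qed auto
  show ?thesis
  proof (intro exI[of _ u] conjI allI)
    show "u 0 = z0" using u(2)[of 0] by simp
    fix t
    have "((\<lambda>t. z0 + primitive (\<lambda>r. H (u r)) t) has_vector_derivative H (u t)) (at t)"
      using primitive_has_vector_derivative[OF Hu[OF u(1)], of t] by (auto intro!: derivative_eq_intros)
    then show "(u has_vector_derivative H (u t)) (at t)" using u(2) by simp
  qed
qed

text \<open>This is \<open>\<integral> exp (- \<mu> (t - r)) f(r) dr\<close> over \<open>(-\<infinity>, t]\<close>, the solution of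
  \<open>s' = - \<mu> s + f\<close> that retains no memory of an initial value. The improper integral is written
  as a limit of primitives.\<close>

definition response :: "real \<Rightarrow> (real \<Rightarrow> 'a::banach) \<Rightarrow> real \<Rightarrow> 'a" where
  "response \<mu> f t = exp (- \<mu> * t) *\<^sub>R (primitive (\<lambda>r. exp (\<mu> * r) *\<^sub>R f r) t
      - lim (\<lambda>n. primitive (\<lambda>r. exp (\<mu> * r) *\<^sub>R f r) (- real n)))"

text \<open>The derivative of \<open>\<phi>\<close> dominates the integrand because \<open>sinh \<ge> - cosh\<close>, and \<open>\<phi>\<close> vanishes at
  \<open>-\<infinity>\<close> because \<open>\<gamma> < \<mu>\<close>.\<close>

lemma response_limit:
  fixes f :: "real \<Rightarrow> 'a::banach"
  assumes f: "continuous_on UNIV f" and \<gamma>: "0 < \<gamma>" "\<gamma> < \<mu>"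
    and le: "\<And>t. norm (f t) \<le> K * cosh (\<gamma> * t)"
  defines "I \<equiv> primitive (\<lambda>r. exp (\<mu> * r) *\<^sub>R f r)"
  defines "\<phi> \<equiv> (\<lambda>t. K / (\<mu> - \<gamma>) * (exp (\<mu> * t) * cosh (\<gamma> * t)))"
  shows "convergent (\<lambda>n. I (- real n))"
    and "norm (I t - lim (\<lambda>n. I (- real n))) \<le> \<phi> t"
proof -
  have K: "K \<ge> 0" using le[of 0] by (simp add: norm_ge_zero[THEN order_trans])
  have cont: "continuous_on UNIV (\<lambda>r. exp (\<mu> * r) *\<^sub>R f r)" by (intro continuous_intros f)
  have d\<phi>: "(\<phi> has_real_derivative K / (\<mu> - \<gamma>) * (exp (\<mu> * t) * (\<mu> * cosh (\<gamma> * t) + \<gamma> * sinh (\<gamma> * t)))) (at t)" for t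
    unfolding \<phi>_def
    by (intro DERIV_cmult) (auto intro!: derivative_eq_intros simp: algebra_simps)
  have *: "norm (I b - I a) \<le> \<phi> b - \<phi> a" if "a \<le> b" for a b
    unfolding I_def
  proof (rule norm_diff_le_of_derivative[OF that primitive_has_vector_derivative[OF cont] d\<phi>])
    fix t
    have "- sinh (\<gamma> * t) \<le> cosh (\<gamma> * t)" using sinh_le_cosh_real[of "- (\<gamma> * t)"] by simp
    then have "\<gamma> * (- sinh (\<gamma> * t)) \<le> \<gamma> * cosh (\<gamma> * t)" using \<gamma> by (intro mult_left_mono) auto
    then have s: "(\<mu> - \<gamma>) * cosh (\<gamma> * t) \<le> \<mu> * cosh (\<gamma> * t) + \<gamma> * sinh (\<gamma> * t)"
      by (simp add: algebra_simps)
    have "norm (exp (\<mu> * t) *\<^sub>R f t) \<le> exp (\<mu> * t) * (K * cosh (\<gamma> * t))" using le[of t] by simp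
    also have "\<dots> = K / (\<mu> - \<gamma>) * (exp (\<mu> * t) * ((\<mu> - \<gamma>) * cosh (\<gamma> * t)))" using \<gamma> by simp
    also have "\<dots> \<le> K / (\<mu> - \<gamma>) * (exp (\<mu> * t) * (\<mu> * cosh (\<gamma> * t) + \<gamma> * sinh (\<gamma> * t)))"
      using \<gamma> K s by (intro mult_left_mono) auto
    finally show "norm (exp (\<mu> * t) *\<^sub>R f t)
        \<le> K / (\<mu> - \<gamma>) * (exp (\<mu> * t) * (\<mu> * cosh (\<gamma> * t) + \<gamma> * sinh (\<gamma> * t)))" .
  qed
  have \<phi>_nonneg: "\<phi> t \<ge> 0" for t unfolding \<phi>_def using K \<gamma> by simp
  have \<phi>_le: "\<phi> (- real n) \<le> K / (\<mu> - \<gamma>) * exp (- ((\<mu> - \<gamma>) * real n))" for n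
  proof -
    have "exp (\<mu> * (- real n)) * cosh (- (\<gamma> * real n)) \<le> exp (\<mu> * (- real n)) * exp (\<gamma> * real n)"
      using \<gamma> by (intro mult_left_mono cosh_le_exp) auto
    also have "\<dots> = exp (- ((\<mu> - \<gamma>) * real n))" by (simp add: exp_add[symmetric] algebra_simps)
    finally show ?thesis unfolding \<phi>_def using K \<gamma> by (intro mult_left_mono) auto
  qed
  have lim0: "(\<lambda>n. \<phi> (- real n)) \<longlonglongrightarrow> 0"
  proof (rule tendsto_sandwich[OF _ _ tendsto_const])
    have "(\<lambda>n. exp (- (\<mu> - \<gamma>)) ^ n) \<longlonglongrightarrow> 0"
      by (rule LIMSEQ_power_zero) (use \<gamma> in simp)
    then have "(\<lambda>n. exp (- ((\<mu> - \<gamma>) * real n))) \<longlonglongrightarrow> 0"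
      by (simp add: exp_of_nat_mult[symmetric] algebra_simps)
    from tendsto_mult_right_zero[OF this, of "K / (\<mu> - \<gamma>)"]
    show "(\<lambda>n. K / (\<mu> - \<gamma>) * exp (- ((\<mu> - \<gamma>) * real n))) \<longlonglongrightarrow> 0" .
  qed (use \<phi>_nonneg \<phi>_le in simp_all)
  have "Cauchy (\<lambda>n. I (- real n))"
  proof (rule CauchyI')
    fix e :: real assume "e > 0"
    then obtain M where M: "\<And>n. n \<ge> M \<Longrightarrow> \<phi> (- real n) < e"
      using order_tendstoD(2)[OF lim0, of e] by (auto simp: eventually_sequentially)
    have "dist (I (- real m)) (I (- real n)) < e" if "m \<ge> M" "n > m" for m n
      using *[of "- real n" "- real m"] M[OF that(1)] \<phi>_nonneg[of "- real n"] that by (simp add: dist_norm)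
    then show "\<exists>M. \<forall>m\<ge>M. \<forall>n>m. dist (I (- real m)) (I (- real n)) < e" by blast
  qed
  then show conv: "convergent (\<lambda>n. I (- real n))" by (rule Cauchy_convergent)
  show "norm (I t - lim (\<lambda>n. I (- real n))) \<le> \<phi> t"
  proof (rule tendsto_upperbound)
    show "(\<lambda>n. norm (I t - I (- real n))) \<longlonglongrightarrow> norm (I t - lim (\<lambda>n. I (- real n)))"
      using conv by (intro tendsto_intros) (simp add: convergent_LIMSEQ_iff)
    have "\<forall>\<^sub>F n in sequentially. - real n \<le> t"
      using eventually_ge_at_top[of "nat \<lceil>- t\<rceil>"] by eventually_elim linarith
    then show "\<forall>\<^sub>F n in sequentially. norm (I t - I (- real n)) \<le> \<phi> t"
    proof eventually_elim
      case (elim n)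
      then show ?case using *[OF elim] \<phi>_nonneg[of "- real n"] by simp
    qed
  qed simp
qed

lemma norm_response_le:
  fixes f :: "real \<Rightarrow> 'a::banach"
  assumes "continuous_on UNIV f" "0 < \<gamma>" "\<gamma> < \<mu>" "\<And>t. norm (f t) \<le> K * cosh (\<gamma> * t)"
  shows "norm (response \<mu> f t) \<le> K / (\<mu> - \<gamma>) * cosh (\<gamma> * t)"
proof -
  have "norm (response \<mu> f t) \<le> exp (- \<mu> * t) * (K / (\<mu> - \<gamma>) * (exp (\<mu> * t) * cosh (\<gamma> * t)))"
    unfolding response_def norm_scaleR abs_exp_cancel by (intro mult_left_mono response_limit(2)[OF assms]) auto
  also have "\<dots> = K / (\<mu> - \<gamma>) * cosh (\<gamma> * t)"
    by (simp add: exp_minus field_simps)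
  finally show ?thesis .
qed

lemma response_diff:
  fixes f :: "real \<Rightarrow> 'a::banach"
  assumes f: "continuous_on UNIV f" "\<And>t. norm (f t) \<le> K * cosh (\<gamma> * t)"
    and g: "continuous_on UNIV g" "\<And>t. norm (g t) \<le> K' * cosh (\<gamma> * t)"
    and \<gamma>: "0 < \<gamma>" "\<gamma> < \<mu>"
  shows "response \<mu> (\<lambda>r. f r - g r) t = response \<mu> f t - response \<mu> g t"
proof -
  have eq: "primitive (\<lambda>r. exp (\<mu> * r) *\<^sub>R (f r - g r)) t
     = primitive (\<lambda>r. exp (\<mu> * r) *\<^sub>R f r) t - primitive (\<lambda>r. exp (\<mu> * r) *\<^sub>R g r) t" for t
    unfolding scaleR_diff_right by (intro primitive_diff continuous_intros f g)
  have "lim (\<lambda>n. primitive (\<lambda>r. exp (\<mu> * r) *\<^sub>R (f r - g r)) (- real n))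
     = lim (\<lambda>n. primitive (\<lambda>r. exp (\<mu> * r) *\<^sub>R f r) (- real n))
      - lim (\<lambda>n. primitive (\<lambda>r. exp (\<mu> * r) *\<^sub>R g r) (- real n))"
    unfolding eq using response_limit(1)[OF f(1) \<gamma> f(2)] response_limit(1)[OF g(1) \<gamma> g(2)]
    by (intro limI tendsto_diff) (simp_all add: convergent_LIMSEQ_iff)
  then show ?thesis unfolding response_def eq[of t] by (simp only: scaleR_diff_right) simp
qed

lemma response_has_vector_derivative:
  fixes f :: "real \<Rightarrow> 'a::banach"
  assumes f: "continuous_on UNIV f"
  shows "(response \<mu> f has_vector_derivative (- \<mu> *\<^sub>R response \<mu> f t + f t)) (at t)"
proof -
  define l where "l = lim (\<lambda>n. primitive (\<lambda>r. exp (\<mu> * r) *\<^sub>R f r) (- real n))"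
  have cont: "continuous_on UNIV (\<lambda>r. exp (\<mu> * r) *\<^sub>R f r)" by (intro continuous_intros f)
  have 1: "((\<lambda>t. exp (- \<mu> * t)) has_real_derivative - \<mu> * exp (- \<mu> * t)) (at t)"
    by (auto intro!: derivative_eq_intros)
  have 2: "((\<lambda>t. primitive (\<lambda>r. exp (\<mu> * r) *\<^sub>R f r) t - l) has_vector_derivative exp (\<mu> * t) *\<^sub>R f t) (at t)"
    using primitive_has_vector_derivative[OF cont, of t] by (auto intro!: derivative_eq_intros)
  have "(response \<mu> f has_vector_derivative (exp (- \<mu> * t) *\<^sub>R (exp (\<mu> * t) *\<^sub>R f t)
      + (- \<mu> * exp (- \<mu> * t)) *\<^sub>R (primitive (\<lambda>r. exp (\<mu> * r) *\<^sub>R f r) t - l))) (at t)"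
    unfolding response_def[abs_def] l_def[symmetric] by (rule has_vector_derivative_scaleR[OF 1 2])
  then show ?thesis
    by (simp add: response_def l_def[symmetric] exp_minus)
qed

section \<open>Uniqueness\<close>

text \<open>Gronwall's inequality for the distance of the two curves.\<close>

lemma ode_unique_forward:
  fixes H :: "'z::real_normed_vector \<Rightarrow> 'z"
  assumes H: "\<And>x y. norm (H x - H y) \<le> L * norm (x - y)"
    and x: "\<And>t. t \<in> {a..b} \<Longrightarrow> (x has_vector_derivative H (x t)) (at t within {a..b})"
    and y: "\<And>t. t \<in> {a..b} \<Longrightarrow> (y has_vector_derivative H (y t)) (at t within {a..b})"
    and eq: "x a = y a" and ab: "a \<le> b"
  shows "x b = y b"
proof -
  have d: "((\<lambda>t. x t - y t) has_vector_derivative (H (x t) - H (y t))) (at t within {a..b})"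
    if "t \<in> {a..b}" for t
    using x[OF that] y[OF that] by (rule has_vector_derivative_diff)
  have "norm (x b - y b) \<le> exp (L * (b - a)) * norm (x a - y a)"
  proof (rule dini_le_exp_bound[OF _ ab])
    show "continuous_on {a..b} (\<lambda>t. norm (x t - y t))"
      by (intro continuous_on_norm continuous_on_vector_derivative[OF d])
    fix t assume t: "a \<le> t" "t < b"
    have "\<forall>\<^sub>F h in at_right 0. h < b - t"
      using t order_tendstoD(2)[OF tendsto_ident_at[of 0 "{0<..}"], of "b - t"] by simp
    then have "\<forall>\<^sub>F h in at_right 0. t + h \<in> {a..b}"
      using eventually_at_right_less[of 0] by eventually_elim (use t in auto)
    then have "dini_le (\<lambda>t. norm (x t - y t)) t (0 * norm (x t - y t) + norm (H (x t) - H (y t)))"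
      using d[of t] t by (intro dini_le_seminorm[OF bounded_seminorm_norm]) auto
    then show "dini_le (\<lambda>t. norm (x t - y t)) t (L * norm (x t - y t))"
      by (rule dini_le_mono) (use H in simp)
  qed
  then show ?thesis using eq by simp
qed

lemma has_vector_derivative_reverse:
  assumes "(x has_vector_derivative v) (at (- t) within uminus ` X)"
  shows "((\<lambda>r. x (- r)) has_vector_derivative - v) (at t within X)"
proof -
  have "(uminus has_vector_derivative - (1::real)) (at t within X)"
    by (auto intro!: derivative_eq_intros)
  from vector_diff_chain_within[OF this, of x v] assms show ?thesis by (simp add: o_def)
qed

lemma ode_unique_backward:
  fixes H :: "'z::real_normed_vector \<Rightarrow> 'z"
  assumes H: "\<And>x y. norm (H x - H y) \<le> L * norm (x - y)"
    and x: "\<And>t. t \<in> {a..b} \<Longrightarrow> (x has_vector_derivative H (x t)) (at t within {a..b})"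
    and y: "\<And>t. t \<in> {a..b} \<Longrightarrow> (y has_vector_derivative H (y t)) (at t within {a..b})"
    and eq: "x b = y b" and ab: "a \<le> b"
  shows "x a = y a"
proof -
  have "x (- (- a)) = y (- (- a))"
  proof (rule ode_unique_forward[where H = "\<lambda>z. - H z" and L = L and a = "- b" and b = "- a"])
    show "norm (- H x - - H y) \<le> L * norm (x - y)" for x y
      using H[of x y] by (simp add: norm_minus_commute)
    fix t assume t: "t \<in> {- b..- a}"
    show "((\<lambda>r. x (- r)) has_vector_derivative - H (x (- t))) (at t within {- b..- a})"
      using x[of "- t"] t by (intro has_vector_derivative_reverse) auto
    show "((\<lambda>r. y (- r)) has_vector_derivative - H (y (- t))) (at t within {- b..- a})"
      using y[of "- t"] t by (intro has_vector_derivative_reverse) auto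
  qed (use eq ab in auto)
  then show ?thesis by simp
qed

text \<open>Only \<open>y\<close> is known to stay in \<open>U\<close>; the curve \<open>x\<close> has to follow \<open>H\<close> only while it is in \<open>U\<close>. The set
  of times at which the curves agree is closed in \<open>J\<close>, and it is open because a curve that meets
  \<open>y\<close> is in \<open>U\<close> for nearby times.\<close>

lemma ode_unique_in_open:
  fixes H :: "'z::real_normed_vector \<Rightarrow> 'z"
  assumes H: "\<And>x y. norm (H x - H y) \<le> L * norm (x - y)"
    and J: "is_interval J" "t0 \<in> J" and U: "open U"
    and x: "continuous_on J x"
      "\<And>t. t \<in> J \<Longrightarrow> x t \<in> U \<Longrightarrow> (x has_vector_derivative H (x t)) (at t within J)"
    and y: "\<And>t. t \<in> J \<Longrightarrow> y t \<in> U"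
      "\<And>t. t \<in> J \<Longrightarrow> (y has_vector_derivative H (y t)) (at t within J)"
    and eq: "x t0 = y t0" and t: "t \<in> J"
  shows "x t = y t"
proof -
  define E where "E = {t \<in> J. x t - y t = 0}"
  have yc: "continuous_on J y"
    by (rule continuous_on_vector_derivative[OF y(2)])
  have "closedin (top_of_set J) E"
    unfolding E_def by (rule continuous_closedin_preimage_constant[OF continuous_on_diff[OF x(1) yc]])
  moreover have "openin (top_of_set J) E"
    unfolding openin_euclidean_subtopology_iff
  proof (intro conjI ballI)
    show "E \<subseteq> J" by (auto simp: E_def)
    fix t1 assume t1: "t1 \<in> E"
    then have "t1 \<in> J" "x t1 \<in> U" "x t1 = y t1" using y(1) by (auto simp: E_def)
    obtain e where e: "e > 0" "ball (x t1) e \<subseteq> U" using U \<open>x t1 \<in> U\<close> by (rule openE)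
    then obtain d where d': "d > 0" "\<And>r. r \<in> J \<Longrightarrow> dist r t1 < d \<Longrightarrow> dist (x r) (x t1) < e"
      using x(1)[unfolded continuous_on_iff, rule_format, OF \<open>t1 \<in> J\<close>] by blast
    then have d: "d > 0" "\<And>r. r \<in> J \<Longrightarrow> dist r t1 < d \<Longrightarrow> x r \<in> U"
      using e(2) by (auto simp: dist_commute subset_iff)
    have "r \<in> E" if r: "r \<in> J" "dist r t1 < d" for r
    proof -
      have both: "(x has_vector_derivative H (x q)) (at q within {u..v})"
        "(y has_vector_derivative H (y q)) (at q within {u..v})"
        if uv: "u \<in> J" "v \<in> J" and q: "q \<in> {u..v}" and near: "dist q t1 < d" for u v q
      proof -
        have sub: "{u..v} \<subseteq> J"
          by (rule subsetI, rule mem_is_interval_1_I[OF J(1) uv]) auto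
        then have "q \<in> J" using q by blast
        show "(x has_vector_derivative H (x q)) (at q within {u..v})"
          by (rule has_vector_derivative_within_subset[OF x(2)[OF \<open>q \<in> J\<close> d(2)[OF \<open>q \<in> J\<close> near]] sub])
        show "(y has_vector_derivative H (y q)) (at q within {u..v})"
          by (rule has_vector_derivative_within_subset[OF y(2)[OF \<open>q \<in> J\<close>] sub])
      qed
      have "x r = y r"
      proof (cases "t1 \<le> r")
        case True
        have near: "dist q t1 < d" if "q \<in> {t1..r}" for q
          using that r(2) True by (simp add: dist_real_def)
        show ?thesis
          by (rule ode_unique_forward[where x = x and y = y and a = t1 and b = r and H = H, OF H])
            (use True \<open>x t1 = y t1\<close> both near \<open>t1 \<in> J\<close> r(1) in blast)+
      next
        case False
        have near: "dist q t1 < d" if "q \<in> {r..t1}" for q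
          using that r(2) False by (simp add: dist_real_def)
        show ?thesis
          by (rule ode_unique_backward[where x = x and y = y and a = r and b = t1 and H = H, OF H])
            (use False \<open>x t1 = y t1\<close> both near \<open>t1 \<in> J\<close> r(1) in \<open>auto\<close>)
      qed
      then show ?thesis using r by (simp add: E_def)
    qed
    then show "\<exists>e>0. \<forall>x'\<in>J. dist x' t1 < e \<longrightarrow> x' \<in> E" using d(1) by blast
  qed
  ultimately have "E = {} \<or> E = J"
    using is_interval_connected[OF J(1), unfolded connected_clopen, rule_format, of E] by blast
  moreover have "t0 \<in> E" using J(2) eq by (simp add: E_def)
  ultimately show ?thesis using t by (auto simp: E_def)
qed

section \<open>Attracting slow manifolds in Banach spaces\<close>

lemma norm_fst_le_norm: "norm (fst p) \<le> norm p" and norm_snd_le_norm: "norm (snd p) \<le> norm p"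
  by (cases p; simp add: norm_fst_le norm_snd_le)+

text \<open>Here \<open>\<eta>\<close> bounds the feedback of the fast variable on itself and \<open>\<epsilon>\<close> all the other couplings. The
  condition \<open>gap\<close> makes the fixed point operator of \<open>ancient_exists\<close> contract by \<open>1/2\<close> and keeps the
  backward expansion of the fast variable above \<open>\<mu> / 2\<close>.\<close>

locale fast_slow =
  fixes N :: "'x::banach \<Rightarrow> 'y::banach \<Rightarrow> 'x" and g :: "'x \<Rightarrow> 'y \<Rightarrow> 'y" and \<mu> \<eta> \<epsilon> :: real
  assumes \<mu>: "\<mu> > 0" and \<eta>: "\<eta> \<ge> 0" and \<epsilon>: "\<epsilon> \<ge> 0" and gap: "4 * \<eta> + 12 * \<epsilon> \<le> \<mu>"
    and N_lip: "norm (N s y - N s' y') \<le> \<eta> * norm (s - s') + \<epsilon> * norm (y - y')"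
    and g_lip: "norm (g s y - g s' y') \<le> \<epsilon> * (norm (s - s') + norm (y - y'))"
begin

definition trajectory :: "real set \<Rightarrow> (real \<Rightarrow> 'x) \<Rightarrow> (real \<Rightarrow> 'y) \<Rightarrow> bool" where
  "trajectory J s y \<longleftrightarrow> (\<forall>t\<in>J. (s has_vector_derivative (- \<mu> *\<^sub>R s t + N (s t) (y t))) (at t within J)
     \<and> (y has_vector_derivative g (s t) (y t)) (at t within J))"

text \<open>The orbits that will make up the manifold. An orbit off the manifold has a fast component that
  grows backwards in time at a rate close to \<open>\<mu>\<close>, so the bound with exponent \<open>\<mu> / 2\<close> excludes it.\<close>

definition ancient :: "(real \<Rightarrow> 'x) \<Rightarrow> (real \<Rightarrow> 'y) \<Rightarrow> bool" where
  "ancient s y \<longleftrightarrow> trajectory UNIV s y \<and> (\<exists>K. \<forall>t. norm (s t) \<le> K * cosh (\<mu> / 2 * t))"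

lemma ancientD:
  assumes "ancient s y"
  shows "(s has_vector_derivative (- \<mu> *\<^sub>R s t + N (s t) (y t))) (at t)"
    and "(y has_vector_derivative g (s t) (y t)) (at t)"
  using assms by (auto simp: ancient_def trajectory_def)

lemma N_lip_pair: "norm (N (fst p) (snd p) - N (fst q) (snd q)) \<le> (\<eta> + \<epsilon>) * norm (p - q)"
proof -
  have "norm (N (fst p) (snd p) - N (fst q) (snd q)) \<le> \<eta> * norm (fst (p - q)) + \<epsilon> * norm (snd (p - q))"
    using N_lip by simp
  also have "\<dots> \<le> \<eta> * norm (p - q) + \<epsilon> * norm (p - q)"
    using \<eta> \<epsilon> by (intro add_mono mult_left_mono norm_fst_le_norm norm_snd_le_norm)
  finally show ?thesis by (simp add: algebra_simps)
qed

lemma g_lip_pair: "norm (g (fst p) (snd p) - g (fst q) (snd q)) \<le> (2 * \<epsilon>) * norm (p - q)"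
proof -
  have "norm (g (fst p) (snd p) - g (fst q) (snd q)) \<le> \<epsilon> * (norm (fst (p - q)) + norm (snd (p - q)))"
    using g_lip by simp
  also have "\<dots> \<le> \<epsilon> * (norm (p - q) + norm (p - q))"
    using \<epsilon> by (intro add_mono mult_left_mono norm_fst_le_norm norm_snd_le_norm)
  finally show ?thesis by (simp add: algebra_simps)
qed

lemma
  assumes "continuous_on UNIV u"
  shows N_continuous: "continuous_on UNIV (\<lambda>t::real. N (fst (u t)) (snd (u t)))"
    and g_continuous: "continuous_on UNIV (\<lambda>t::real. g (fst (u t)) (snd (u t)))"
proof -
  have "(\<eta> + \<epsilon>)-lipschitz_on UNIV (\<lambda>p. N (fst p) (snd p))"
    by (rule lipschitz_onI) (use \<eta> \<epsilon> N_lip_pair in \<open>auto simp: dist_norm\<close>)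
  then show "continuous_on UNIV (\<lambda>t::real. N (fst (u t)) (snd (u t)))"
    by (rule continuous_on_compose2[OF lipschitz_on_continuous_on assms]) auto
  have "(2 * \<epsilon>)-lipschitz_on UNIV (\<lambda>p. g (fst p) (snd p))"
    by (rule lipschitz_onI) (use \<epsilon> g_lip_pair in \<open>auto simp: dist_norm\<close>)
  then show "continuous_on UNIV (\<lambda>t::real. g (fst (u t)) (snd (u t)))"
    by (rule continuous_on_compose2[OF lipschitz_on_continuous_on assms]) auto
qed

definition vfield :: "'x \<times> 'y \<Rightarrow> 'x \<times> 'y" where
  "vfield p = (- \<mu> *\<^sub>R fst p + N (fst p) (snd p), g (fst p) (snd p))"

lemma vfield_lip: "norm (vfield p - vfield q) \<le> (\<mu> + \<eta> + 3 * \<epsilon>) * norm (p - q)"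
proof -
  have "norm (vfield p - vfield q) \<le> norm (- \<mu> *\<^sub>R (fst (p - q)) + (N (fst p) (snd p) - N (fst q) (snd q)))
      + norm (g (fst p) (snd p) - g (fst q) (snd q))"
    by (rule order_trans[OF eq_refl norm_Pair_le]) (simp add: vfield_def algebra_simps)
  also have "norm (- \<mu> *\<^sub>R (fst (p - q)) + (N (fst p) (snd p) - N (fst q) (snd q)))
      \<le> norm (- \<mu> *\<^sub>R (fst (p - q))) + norm (N (fst p) (snd p) - N (fst q) (snd q))"
    by (rule norm_triangle_ineq)
  also have "norm (- \<mu> *\<^sub>R (fst (p - q))) \<le> \<mu> * norm (p - q)"
    using \<mu> norm_fst_le_norm[of "p - q"] by simp
  finally show ?thesis using N_lip_pair[of p q] g_lip_pair[of p q] by (simp add: algebra_simps)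
qed

lemma trajectory_iff_vfield:
  "trajectory J s y \<longleftrightarrow>
    (\<forall>t\<in>J. ((\<lambda>t. (s t, y t)) has_vector_derivative vfield (s t, y t)) (at t within J))"
proof -
  have "((\<lambda>t. (s t, y t)) has_vector_derivative (a, b)) (at t within J) \<longleftrightarrow>
    (s has_vector_derivative a) (at t within J) \<and> (y has_vector_derivative b) (at t within J)" for t a b
    using bounded_linear.has_vector_derivative[OF bounded_linear_fst, of "\<lambda>t. (s t, y t)" "(a, b)" "at t within J"]
      bounded_linear.has_vector_derivative[OF bounded_linear_snd, of "\<lambda>t. (s t, y t)" "(a, b)" "at t within J"]
    by (auto intro: has_vector_derivative_Pair)
  then show ?thesis by (simp add: trajectory_def vfield_def)
qed

text \<open>The Lyapunov-Perron method: the fast component is the history-free response to its own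
  nonlinearity and the slow component is integrated from \<open>\<xi>\<close>. Both are controlled by the weight
  \<open>cosh (\<mu> t / 2)\<close> on the whole line, so the orbit is obtained for all times at once.\<close>

lemma ancient_exists: "\<exists>s y. ancient s y \<and> y 0 = \<xi>"
proof -
  define \<gamma> where "\<gamma> = \<mu> / 2"
  define w where "w = (\<lambda>t. cosh (\<gamma> * t))"
  have \<gamma>: "0 < \<gamma>" "\<gamma> < \<mu>" "\<mu> - \<gamma> = \<gamma>" using \<mu> by (auto simp: \<gamma>_def)
  have w1: "1 \<le> w t" for t by (simp add: w_def cosh_real_ge_1)
  define Nu where "Nu u = (\<lambda>r. N (fst (u r)) (snd (u r)))" for u :: "real \<Rightarrow> 'x \<times> 'y"
  define gu where "gu u = (\<lambda>r. g (fst (u r)) (snd (u r)))" for u :: "real \<Rightarrow> 'x \<times> 'y"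
  define T where "T u t = (response \<mu> (Nu u) t, \<xi> + primitive (gu u) t)" for u t
  have Nu_cont: "continuous_on UNIV (Nu u)" and gu_cont: "continuous_on UNIV (gu u)"
    if "continuous_on UNIV u" for u
    using that unfolding Nu_def gu_def by (rule N_continuous g_continuous)+
  have Nu_diff: "norm (Nu u t - Nu v t) \<le> (\<eta> + \<epsilon>) * norm (u t - v t)" for u v t
    unfolding Nu_def by (rule N_lip_pair)
  have gu_diff: "norm (gu u t - gu v t) \<le> (2 * \<epsilon>) * norm (u t - v t)" for u v t
    unfolding gu_def by (rule g_lip_pair)
  have Nu_growth: "norm (Nu u t) \<le> ((\<eta> + \<epsilon>) * C + norm (N 0 0)) * w t" if "norm (u t) \<le> C * w t" for u t C
  proof -
    have "norm (Nu u t) \<le> norm (Nu u t - Nu (\<lambda>_. 0) t) + norm (N 0 0)"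
      using norm_triangle_sub[of "Nu u t" "N 0 0"] by (simp add: Nu_def)
    also have "\<dots> \<le> (\<eta> + \<epsilon>) * (C * w t) + norm (N 0 0) * w t"
    proof (rule add_mono)
      show "norm (Nu u t - Nu (\<lambda>_. 0) t) \<le> (\<eta> + \<epsilon>) * (C * w t)"
        using \<eta> \<epsilon> that by (intro order_trans[OF Nu_diff] mult_left_mono) auto
      show "norm (N 0 0) \<le> norm (N 0 0) * w t" using w1 by (simp add: mult_le_cancel_left1)
    qed
    finally show ?thesis by (simp add: algebra_simps)
  qed
  obtain u K where u: "continuous_on UNIV u" "\<And>t. norm (u t) \<le> K * w t" "\<And>t. T u t = u t"
  proof (rule weighted_fixpoint[of w T])
    show "continuous_on UNIV w" unfolding w_def by (intro continuous_intros)
    show "w t > 0" for t by (simp add: w_def)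
    show "continuous_on UNIV (T u)" if "continuous_on UNIV u" for u
    proof -
      have "continuous_on UNIV (response \<mu> (Nu u))"
        using response_has_vector_derivative[OF Nu_cont[OF that]]
        by (meson has_vector_derivative_continuous continuous_at_imp_continuous_on)
      then show ?thesis unfolding T_def[abs_def]
        by (intro continuous_intros primitive_continuous gu_cont that)
    qed
    show "norm (T (\<lambda>_. 0) t) \<le> (norm (N 0 0) / \<gamma> + norm \<xi> + norm (g 0 0) / \<gamma>) * w t" for t
    proof -
      have le: "norm z \<le> norm z * cosh (\<gamma> * r)" for z :: "'z::real_normed_vector" and r
        by (simp add: mult_le_cancel_left1 cosh_real_ge_1)
      have 1: "norm (response \<mu> (Nu (\<lambda>_. 0)) t) \<le> norm (N 0 0) / (\<mu> - \<gamma>) * cosh (\<gamma> * t)"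
        by (rule norm_response_le[OF Nu_cont \<gamma>(1,2)]) (auto simp: Nu_def le)
      have 2: "norm (primitive (gu (\<lambda>_. 0)) t) \<le> norm (g 0 0) / \<gamma> * cosh (\<gamma> * t)"
        by (rule norm_primitive_le[OF gu_cont \<gamma>(1)]) (auto simp: gu_def le)
      have "norm (T (\<lambda>_. 0) t) \<le> norm (response \<mu> (Nu (\<lambda>_. 0)) t) + (norm \<xi> + norm (primitive (gu (\<lambda>_. 0)) t))"
        unfolding T_def by (rule order_trans[OF norm_Pair_le add_left_mono[OF norm_triangle_ineq]])
      then show ?thesis using 1 2 le[of \<xi> t] unfolding \<gamma>(3) by (simp add: w_def algebra_simps)
    qed
    fix u v :: "real \<Rightarrow> 'x \<times> 'y" and C C' K t
    assume uc: "continuous_on UNIV u" and vc: "continuous_on UNIV v"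
      and ub: "\<And>t. norm (u t) \<le> C * w t" and vb: "\<And>t. norm (v t) \<le> C' * w t"
      and d: "\<And>t. norm (u t - v t) \<le> K * w t"
    have K: "K \<ge> 0" using order_trans[OF norm_ge_zero d[of 0]] by (simp add: w_def)
    have 1: "norm (response \<mu> (\<lambda>r. Nu u r - Nu v r) t) \<le> ((\<eta> + \<epsilon>) * K) / (\<mu> - \<gamma>) * cosh (\<gamma> * t)"
    proof (rule norm_response_le[OF _ \<gamma>(1,2)])
      show "continuous_on UNIV (\<lambda>r. Nu u r - Nu v r)" by (intro continuous_intros Nu_cont uc vc)
      show "norm (Nu u r - Nu v r) \<le> (\<eta> + \<epsilon>) * K * cosh (\<gamma> * r)" for r
        using Nu_diff[of u r v] mult_left_mono[OF d[of r], of "\<eta> + \<epsilon>"] \<eta> \<epsilon> by (simp add: mult.assoc w_def)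
    qed
    have 2: "norm (primitive (\<lambda>r. gu u r - gu v r) t) \<le> ((2 * \<epsilon>) * K) / \<gamma> * cosh (\<gamma> * t)"
    proof (rule norm_primitive_le[OF _ \<gamma>(1)])
      show "continuous_on UNIV (\<lambda>r. gu u r - gu v r)" by (intro continuous_intros gu_cont uc vc)
      show "norm (gu u r - gu v r) \<le> (2 * \<epsilon>) * K * cosh (\<gamma> * r)" for r
        using gu_diff[of u r v] mult_left_mono[OF d[of r], of "2 * \<epsilon>"] \<epsilon> by (simp add: mult.assoc w_def)
    qed
    have "T u t - T v t = (response \<mu> (\<lambda>r. Nu u r - Nu v r) t, primitive (\<lambda>r. gu u r - gu v r) t)"
      using response_diff[OF Nu_cont[OF uc] Nu_growth[OF ub, unfolded w_def] Nu_cont[OF vc] Nu_growth[OF vb, unfolded w_def] \<gamma>(1,2)]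
        primitive_diff[OF gu_cont[OF uc] gu_cont[OF vc]]
      by (simp add: T_def)
    then have "norm (T u t - T v t) \<le> ((\<eta> + \<epsilon>) * K) / \<gamma> * w t + ((2 * \<epsilon>) * K) / \<gamma> * w t"
      using order_trans[OF norm_Pair_le add_mono[OF 1 2]] unfolding \<gamma>(3) by (simp add: w_def)
    also have "\<dots> = ((\<eta> + 3 * \<epsilon>) / \<gamma>) * (K * w t)"
      by (simp add: add_divide_distrib algebra_simps)
    also have "\<dots> \<le> (1 / 2) * (K * w t)"
    proof (rule mult_right_mono)
      show "(\<eta> + 3 * \<epsilon>) / \<gamma> \<le> 1 / 2" using gap \<gamma>(1) by (simp add: \<gamma>_def field_simps)
      show "0 \<le> K * w t" using K w1[of t] by simp
    qed
    finally show "norm (T u t - T v t) \<le> K / 2 * w t" by simp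
  qed auto
  define s where "s = (\<lambda>t. fst (u t))"
  define y where "y = (\<lambda>t. snd (u t))"
  have s: "s = response \<mu> (Nu u)" and y: "y = (\<lambda>t. \<xi> + primitive (gu u) t)"
    unfolding s_def y_def fun_eq_iff using u(3)[symmetric] by (metis T_def fst_conv, metis T_def snd_conv)
  have "(s has_vector_derivative (- \<mu> *\<^sub>R s t + N (s t) (y t))) (at t)" for t
    using response_has_vector_derivative[OF Nu_cont[OF u(1)], of \<mu> t] unfolding s[symmetric]
    by (simp add: Nu_def s_def y_def)
  moreover have "(y has_vector_derivative g (s t) (y t)) (at t)" for t
  proof -
    have "((\<lambda>t. \<xi> + primitive (gu u) t) has_vector_derivative gu u t) (at t)"
      using primitive_has_vector_derivative[OF gu_cont[OF u(1)], of t] by (auto intro!: derivative_eq_intros)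
    then show ?thesis unfolding y[symmetric] by (simp add: gu_def s_def y_def)
  qed
  moreover have "norm (s t) \<le> K * cosh (\<mu> / 2 * t)" for t
    using order_trans[OF norm_fst_le_norm u(2)[of t]] by (simp add: s_def w_def \<gamma>_def)
  moreover have "y 0 = \<xi>" by (simp add: y)
  ultimately show ?thesis unfolding ancient_def trajectory_def by (intro exI[of _ s] exI[of _ y]) auto
qed

lemma ancient_shift:
  assumes "ancient s y" shows "ancient (\<lambda>t. s (t + r)) (\<lambda>t. y (t + r))"
proof -
  obtain K where K: "\<And>t. norm (s t) \<le> K * cosh (\<mu> / 2 * t)" using assms by (auto simp: ancient_def)
  have K0: "K \<ge> 0" using order_trans[OF norm_ge_zero K[of 0]] by simp
  have "norm (s (t + r)) \<le> (2 * K * cosh (\<mu> / 2 * r)) * cosh (\<mu> / 2 * t)" for t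
  proof -
    have "sinh a * sinh b \<le> cosh a * cosh b" for a b :: real
      using cosh_real_pos[of "a - b"] by (simp add: cosh_diff)
    then have "cosh (\<mu> / 2 * (t + r)) \<le> 2 * cosh (\<mu> / 2 * r) * cosh (\<mu> / 2 * t)"
      by (simp only: distrib_left cosh_add) (simp add: algebra_simps)
    then have "K * cosh (\<mu> / 2 * (t + r)) \<le> K * (2 * cosh (\<mu> / 2 * r) * cosh (\<mu> / 2 * t))"
      using K0 by (rule mult_left_mono)
    with K[of "t + r"] show ?thesis by (simp add: mult_ac)
  qed
  moreover have shift: "((\<lambda>t. z (t + r)) has_vector_derivative d) (at t)"
    if "(z has_vector_derivative d) (at (t + r))" for z :: "real \<Rightarrow> 'b::real_normed_vector" and d t
  proof -
    have "((\<lambda>t. t + r) has_vector_derivative 1) (at t)"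
      using has_vector_derivative_add[OF has_vector_derivative_id has_vector_derivative_const] by simp
    from vector_diff_chain_at[OF this that] show ?thesis by (simp add: o_def)
  qed
  have "trajectory UNIV (\<lambda>t. s (t + r)) (\<lambda>t. y (t + r))"
    unfolding trajectory_def using ancientD[OF assms] by (auto intro!: shift)
  ultimately show ?thesis unfolding ancient_def by blast
qed

lemma trajectory_continuous:
  assumes "trajectory J s y" shows "continuous_on J s" "continuous_on J y"
  using assms unfolding trajectory_def
  by (auto intro: continuous_on_vector_derivative[where f' = "\<lambda>t. - \<mu> *\<^sub>R s t + N (s t) (y t)"]
      continuous_on_vector_derivative[where f' = "\<lambda>t. g (s t) (y t)"])

text \<open>The invariant cone. In reversed time \<open>W = \<kappa> P - S\<close> obeys \<open>W' \<le> \<nu> W\<close> with \<open>\<nu> > \<mu> / 2\<close>, so a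
  negative \<open>W\<close> at time \<open>0\<close> contradicts the slow growth of ancient orbits. Since the factor \<open>\<kappa>\<close> is kept
  in front of \<open>c\<close>, no division by \<open>\<kappa>\<close> occurs and \<open>\<kappa> = 0\<close>, the uncoupled case, is covered.

  The curve \<open>q\<close> is the difference of the slow components in the Lipschitz estimates, and a
  constant in the proof of the sup bound.\<close>

lemma ancient_cone:
  assumes 1: "ancient s y" and 2: "ancient s' y'"
    and S: "bounded_seminorm S" and P: "bounded_seminorm P"
    and nonneg: "\<kappa> \<ge> 0" "c \<ge> 0" "d \<ge> 0" and small: "\<eta> + \<kappa> * d + d + c \<le> \<mu> / 4"
    and SN: "\<And>t. S (N (s t) (y t) - N (s' t) (y' t)) \<le> \<eta> * S (s t - s' t) + \<kappa> * c * P (q t)"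
    and q: "\<And>t. (q has_vector_derivative q' t) (at t)"
    and Pq: "\<And>t. P (q' t) \<le> d * (S (s t - s' t) + P (q t))"
  shows "S (s 0 - s' 0) \<le> \<kappa> * P (q 0)"
proof -
  define \<nu> where "\<nu> = \<mu> - \<eta> - \<kappa> * d"
  define W where "W = (\<lambda>t. - S (s (- t) - s' (- t)) + \<kappa> * P (q (- t)))"
  obtain K where K: "\<And>t. norm (s t) \<le> K * cosh (\<mu> / 2 * t)"
    using 1 unfolding ancient_def by blast
  obtain K' where K': "\<And>t. norm (s' t) \<le> K' * cosh (\<mu> / 2 * t)"
    using 2 unfolding ancient_def by blast
  obtain B where B: "B > 0" "\<And>x. S x \<le> B * norm x" using bounded_seminorm_bound[OF S] by blast
  have ds: "((\<lambda>r. s (- r) - s' (- r)) has_vector_derivative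
     (\<mu> *\<^sub>R (s (- t) - s' (- t)) - (N (s (- t)) (y (- t)) - N (s' (- t)) (y' (- t))))) (at t)" for t
  proof -
    have "((\<lambda>t. s t - s' t) has_vector_derivative (- \<mu> *\<^sub>R s (- t) + N (s (- t)) (y (- t))
       - (- \<mu> *\<^sub>R s' (- t) + N (s' (- t)) (y' (- t))))) (at (- t))"
      by (intro has_vector_derivative_diff ancientD[OF 1] ancientD[OF 2])
    then have "((\<lambda>t. s t - s' t) has_vector_derivative (- \<mu> *\<^sub>R s (- t) + N (s (- t)) (y (- t))
       - (- \<mu> *\<^sub>R s' (- t) + N (s' (- t)) (y' (- t))))) (at (- t) within uminus ` UNIV)"
      by (rule has_vector_derivative_at_within)
    from has_vector_derivative_reverse[where x = "\<lambda>t. s t - s' t", OF this]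
    show ?thesis by (simp add: algebra_simps)
  qed
  have dq: "((\<lambda>r. q (- r)) has_vector_derivative - q' (- t)) (at t)" for t
    by (rule has_vector_derivative_reverse[where x = q, OF has_vector_derivative_at_within[OF q]])
  have "0 \<le> W 0"
  proof (rule cosh_growth_excludes_faster[where W = W and \<nu> = \<nu> and \<gamma> = "\<mu> / 2" and K = "B * (K + K')"])
    have "continuous_on {0..} (\<lambda>r. S (s (- r) - s' (- r)))"
      by (rule continuous_on_compose2[OF bounded_seminorm_continuous[OF S, of UNIV]
            continuous_on_vector_derivative[OF has_vector_derivative_at_within[OF ds]]]) auto
    moreover have "continuous_on {0..} (\<lambda>r. P (q (- r)))"
      by (rule continuous_on_compose2[OF bounded_seminorm_continuous[OF P, of UNIV]
            continuous_on_vector_derivative[OF has_vector_derivative_at_within[OF dq]]]) auto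
    ultimately show "continuous_on {0..} W" unfolding W_def by (intro continuous_intros)
    fix t :: real assume "t \<ge> 0"
    define u where "u = S (s (- t) - s' (- t))"
    define p where "p = P (q (- t))"
    define D where "D = (S (N (s (- t)) (y (- t)) - N (s' (- t)) (y' (- t))) - \<mu> * u)
        + \<kappa> * (0 * p + P (- q' (- t)))"
    have "dini_le W t D"
      unfolding W_def D_def u_def p_def
    proof (rule dini_le_add_cmult[OF _ _ nonneg(1)])
      show "dini_le (\<lambda>t. - S (s (- t) - s' (- t))) t
          (S (N (s (- t)) (y (- t)) - N (s' (- t)) (y' (- t))) - \<mu> * S (s (- t) - s' (- t)))"
        by (rule dini_le_minus_seminorm[OF S ds]) simp
      show "dini_le (\<lambda>t. P (q (- t))) t (0 * P (q (- t)) + P (- q' (- t)))"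
        by (rule dini_le_seminorm[where X = UNIV, OF P]) (use dq in simp_all)
    qed
    moreover have "D \<le> \<nu> * W t"
    proof -
      have p: "p \<ge> 0" and u: "u \<ge> 0" unfolding p_def u_def by (rule bounded_seminormD(3)[OF P] bounded_seminormD(3)[OF S])+
      have "D \<le> (\<eta> * u + \<kappa> * c * p - \<mu> * u) + \<kappa> * (d * (u + p))"
        unfolding D_def using SN[of "- t"] mult_left_mono[OF Pq[of "- t"], of \<kappa>] nonneg
        by (simp add: u_def p_def bounded_seminormD(4)[OF P])
      also have "\<dots> = \<nu> * (\<kappa> * p - u) - (\<nu> - c - d) * (\<kappa> * p)"
        by (simp add: \<nu>_def algebra_simps)
      \<comment> \<open>The dropped term has the right sign because \<open>c + d \<le> \<mu> / 4 < \<nu>\<close>.\<close>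
      also have "\<dots> \<le> \<nu> * (\<kappa> * p - u)"
        using small \<mu> p nonneg \<eta> by (simp add: \<nu>_def)
      finally show ?thesis by (simp add: W_def u_def p_def)
    qed
    ultimately show "dini_le W t (\<nu> * W t)" by (rule dini_le_mono)
    have "- W t \<le> S (s (- t) - s' (- t))"
      unfolding W_def using nonneg bounded_seminormD(3)[OF P] by simp
    also have "\<dots> \<le> B * (norm (s (- t)) + norm (s' (- t)))"
      using B(1) norm_triangle_ineq4 by (intro order_trans[OF B(2)] mult_left_mono) auto
    also have "\<dots> \<le> B * (K * cosh (\<mu> / 2 * (- t)) + K' * cosh (\<mu> / 2 * (- t)))"
      using B(1) by (intro mult_left_mono add_mono K K') auto
    finally show "- W t \<le> B * (K + K') * cosh (\<mu> / 2 * t)" by (simp add: algebra_simps)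
  next
    have "\<kappa> * d \<ge> 0" using nonneg by simp
    then show "\<mu> / 2 < \<nu>" using small \<mu> nonneg by (simp add: \<nu>_def)
  qed (use \<mu> in auto)
  then show ?thesis by (simp add: W_def)
qed

text \<open>Two ancient orbits with the same slow component at one time have the same fast component there.
  This is what makes the manifold a graph.\<close>

lemma ancient_norm_cone:
  assumes "ancient s y" "ancient s' y'"
  shows "norm (s 0 - s' 0) \<le> norm (y 0 - y' 0)"
proof -
  have "norm (s 0 - s' 0) \<le> 1 * norm ((\<lambda>t. y t - y' t) 0)"
  proof (rule ancient_cone[OF assms, where S = norm and P = norm and c = \<epsilon> and d = \<epsilon> and \<kappa> = 1
        and q = "\<lambda>t. y t - y' t" and q' = "\<lambda>t. g (s t) (y t) - g (s' t) (y' t)"])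
    show "((\<lambda>t. y t - y' t) has_vector_derivative (g (s t) (y t) - g (s' t) (y' t))) (at t)" for t
      by (intro has_vector_derivative_diff ancientD[OF assms(1)] ancientD[OF assms(2)])
    show "norm (N (s t) (y t) - N (s' t) (y' t)) \<le> \<eta> * norm (s t - s' t) + 1 * \<epsilon> * norm (y t - y' t)" for t
      using N_lip by simp
  qed (use gap \<epsilon> g_lip bounded_seminorm_norm in auto)
  then show ?thesis by simp
qed

text \<open>By \<open>ancient_norm_cone\<close> the choice does not depend on the orbit.\<close>

definition slaved :: "'y \<Rightarrow> 'x" where
  "slaved \<xi> = (SOME x. \<exists>s y. ancient s y \<and> y 0 = \<xi> \<and> s 0 = x)"

text \<open>The system is autonomous, so \<open>t\<close> can be shifted to \<open>0\<close>.\<close>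

lemma slaved_ancient:
  assumes "ancient s y" shows "slaved (y t) = s t"
proof -
  have *: "ancient (\<lambda>r. s (r + t)) (\<lambda>r. y (r + t))" by (rule ancient_shift[OF assms])
  have "\<exists>x s' y'. ancient s' y' \<and> y' 0 = y t \<and> s' 0 = x"
    using ancient_exists by blast
  then obtain s' y' where "ancient s' y'" "y' 0 = y t" "s' 0 = slaved (y t)"
    unfolding slaved_def by (smt (verit, best) someI_ex)
  then show ?thesis using ancient_norm_cone[OF _ *, of s' y'] by simp
qed

lemma ancient_on_graph: "\<exists>s y. ancient s y \<and> y 0 = \<xi> \<and> (\<forall>t. s t = slaved (y t))"
  using ancient_exists[of \<xi>] slaved_ancient by metis

lemma slaved_lipschitz:
  assumes S: "bounded_seminorm S" and P: "bounded_seminorm P"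
    and nonneg: "\<kappa> \<ge> 0" "c \<ge> 0" "d \<ge> 0" and small: "\<eta> + \<kappa> * d + d + c \<le> \<mu> / 4"
    and SN: "\<And>s y s' y'. S (N s y - N s' y') \<le> \<eta> * S (s - s') + \<kappa> * c * P (y - y')"
    and Pg: "\<And>s y s' y'. P (g s y - g s' y') \<le> d * (S (s - s') + P (y - y'))"
  shows "S (slaved \<xi> - slaved \<xi>') \<le> \<kappa> * P (\<xi> - \<xi>')"
proof -
  obtain s y where 1: "ancient s y" "y 0 = \<xi>" "\<And>t. s t = slaved (y t)"
    using ancient_on_graph[of \<xi>] by blast
  obtain s' y' where 2: "ancient s' y'" "y' 0 = \<xi>'" "\<And>t. s' t = slaved (y' t)"
    using ancient_on_graph[of \<xi>'] by blast
  have "S (s 0 - s' 0) \<le> \<kappa> * P ((\<lambda>t. y t - y' t) 0)"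
  proof (rule ancient_cone[OF 1(1) 2(1) S P nonneg small,
        where q = "\<lambda>t. y t - y' t" and q' = "\<lambda>t. g (s t) (y t) - g (s' t) (y' t)"])
    show "((\<lambda>t. y t - y' t) has_vector_derivative (g (s t) (y t) - g (s' t) (y' t))) (at t)" for t
      by (intro has_vector_derivative_diff ancientD[OF 1(1)] ancientD[OF 2(1)])
  qed (use SN Pg in auto)
  then show ?thesis using 1 2 by simp
qed

lemma slaved_norm_lipschitz: "norm (slaved \<xi> - slaved \<xi>') \<le> norm (\<xi> - \<xi>')"
proof -
  obtain s y where 1: "ancient s y" "y 0 = \<xi>" "\<And>t. s t = slaved (y t)"
    using ancient_on_graph[of \<xi>] by blast
  obtain s' y' where 2: "ancient s' y'" "y' 0 = \<xi>'" "\<And>t. s' t = slaved (y' t)"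
    using ancient_on_graph[of \<xi>'] by blast
  show ?thesis using ancient_norm_cone[OF 1(1) 2(1)] 1 2 by simp
qed

lemma zero_ancient: "N 0 0 = 0 \<Longrightarrow> g 0 0 = 0 \<Longrightarrow> ancient (\<lambda>_. 0) (\<lambda>_. 0)"
  unfolding ancient_def trajectory_def by (auto intro!: exI[of _ 0])

lemma slaved_zero: "N 0 0 = 0 \<Longrightarrow> g 0 0 = 0 \<Longrightarrow> slaved 0 = 0"
  using slaved_ancient[OF zero_ancient] by blast

text \<open>The cone lemma with the constant curve \<open>1\<close> in place of the slow difference and the zero orbit as
  second orbit.\<close>

lemma slaved_bounded:
  assumes S: "bounded_seminorm S" and nonneg: "\<kappa> \<ge> 0" "c \<ge> 0" and small: "\<eta> + c \<le> \<mu> / 4"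
    and N0: "N 0 0 = 0" and g0: "g 0 0 = 0"
    and SN: "\<And>s y. S (N s y) \<le> \<eta> * S s + \<kappa> * c"
  shows "S (slaved \<xi>) \<le> \<kappa>"
proof -
  obtain s y where 1: "ancient s y" "y 0 = \<xi>" "\<And>t. s t = slaved (y t)"
    using ancient_on_graph[of \<xi>] by blast
  have "S (s 0 - (\<lambda>_. 0) 0) \<le> \<kappa> * norm ((\<lambda>_. 1 :: real) 0)"
  proof (rule ancient_cone[OF 1(1) zero_ancient[OF N0 g0] S bounded_seminorm_norm nonneg order_refl,
        where q = "\<lambda>_. 1" and q' = "\<lambda>_. 0"])
    show "((\<lambda>_. 1 :: real) has_vector_derivative 0) (at t)" for t by simp
  qed (use SN small N0 in auto)
  then show ?thesis using 1 by simp
qed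

lemma trajectory_exists:
  obtains s y where "trajectory UNIV s y" "s 0 = s0" "y 0 = y0"
proof -
  obtain u where u: "u 0 = (s0, y0)" "\<And>t. (u has_vector_derivative vfield (u t)) (at t)"
    using lipschitz_ivp[of vfield "\<mu> + \<eta> + 3 * \<epsilon>" "(s0, y0)", OF vfield_lip] by blast
  then have "trajectory UNIV (\<lambda>t. fst (u t)) (\<lambda>t. snd (u t))"
    by (simp add: trajectory_iff_vfield)
  then show ?thesis by (rule that) (simp_all add: u)
qed

text \<open>At each time \<open>r\<close> the solution is compared with the ancient orbit \<open>(s', y')\<close> through
  \<open>(slaved (y r), y r)\<close>. Near \<open>r\<close> the distance to the graph is at most
  \<open>q = \<parallel>s - s'\<parallel> + \<parallel>y' - y\<parallel>\<close>, with equality at \<open>r\<close>, and the Dini derivative of \<open>q\<close> there is at most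
  \<open>- (\<mu> / 2) \<parallel>s - s'\<parallel>\<close>: the first summand is damped, the second vanishes at \<open>r\<close> and moves slowly.\<close>

lemma slaved_attracts:
  assumes tr: "trajectory {0..} s y" and t: "t \<ge> 0"
  shows "norm (s t - slaved (y t)) \<le> exp (- (\<mu> / 2) * t) * norm (s 0 - slaved (y 0))"
proof -
  have sc: "continuous_on UNIV slaved"
    by (rule lipschitz_on_continuous_on[of 1]) (auto intro!: lipschitz_onI simp: dist_norm slaved_norm_lipschitz)
  have "norm (s t - slaved (y t)) \<le> exp (- (\<mu> / 2) * (t - 0)) * norm (s 0 - slaved (y 0))"
  proof (rule dini_le_exp_bound[OF _ t])
    have "continuous_on {0..t} s" "continuous_on {0..t} y"
      using trajectory_continuous[OF tr] by (auto intro: continuous_on_subset)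
    then show "continuous_on {0..t} (\<lambda>t. norm (s t - slaved (y t)))"
      by (intro continuous_on_norm continuous_on_diff continuous_on_compose2[OF sc]) auto
    fix r assume r: "0 \<le> r" "r < t"
    obtain s1 y1 where 1: "ancient s1 y1" "y1 0 = y r" "\<And>t. s1 t = slaved (y1 t)"
      using ancient_on_graph[of "y r"] by blast
    define s' where "s' = (\<lambda>t. s1 (t + - r))"
    define y' where "y' = (\<lambda>t. y1 (t + - r))"
    have 2: "ancient s' y'" "y' r = y r" "\<And>t. s' t = slaved (y' t)"
      unfolding s'_def y'_def by (rule ancient_shift[OF 1(1)], simp add: 1(2), rule 1(3))
    have in_J: "\<forall>\<^sub>F h in at_right 0. r + h \<in> {0..}"
      using eventually_at_right_less[of 0] by eventually_elim (use r in auto)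
    have ds: "((\<lambda>t. s t - s' t) has_vector_derivative
       (- \<mu> *\<^sub>R (s r - s' r) + (N (s r) (y r) - N (s' r) (y' r)))) (at r within {0..})"
    proof -
      have "((\<lambda>t. s t - s' t) has_vector_derivative
         ((- \<mu> *\<^sub>R s r + N (s r) (y r)) - (- \<mu> *\<^sub>R s' r + N (s' r) (y' r)))) (at r within {0..})"
        using tr r by (intro has_vector_derivative_diff has_vector_derivative_at_within[OF ancientD(1)[OF 2(1)]])
          (auto simp: trajectory_def)
      then show ?thesis by (simp add: algebra_simps)
    qed
    have dy: "((\<lambda>t. y' t - y t) has_vector_derivative
       (0 *\<^sub>R (y' r - y r) + (g (s' r) (y' r) - g (s r) (y r)))) (at r within {0..})"
    proof -
      have "((\<lambda>t. y' t - y t) has_vector_derivative (g (s' r) (y' r) - g (s r) (y r))) (at r within {0..})"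
        using tr r by (intro has_vector_derivative_diff has_vector_derivative_at_within[OF ancientD(2)[OF 2(1)]])
          (auto simp: trajectory_def)
      then show ?thesis by simp
    qed
    define q where "q = (\<lambda>t. norm (s t - s' t) + 1 * norm (y' t - y t))"
    define D where "D = (- \<mu> * norm (s r - s' r) + norm (N (s r) (y r) - N (s' r) (y' r)))
       + 1 * (0 * norm (y' r - y r) + norm (g (s' r) (y' r) - g (s r) (y r)))"
    show "dini_le (\<lambda>t. norm (s t - slaved (y t))) r (- (\<mu> / 2) * norm (s r - slaved (y r)))"
    proof (rule dini_le_majorant[of q])
      have "dini_le q r D" unfolding q_def D_def
        by (intro dini_le_add_cmult dini_le_seminorm[OF bounded_seminorm_norm ds in_J]
            dini_le_seminorm[OF bounded_seminorm_norm dy in_J]) simp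
      moreover have "D \<le> - (\<mu> / 2) * norm (s r - s' r)"
      proof -
        have "D \<le> (- \<mu> + \<eta> + \<epsilon>) * norm (s r - s' r)"
          using N_lip[of "s r" "y r" "s' r" "y' r"] g_lip[of "s' r" "y' r" "s r" "y r"]
          by (simp add: D_def 2(2) norm_minus_commute algebra_simps)
        also have "\<dots> \<le> - (\<mu> / 2) * norm (s r - s' r)"
          using gap \<eta> \<epsilon> \<mu> by (intro mult_right_mono) auto
        finally show ?thesis .
      qed
      ultimately show "dini_le q r (- (\<mu> / 2) * norm (s r - slaved (y r)))"
        using dini_le_mono 2 by metis
      show "norm (s r - slaved (y r)) = q r" by (simp add: q_def 2)
      have "norm (s t - slaved (y t)) \<le> q t" for t
        using norm_triangle_ineq[of "s t - s' t" "s' t - slaved (y t)"] slaved_norm_lipschitz[of "y' t" "y t"]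
        by (simp add: q_def 2(3))
      then show "\<forall>\<^sub>F h in at_right 0. norm (s (r + h) - slaved (y (r + h))) \<le> q (r + h)" by simp
    qed
  qed
  then show ?thesis by simp
qed

end

section \<open>The p-norms and nearest-neighbour differences\<close>

lemma abs_powr_convex:
  fixes s t u p :: real
  assumes p: "p \<ge> 1" and u: "0 \<le> u" "u \<le> 1"
  shows "\<bar>u * s + (1 - u) * t\<bar> powr p \<le> u * \<bar>s\<bar> powr p + (1 - u) * \<bar>t\<bar> powr p"
proof -
  have scale: "(v * r) powr p \<le> v * r powr p" if "0 \<le> v" "v \<le> 1" "0 \<le> r" for v r :: real
  proof (cases "v = 0")
    case False
    then have "v powr p \<le> v powr 1" using that p by (intro powr_mono') auto
    then show ?thesis using that by (simp add: powr_mult mult_right_mono)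
  qed simp
  have "\<bar>u * s + (1 - u) * t\<bar> \<le> u * \<bar>s\<bar> + (1 - u) * \<bar>t\<bar>"
    using u abs_triangle_ineq[of "u * s" "(1 - u) * t"] by (simp add: abs_mult)
  then have "\<bar>u * s + (1 - u) * t\<bar> powr p \<le> (u * \<bar>s\<bar> + (1 - u) * \<bar>t\<bar>) powr p"
    using p by (intro powr_mono2) auto
  also have "\<dots> \<le> u * \<bar>s\<bar> powr p + (1 - u) * \<bar>t\<bar> powr p"
  proof -
    consider "s = 0" | "t = 0" | "s \<noteq> 0" "t \<noteq> 0" by blast
    then show ?thesis
    proof cases
      case 3
      then show ?thesis
        using convex_onD[OF powr_convex[OF p], of "1 - u" "\<bar>s\<bar>" "\<bar>t\<bar>"] u by simp
    qed (use scale[of u "\<bar>s\<bar>"] scale[of "1 - u" "\<bar>t\<bar>"] u in auto)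
  qed
  finally show ?thesis .
qed

text \<open>The abstract form of Minkowski's inequality. The set where \<open>\<Phi>\<close> is at most \<open>1\<close> is convex, and
  \<open>\<Phi>\<^sup>1\<^sup>/\<^sup>p\<close> is its gauge, hence subadditive. It is needed both for
  \<open>\<Sum>\<bar>x k\<bar>\<^sup>p\<close> and for the double sum in \<open>Q p\<close>.\<close>

lemma root_of_convex_homogeneous:
  fixes \<Phi> :: "'v::real_vector \<Rightarrow> real"
  assumes p: "p \<ge> 1" and nonneg: "\<And>x. \<Phi> x \<ge> 0"
    and hom: "\<And>c x. \<Phi> (c *\<^sub>R x) = \<bar>c\<bar> powr p * \<Phi> x"
    and conv: "\<And>u x y. 0 \<le> u \<Longrightarrow> u \<le> 1 \<Longrightarrow> \<Phi> (u *\<^sub>R x + (1 - u) *\<^sub>R y) \<le> u * \<Phi> x + (1 - u) * \<Phi> y"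
  shows "\<Phi> (x + y) powr (1 / p) \<le> \<Phi> x powr (1 / p) + \<Phi> y powr (1 / p)"
    and "\<Phi> (c *\<^sub>R x) powr (1 / p) = \<bar>c\<bar> * \<Phi> x powr (1 / p)"
proof -
  show "\<Phi> (c *\<^sub>R x) powr (1 / p) = \<bar>c\<bar> * \<Phi> x powr (1 / p)"
    using p nonneg by (simp add: hom powr_mult powr_powr)
  show "\<Phi> (x + y) powr (1 / p) \<le> \<Phi> x powr (1 / p) + \<Phi> y powr (1 / p)"
  proof (rule field_le_epsilon)
    fix e :: real assume e: "e > 0"
    \<comment> \<open>The summand \<open>e / 2\<close> makes the scaling factors positive, also when \<open>\<Phi>\<close> vanishes.\<close>
    define A where "A = \<Phi> x powr (1 / p) + e / 2"
    define B where "B = \<Phi> y powr (1 / p) + e / 2"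
    have AB: "A > 0" "B > 0" unfolding A_def B_def using e by (auto intro: add_nonneg_pos)
    have le1: "\<Phi> (z /\<^sub>R C) \<le> 1" if "C > 0" "\<Phi> z powr (1 / p) \<le> C" for z C
    proof -
      have "\<Phi> z = (\<Phi> z powr (1 / p)) powr p" using p nonneg[of z] by (simp add: powr_powr)
      also have "\<dots> \<le> C powr p" using that p by (intro powr_mono2) auto
      finally show ?thesis
        using that by (simp add: hom powr_divide inverse_eq_divide field_simps)
    qed
    define u where "u = A / (A + B)"
    have u: "0 \<le> u" "u \<le> 1" "1 - u = B / (A + B)" using AB by (auto simp: u_def field_simps)
    have "x + y = (A + B) *\<^sub>R (u *\<^sub>R (x /\<^sub>R A) + (1 - u) *\<^sub>R (y /\<^sub>R B))"
      unfolding u(3) using AB by (simp add: u_def scaleR_add_right)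
    then have "\<Phi> (x + y) = (A + B) powr p * \<Phi> (u *\<^sub>R (x /\<^sub>R A) + (1 - u) *\<^sub>R (y /\<^sub>R B))"
      using AB by (simp only: hom)
    also have "\<dots> \<le> (A + B) powr p * (u * 1 + (1 - u) * 1)"
    proof (rule mult_left_mono)
      have "\<Phi> (u *\<^sub>R (x /\<^sub>R A) + (1 - u) *\<^sub>R (y /\<^sub>R B)) \<le> u * \<Phi> (x /\<^sub>R A) + (1 - u) * \<Phi> (y /\<^sub>R B)"
        by (rule conv[OF u(1,2)])
      also have "\<dots> \<le> u * 1 + (1 - u) * 1"
      proof (intro add_mono mult_left_mono le1)
        show "\<Phi> x powr (1 / p) \<le> A" "\<Phi> y powr (1 / p) \<le> B" unfolding A_def B_def using e by auto
      qed (use u AB in auto)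
      finally show "\<Phi> (u *\<^sub>R (x /\<^sub>R A) + (1 - u) *\<^sub>R (y /\<^sub>R B)) \<le> u * 1 + (1 - u) * 1" .
    qed simp
    finally have "\<Phi> (x + y) \<le> (A + B) powr p" by simp
    then have "\<Phi> (x + y) powr (1 / p) \<le> ((A + B) powr p) powr (1 / p)"
      using p nonneg by (intro powr_mono2) auto
    also have "\<dots> = A + B" using AB p by (simp add: powr_powr)
    finally show "\<Phi> (x + y) powr (1 / p) \<le> \<Phi> x powr (1 / p) + \<Phi> y powr (1 / p) + e"
      by (simp add: A_def B_def)
  qed
qed

lemma powr_root_le:
  fixes A B c p :: real
  assumes "p \<ge> 1" "0 \<le> A" "0 \<le> B" "0 \<le> c" "A \<le> c powr p * B"
  shows "A powr (1 / p) \<le> c * B powr (1 / p)"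
proof -
  have "A powr (1 / p) \<le> (c powr p * B) powr (1 / p)" using assms by (intro powr_mono2) auto
  also have "\<dots> = c * B powr (1 / p)" using assms by (simp add: powr_mult powr_powr)
  finally show ?thesis .
qed

lemma summable_seq_powr:
  assumes "p \<ge> 1"
  shows "(\<lambda>k. \<bar>seq x k\<bar> powr p) summable_on UNIV"
    and "(\<Sum>\<^sub>\<infinity>k. \<bar>seq x k\<bar> powr p) \<le> norm x powr p"
proof -
  have le: "\<bar>seq x k\<bar> powr p \<le> norm x powr (p - 1) * \<bar>seq x k\<bar>" for k
  proof (cases "seq x k = 0")
    case False
    then have "\<bar>seq x k\<bar> powr p = \<bar>seq x k\<bar> powr (p - 1) * \<bar>seq x k\<bar>"
      using powr_add[of "\<bar>seq x k\<bar>" "p - 1" 1] by simp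
    also have "\<dots> \<le> norm x powr (p - 1) * \<bar>seq x k\<bar>"
      using assms abs_seq_le_norm[of x k] by (intro mult_right_mono powr_mono2) auto
    finally show ?thesis .
  qed simp
  have sum: "(\<lambda>k. norm x powr (p - 1) * \<bar>seq x k\<bar>) summable_on UNIV"
    by (intro summable_on_cmult_right summable_seq)
  show 1: "(\<lambda>k. \<bar>seq x k\<bar> powr p) summable_on UNIV"
    by (rule summable_on_comparison_test[OF sum le]) auto
  have "(\<Sum>\<^sub>\<infinity>k. \<bar>seq x k\<bar> powr p) \<le> (\<Sum>\<^sub>\<infinity>k. norm x powr (p - 1) * \<bar>seq x k\<bar>)"
    by (rule infsum_mono[OF 1 sum le])
  also have "\<dots> = norm x powr (p - 1) * norm x" by (simp add: infsum_cmult_right' norm_l1_def)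
  also have "\<dots> = norm x powr p"
    using powr_add[of "norm x" "p - 1" 1] by (cases "x = 0") auto
  finally show "(\<Sum>\<^sub>\<infinity>k. \<bar>seq x k\<bar> powr p) \<le> norm x powr p" .
qed

lemma sum_nbrs:
  "(\<Sum>k'\<in>nbrs k. f k') = f (fst k + 1, snd k) + f (fst k - 1, snd k) + f (fst k, snd k + 1) + f (fst k, snd k - 1)"
  by (simp add: nbrs_def add.assoc)

lemma finite_nbrs [simp]: "finite (nbrs k)" by (simp add: nbrs_def)

lemma card_nbrs [simp]: "card (nbrs k) = 4"
  using sum_nbrs[of "\<lambda>_. 1 :: nat" k] by simp

lemma nbrs_summable:
  fixes f :: "site \<Rightarrow> real"
  assumes "f summable_on UNIV"
  shows "(\<lambda>k. \<Sum>k'\<in>nbrs k. f k') summable_on UNIV"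
    and "(\<Sum>\<^sub>\<infinity>k. \<Sum>k'\<in>nbrs k. f k') = 4 * (\<Sum>\<^sub>\<infinity>k. f k)"
proof -
  have b: "bij_betw (\<lambda>k. (fst k + a, snd k + b)) UNIV UNIV" for a b :: int
    by (rule bij_betw_byWitness[of _ "\<lambda>k. (fst k - a, snd k - b)"]) auto
  have s: "(\<lambda>k. f (fst k + a, snd k + b)) summable_on UNIV" for a b
    using summable_on_reindex_bij_betw[OF b, of f a b] assms by simp
  have i: "(\<Sum>\<^sub>\<infinity>k. f (fst k + a, snd k + b)) = (\<Sum>\<^sub>\<infinity>k. f k)" for a b
    using infsum_reindex_bij_betw[OF b, of f a b] by simp
  note S = s[of 1 0, simplified] s[of "-1" 0, simplified] s[of 0 1, simplified] s[of 0 "-1", simplified]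
  note I = i[of 1 0, simplified] i[of "-1" 0, simplified] i[of 0 1, simplified] i[of 0 "-1", simplified]
  show "(\<lambda>k. \<Sum>k'\<in>nbrs k. f k') summable_on UNIV"
    unfolding sum_nbrs by (intro summable_on_add S)
  show "(\<Sum>\<^sub>\<infinity>k. \<Sum>k'\<in>nbrs k. f k') = 4 * (\<Sum>\<^sub>\<infinity>k. f k)"
    unfolding sum_nbrs by (simp add: infsum_add S I summable_on_add)
qed

definition nbr_sum :: "site l1 \<Rightarrow> site l1" where
  "nbr_sum x = L1 (\<lambda>k. \<Sum>k'\<in>nbrs k. \<bar>seq x k'\<bar>)"

definition nbr_diff :: "site l1 \<Rightarrow> site l1" where
  "nbr_diff x = L1 (\<lambda>k. \<Sum>k'\<in>nbrs k. \<bar>seq x k' - seq x k\<bar>)"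

lemma seq_nbr_sum: "seq (nbr_sum x) = (\<lambda>k. \<Sum>k'\<in>nbrs k. \<bar>seq x k'\<bar>)"
  unfolding nbr_sum_def
  by (rule seq_L1) (simp add: sum_nonneg nbrs_summable(1))

lemma seq_nbr_diff: "seq (nbr_diff x) = (\<lambda>k. \<Sum>k'\<in>nbrs k. \<bar>seq x k' - seq x k\<bar>)"
  unfolding nbr_diff_def
proof (rule seq_L1, rule summable_abs_le)
  show "(\<lambda>k. (\<Sum>k'\<in>nbrs k. \<bar>seq x k'\<bar>) + 4 * \<bar>seq x k\<bar>) summable_on UNIV"
    by (intro summable_on_add summable_on_cmult_right nbrs_summable(1) summable_seq)
  fix k
  have "(\<Sum>k'\<in>nbrs k. \<bar>seq x k' - seq x k\<bar>) \<le> (\<Sum>k'\<in>nbrs k. \<bar>seq x k'\<bar> + \<bar>seq x k\<bar>)"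
    by (intro sum_mono) auto
  then show "\<bar>\<Sum>k'\<in>nbrs k. \<bar>seq x k' - seq x k\<bar>\<bar> \<le> (\<Sum>k'\<in>nbrs k. \<bar>seq x k'\<bar>) + 4 * \<bar>seq x k\<bar>"
    by (simp add: sum.distrib sum_nonneg)
qed

lemma sum_nbrs_powr_le:
  fixes f :: "site \<Rightarrow> real"
  assumes p: "p \<ge> 1" and f: "\<And>k'. f k' \<ge> 0"
  shows "(\<Sum>k'\<in>nbrs k. f k') powr p \<le> 4 powr p * (\<Sum>k'\<in>nbrs k. f k' powr p)"
proof -
  define m where "m = Max (f ` nbrs k)"
  have ne: "nbrs k \<noteq> {}" by (simp add: nbrs_def)
  have "m \<in> f ` nbrs k" unfolding m_def using ne by (intro Max_in) auto
  then obtain l where l: "l \<in> nbrs k" "m = f l" by blast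
  have "(\<Sum>k'\<in>nbrs k. f k') \<le> of_nat (card (nbrs k)) * m"
    by (rule sum_bounded_above) (simp add: m_def)
  then have "(\<Sum>k'\<in>nbrs k. f k') powr p \<le> (4 * m) powr p"
    using p f by (intro powr_mono2) (auto simp: sum_nonneg)
  also have "\<dots> = 4 powr p * f l powr p" using f l by (simp add: powr_mult)
  also have "\<dots> \<le> 4 powr p * (\<Sum>k'\<in>nbrs k. f k' powr p)"
    using l by (intro mult_left_mono member_le_sum) auto
  finally show ?thesis .
qed

text \<open>What the estimates on the lattice system use about \<open>\<parallel>\<cdot>\<parallel>\<^sub>p\<close> and \<open>Q p\<close>. The constant 16 is crude
  but does not depend on \<open>p\<close>.\<close>

definition admissible :: "(site l1 \<Rightarrow> real) \<Rightarrow> (site l1 \<Rightarrow> real) \<Rightarrow> bool" where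
  "admissible S P \<longleftrightarrow> bounded_seminorm S \<and> bounded_seminorm P \<and>
     (\<forall>x y. (\<forall>k. \<bar>seq x k\<bar> \<le> \<bar>seq y k\<bar>) \<longrightarrow> S x \<le> S y) \<and>
     (\<forall>x. S (nbr_sum x) \<le> 16 * S x) \<and> (\<forall>x. S (nbr_diff x) \<le> 16 * P x) \<and> (\<forall>x. P x \<le> 16 * S x)"

text \<open>All constants come from \<open>(a\<^sub>1 + \<dots> + a\<^sub>n)\<^sup>p \<le> n\<^sup>p (a\<^sub>1\<^sup>p + \<dots> + a\<^sub>n\<^sup>p)\<close> and from each
  site having four neighbours: \<open>4\<^sup>p 4 \<le> 16\<^sup>p\<close> and \<open>2\<^sup>p 8 \<le> 16\<^sup>p\<close>.\<close>

lemma admissible_real: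
  assumes p: "1 \<le> r"
  shows "admissible (\<lambda>x. lnorm (ereal r) (seq x)) (\<lambda>x. Q (ereal r) (seq x))"
proof -
  define \<Phi> where "\<Phi> x = (\<Sum>\<^sub>\<infinity>k. \<bar>seq x k\<bar> powr r)" for x :: "site l1"
  define \<Psi> where "\<Psi> x = (\<Sum>\<^sub>\<infinity>k. \<Sum>k'\<in>nbrs k. \<bar>seq x k' - seq x k\<bar> powr r)" for x :: "site l1"
  have r: "r > 0" using p by simp
  have S: "lnorm (ereal r) (seq x) = \<Phi> x powr (1 / r)" for x by (simp add: lnorm_def \<Phi>_def)
  have P: "Q (ereal r) (seq x) = \<Psi> x powr (1 / r)" for x by (simp add: Q_def \<Psi>_def)
  have sum\<Phi>: "(\<lambda>k. \<bar>seq x k\<bar> powr r) summable_on UNIV" for x :: "site l1" by (rule summable_seq_powr[OF p])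
  have le2: "\<bar>a - b\<bar> powr r \<le> 2 powr r * (\<bar>a\<bar> powr r + \<bar>b\<bar> powr r)" for a b :: real
  proof -
    have "\<bar>a - b\<bar> powr r \<le> (2 * max \<bar>a\<bar> \<bar>b\<bar>) powr r" using r by (intro powr_mono2) auto
    also have "\<dots> = 2 powr r * max \<bar>a\<bar> \<bar>b\<bar> powr r" by (simp add: powr_mult)
    also have "\<dots> \<le> 2 powr r * (\<bar>a\<bar> powr r + \<bar>b\<bar> powr r)" by (intro mult_left_mono) (auto simp: max_def)
    finally show ?thesis .
  qed
  have bnd\<Psi>: "(\<Sum>k'\<in>nbrs k. \<bar>seq x k' - seq x k\<bar> powr r)
     \<le> 2 powr r * ((\<Sum>k'\<in>nbrs k. \<bar>seq x k'\<bar> powr r) + 4 * \<bar>seq x k\<bar> powr r)" for x k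
  proof -
    have "(\<Sum>k'\<in>nbrs k. \<bar>seq x k' - seq x k\<bar> powr r)
      \<le> (\<Sum>k'\<in>nbrs k. 2 powr r * (\<bar>seq x k'\<bar> powr r + \<bar>seq x k\<bar> powr r))"
      by (intro sum_mono le2)
    also have "\<dots> = 2 powr r * ((\<Sum>k'\<in>nbrs k. \<bar>seq x k'\<bar> powr r) + 4 * \<bar>seq x k\<bar> powr r)"
      by (simp add: sum_distrib_left[symmetric] sum.distrib)
    finally show ?thesis .
  qed
  have sumB: "(\<lambda>k. 2 powr r * ((\<Sum>k'\<in>nbrs k. \<bar>seq x k'\<bar> powr r) + 4 * \<bar>seq x k\<bar> powr r)) summable_on UNIV" for x
    by (intro summable_on_cmult_right summable_on_add nbrs_summable(1) sum\<Phi>)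
  have sum\<Psi>: "(\<lambda>k. \<Sum>k'\<in>nbrs k. \<bar>seq x k' - seq x k\<bar> powr r) summable_on UNIV" for x
    by (rule summable_on_comparison_test[OF sumB bnd\<Psi>]) (auto simp: sum_nonneg)
  have \<Phi>0: "\<Phi> x \<ge> 0" and \<Psi>0: "\<Psi> x \<ge> 0" for x
    unfolding \<Phi>_def \<Psi>_def by (auto intro!: infsum_nonneg sum_nonneg)
  have \<Psi>\<Phi>: "\<Psi> x \<le> 16 powr r * \<Phi> x" for x
  proof -
    have "\<Psi> x \<le> (\<Sum>\<^sub>\<infinity>k. 2 powr r * ((\<Sum>k'\<in>nbrs k. \<bar>seq x k'\<bar> powr r) + 4 * \<bar>seq x k\<bar> powr r))"
      unfolding \<Psi>_def by (rule infsum_mono[OF sum\<Psi> sumB bnd\<Psi>])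
    also have "\<dots> = 2 powr r * (4 * \<Phi> x + 4 * \<Phi> x)"
      unfolding infsum_cmult_right'
      by (subst infsum_add) (auto simp: nbrs_summable sum\<Phi> \<Phi>_def infsum_cmult_right' intro: summable_on_cmult_right)
    also have "\<dots> = 2 powr r * 8 powr 1 * \<Phi> x" by simp
    also have "\<dots> \<le> 2 powr r * 8 powr r * \<Phi> x"
      using p \<Phi>0 by (intro mult_right_mono mult_left_mono powr_mono) auto
    also have "2 powr r * 8 powr r = (16 :: real) powr r" by (simp add: powr_mult[symmetric])
    finally show ?thesis .
  qed
  have hom: "\<bar>c * a\<bar> powr r = \<bar>c\<bar> powr r * \<bar>a\<bar> powr r" for a c :: real
    by (simp add: abs_mult powr_mult)
  have 1: "\<Phi> (c *\<^sub>R x) = \<bar>c\<bar> powr r * \<Phi> x" for c x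
      by (simp add: \<Phi>_def hom infsum_cmult_right')
  have 2: "\<Phi> (u *\<^sub>R x + (1 - u) *\<^sub>R y) \<le> u * \<Phi> x + (1 - u) * \<Phi> y" if u: "0 \<le> u" "u \<le> 1" for u x y
    proof -
      have "\<Phi> (u *\<^sub>R x + (1 - u) *\<^sub>R y) \<le> (\<Sum>\<^sub>\<infinity>k. u * \<bar>seq x k\<bar> powr r + (1 - u) * \<bar>seq y k\<bar> powr r)"
        unfolding \<Phi>_def
        by (intro infsum_mono sum\<Phi> summable_on_add summable_on_cmult_right) (simp add: abs_powr_convex[OF p u])
      also have "\<dots> = u * \<Phi> x + (1 - u) * \<Phi> y"
        unfolding \<Phi>_def
        by (subst infsum_add) (auto simp: sum\<Phi> infsum_cmult_right' intro: summable_on_cmult_right)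
      finally show ?thesis .
    qed
  note \<Phi>_seminorm = root_of_convex_homogeneous[where \<Phi> = \<Phi>, OF p \<Phi>0 1 2]
  have 1: "\<Psi> (c *\<^sub>R x) = \<bar>c\<bar> powr r * \<Psi> x" for c x
      by (simp add: \<Psi>_def hom right_diff_distrib[symmetric] infsum_cmult_right' sum_distrib_left[symmetric])
  have 2: "\<Psi> (u *\<^sub>R x + (1 - u) *\<^sub>R y) \<le> u * \<Psi> x + (1 - u) * \<Psi> y" if u: "0 \<le> u" "u \<le> 1" for u x y
    proof -
      have "\<Psi> (u *\<^sub>R x + (1 - u) *\<^sub>R y) \<le> (\<Sum>\<^sub>\<infinity>k. u * (\<Sum>k'\<in>nbrs k. \<bar>seq x k' - seq x k\<bar> powr r)
          + (1 - u) * (\<Sum>k'\<in>nbrs k. \<bar>seq y k' - seq y k\<bar> powr r))"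
        unfolding \<Psi>_def
      proof (intro infsum_mono sum\<Psi> summable_on_add summable_on_cmult_right)
        fix k
        have "\<bar>seq (u *\<^sub>R x + (1 - u) *\<^sub>R y) k' - seq (u *\<^sub>R x + (1 - u) *\<^sub>R y) k\<bar> powr r
          \<le> u * \<bar>seq x k' - seq x k\<bar> powr r + (1 - u) * \<bar>seq y k' - seq y k\<bar> powr r" for k'
          using abs_powr_convex[OF p u, of "seq x k' - seq x k" "seq y k' - seq y k"]
          by (simp add: algebra_simps)
        then have "(\<Sum>k'\<in>nbrs k. \<bar>seq (u *\<^sub>R x + (1 - u) *\<^sub>R y) k' - seq (u *\<^sub>R x + (1 - u) *\<^sub>R y) k\<bar> powr r)
          \<le> (\<Sum>k'\<in>nbrs k. u * \<bar>seq x k' - seq x k\<bar> powr r + (1 - u) * \<bar>seq y k' - seq y k\<bar> powr r)"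
          by (rule sum_mono)
        then show "(\<Sum>k'\<in>nbrs k. \<bar>seq (u *\<^sub>R x + (1 - u) *\<^sub>R y) k' - seq (u *\<^sub>R x + (1 - u) *\<^sub>R y) k\<bar> powr r)
          \<le> u * (\<Sum>k'\<in>nbrs k. \<bar>seq x k' - seq x k\<bar> powr r) + (1 - u) * (\<Sum>k'\<in>nbrs k. \<bar>seq y k' - seq y k\<bar> powr r)"
          by (simp only: sum.distrib sum_distrib_left)
      qed
      also have "\<dots> = u * \<Psi> x + (1 - u) * \<Psi> y"
        unfolding \<Psi>_def
        by (subst infsum_add) (auto simp: sum\<Psi> infsum_cmult_right' intro: summable_on_cmult_right)
      finally show ?thesis .
    qed
  note \<Psi>_seminorm = root_of_convex_homogeneous[where \<Phi> = \<Psi>, OF p \<Psi>0 1 2]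
  have bound\<Phi>: "\<Phi> x powr (1 / r) \<le> norm x" for x
    using powr_root_le[of r "\<Phi> x" 1 "norm x"] p \<Phi>0[of x] summable_seq_powr(2)[OF p, of x] by (simp add: \<Phi>_def)
  have bound\<Psi>: "\<Psi> x powr (1 / r) \<le> 16 * \<Phi> x powr (1 / r)" for x
    by (rule powr_root_le[OF p \<Psi>0 \<Phi>0 _ \<Psi>\<Phi>]) simp
  have bsum: "bounded_seminorm (\<lambda>x. \<Phi> x powr (1 / r))" "bounded_seminorm (\<lambda>x. \<Psi> x powr (1 / r))"
    unfolding bounded_seminorm_def using \<Phi>_seminorm \<Psi>_seminorm bound\<Phi> order_trans[OF bound\<Psi> mult_left_mono[OF bound\<Phi>]]
    by (auto intro: exI[of _ 1] exI[of _ 16])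
  have mono: "\<Phi> x powr (1 / r) \<le> \<Phi> y powr (1 / r)" if "\<And>k. \<bar>seq x k\<bar> \<le> \<bar>seq y k\<bar>" for x y
  proof -
    have "\<Phi> x \<le> \<Phi> y" unfolding \<Phi>_def using that r by (intro infsum_mono sum\<Phi> powr_mono2) auto
    then show ?thesis using \<Phi>0 r by (intro powr_mono2) auto
  qed
  have "\<Phi> (nbr_sum x) powr (1 / r) \<le> 16 * \<Phi> x powr (1 / r)" for x
  proof (rule powr_root_le[OF p \<Phi>0 \<Phi>0])
    have "\<Phi> (nbr_sum x) \<le> (\<Sum>\<^sub>\<infinity>k. 4 powr r * (\<Sum>k'\<in>nbrs k. \<bar>seq x k'\<bar> powr r))"
      unfolding \<Phi>_def
    proof (intro infsum_mono sum\<Phi> summable_on_cmult_right nbrs_summable(1))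
      fix k show "\<bar>seq (nbr_sum x) k\<bar> powr r \<le> 4 powr r * (\<Sum>k'\<in>nbrs k. \<bar>seq x k'\<bar> powr r)"
        using sum_nbrs_powr_le[OF p, of "\<lambda>k. \<bar>seq x k\<bar>" k] by (simp add: seq_nbr_sum sum_nonneg)
    qed
    also have "\<dots> = 4 powr r * 4 powr 1 * \<Phi> x"
      by (simp add: infsum_cmult_right' nbrs_summable(2) sum\<Phi> \<Phi>_def)
    also have "\<dots> \<le> 4 powr r * 4 powr r * \<Phi> x"
      using p \<Phi>0 by (intro mult_right_mono mult_left_mono powr_mono) auto
    also have "4 powr r * 4 powr r = (16 :: real) powr r" by (simp add: powr_mult[symmetric])
    finally show "\<Phi> (nbr_sum x) \<le> 16 powr r * \<Phi> x" .
  qed simp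
  moreover have "\<Phi> (nbr_diff x) powr (1 / r) \<le> 16 * \<Psi> x powr (1 / r)" for x
  proof (rule powr_root_le[OF p \<Phi>0 \<Psi>0])
    have "\<Phi> (nbr_diff x) \<le> (\<Sum>\<^sub>\<infinity>k. 4 powr r * (\<Sum>k'\<in>nbrs k. \<bar>seq x k' - seq x k\<bar> powr r))"
      unfolding \<Phi>_def
    proof (intro infsum_mono sum\<Phi> summable_on_cmult_right sum\<Psi>)
      fix k show "\<bar>seq (nbr_diff x) k\<bar> powr r \<le> 4 powr r * (\<Sum>k'\<in>nbrs k. \<bar>seq x k' - seq x k\<bar> powr r)"
        using sum_nbrs_powr_le[OF p, of "\<lambda>k'. \<bar>seq x k' - seq x k\<bar>" k] by (simp add: seq_nbr_diff sum_nonneg)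
    qed
    also have "\<dots> = 4 powr r * \<Psi> x" by (simp add: infsum_cmult_right' \<Psi>_def)
    also have "\<dots> \<le> 16 powr r * \<Psi> x" using r \<Psi>0 by (intro mult_right_mono powr_mono2) auto
    finally show "\<Phi> (nbr_diff x) \<le> 16 powr r * \<Psi> x" .
  qed simp
  ultimately show ?thesis
    unfolding admissible_def S P using bsum mono bound\<Psi> by blast
qed

lemma SUP_abs_bdd: "bdd_above (range (\<lambda>k. \<bar>seq x k\<bar>))"
  by (rule bdd_aboveI2[of _ _ "norm x"]) (rule abs_seq_le_norm)

lemma abs_seq_le_lnorm_infinity: "\<bar>seq x k\<bar> \<le> lnorm \<infinity> (seq x)"
  unfolding lnorm_def by (simp add: cSUP_upper[OF _ SUP_abs_bdd])

lemma lnorm_infinity_leI: "(\<And>k. \<bar>seq x k\<bar> \<le> b) \<Longrightarrow> lnorm \<infinity> (seq x) \<le> b"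
  unfolding lnorm_def by (simp add: cSUP_least)

lemma Q_infinity: "Q \<infinity> (seq x) = lnorm \<infinity> (seq (nbr_diff x))"
  by (simp add: Q_def lnorm_def seq_nbr_diff sum_nonneg)

lemma nbr_diff_triangle: "seq (nbr_diff (x + y)) k \<le> seq (nbr_diff x) k + seq (nbr_diff y) k"
proof -
  have "(\<Sum>k'\<in>nbrs k. \<bar>(seq x k' + seq y k') - (seq x k + seq y k)\<bar>)
    \<le> (\<Sum>k'\<in>nbrs k. \<bar>seq x k' - seq x k\<bar> + \<bar>seq y k' - seq y k\<bar>)"
    by (intro sum_mono) linarith
  then show ?thesis by (simp add: seq_nbr_diff sum.distrib)
qed

lemma nbr_diff_scaleR: "nbr_diff (c *\<^sub>R x) = \<bar>c\<bar> *\<^sub>R nbr_diff x"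
  by (rule l1_eqI) (simp add: seq_nbr_diff right_diff_distrib[symmetric] abs_mult sum_distrib_left)

lemma nbr_diff_nonneg: "0 \<le> seq (nbr_diff x) k"
  by (simp add: seq_nbr_diff sum_nonneg)

lemma admissible_infinity: "admissible (\<lambda>x. lnorm \<infinity> (seq x)) (\<lambda>x. Q \<infinity> (seq x))"
proof -
  define S where "S x = lnorm \<infinity> (seq x)" for x :: "site l1"
  have up: "\<bar>seq x k\<bar> \<le> S x" for x k unfolding S_def by (rule abs_seq_le_lnorm_infinity)
  have least: "S x \<le> b" if "\<And>k. \<bar>seq x k\<bar> \<le> b" for x b unfolding S_def using that by (rule lnorm_infinity_leI)
  have S0: "S x \<ge> 0" for x using up[of x undefined] by simp
  have tri: "S (x + y) \<le> S x + S y" for x y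
    using up[of x] up[of y] by (intro least) (smt (verit) seq_plus)
  have hom_le: "S (c *\<^sub>R x) \<le> \<bar>c\<bar> * S x" for c x
    by (rule least) (auto simp: abs_mult intro!: mult_left_mono up)
  have hom: "S (c *\<^sub>R x) = \<bar>c\<bar> * S x" for c x
  proof (cases "c = 0")
    case True then show ?thesis using hom_le[of 0 x] S0[of "0 *\<^sub>R x"] by simp
  next
    case False
    then show ?thesis using hom_le[of c x] hom_le[of "inverse c" "c *\<^sub>R x"] by (simp add: field_simps)
  qed
  have mono: "S x \<le> S y" if "\<And>k. \<bar>seq x k\<bar> \<le> \<bar>seq y k\<bar>" for x y
    using that up by (intro least) (meson order_trans)
  have bS: "S x \<le> 1 * norm x" for x by (simp add: least abs_seq_le_norm)
  have nbr_sum: "S (nbr_sum x) \<le> 16 * S x" for x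
  proof (rule least)
    fix k
    have "(\<Sum>k'\<in>nbrs k. \<bar>seq x k'\<bar>) \<le> of_nat (card (nbrs k)) * S x"
      by (rule sum_bounded_above) (rule up)
    then show "\<bar>seq (nbr_sum x) k\<bar> \<le> 16 * S x" using S0[of x] by (simp add: seq_nbr_sum sum_nonneg)
  qed
  have nbr_diff: "S (nbr_diff x) \<le> 16 * S x" for x
  proof (rule least)
    fix k
    have "\<bar>seq x k' - seq x k\<bar> \<le> 2 * S x" for k' using up[of x k] up[of x k'] by linarith
    then have "(\<Sum>k'\<in>nbrs k. \<bar>seq x k' - seq x k\<bar>) \<le> of_nat (card (nbrs k)) * (2 * S x)"
      by (intro sum_bounded_above)
    then show "\<bar>seq (nbr_diff x) k\<bar> \<le> 16 * S x" using S0[of x] by (simp add: seq_nbr_diff sum_nonneg)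
  qed
  have gtri: "S (nbr_diff (x + y)) \<le> S (nbr_diff x) + S (nbr_diff y)" for x y
    by (rule order_trans[OF mono tri]) (use nbr_diff_triangle nbr_diff_nonneg in \<open>simp add: order_trans[OF _ abs_ge_self]\<close>)
  have "bounded_seminorm S" unfolding bounded_seminorm_def using tri hom bS by blast
  moreover have "bounded_seminorm (\<lambda>x. S (nbr_diff x))"
    unfolding bounded_seminorm_def
    using gtri order_trans[OF nbr_diff mult_left_mono[OF bS]] by (auto simp: nbr_diff_scaleR hom intro!: exI[of _ 16])
  ultimately show ?thesis
    unfolding admissible_def Q_infinity S_def[symmetric]
    using mono nbr_sum nbr_diff S0 by (auto intro: order_trans)
qed

lemma admissible_lnorm:
  assumes "p \<ge> 1"
  shows "admissible (\<lambda>x. lnorm p (seq x)) (\<lambda>x. Q p (seq x))"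
  using assms admissible_real admissible_infinity by (cases p) auto

lemma lnorm_1: "lnorm 1 (seq x) = norm x"
  by (simp add: lnorm_def norm_l1_def infsum_nonneg)

section \<open>The clipped lattice system\<close>

lemma abs_cos_diff_le: "\<bar>cos x - cos y\<bar> \<le> \<bar>x - y\<bar>" for x y :: real
proof -
  have "\<bar>cos x - cos y\<bar> = 2 * (\<bar>sin ((x + y) / 2)\<bar> * \<bar>sin ((y - x) / 2)\<bar>)"
    unfolding cos_diff_cos by (simp add: abs_mult)
  also have "\<dots> \<le> 2 * (1 * \<bar>(y - x) / 2\<bar>)"
    by (intro mult_left_mono mult_mono abs_sin_le_one abs_sin_x_le_abs_x) auto
  finally show ?thesis by (simp add: abs_minus_commute)
qed

lemma abs_sin_diff_le: "\<bar>sin x - sin y\<bar> \<le> \<bar>x - y\<bar>" for x y :: real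
  using abs_cos_diff_le[of "pi / 2 - x" "pi / 2 - y"] by (simp add: cos_diff abs_minus_commute)

text \<open>Truncation at height \<open>\<rho>\<close>. It does not increase differences, so the truncated system is globally
  Lipschitz although the original one is defined for positive radii only.\<close>

definition clip :: "real \<Rightarrow> real \<Rightarrow> real" where
  "clip \<rho> x = max (- \<rho>) (min \<rho> x)"

lemma clip_diff_le: "\<bar>clip \<rho> x - clip \<rho> y\<bar> \<le> \<bar>x - y\<bar>"
  by (auto simp: clip_def max_def min_def)

lemma clip_abs_le: "\<rho> \<ge> 0 \<Longrightarrow> \<bar>clip \<rho> x\<bar> \<le> \<rho>"
  by (auto simp: clip_def max_def min_def)

lemma clip_id: "\<bar>x\<bar> \<le> \<rho> \<Longrightarrow> clip \<rho> x = x"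
  by (auto simp: clip_def max_def min_def)

lemma mult_diff_le:
  fixes u v u' v' :: real
  assumes "\<bar>v\<bar> \<le> 1" "\<bar>u'\<bar> \<le> B" "\<bar>v - v'\<bar> \<le> e"
  shows "\<bar>u * v - u' * v'\<bar> \<le> \<bar>u - u'\<bar> + B * e"
proof -
  have "u * v - u' * v' = (u - u') * v + u' * (v - v')" by (simp add: algebra_simps)
  then have "\<bar>u * v - u' * v'\<bar> \<le> \<bar>u - u'\<bar> * \<bar>v\<bar> + \<bar>u'\<bar> * \<bar>v - v'\<bar>"
    by (metis abs_mult abs_triangle_ineq)
  also have "\<dots> \<le> \<bar>u - u'\<bar> * 1 + B * e"
    using assms by (intro add_mono mult_left_mono mult_mono) auto
  finally show ?thesis by simp
qed

lemma ratio_diff_le: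
  fixes R1 R2 r1 r2 a :: real
  assumes a: "a > 0" and R: "a / 2 \<le> R1" "a / 2 \<le> R2" "r2 \<le> 3 * a / 2" "0 \<le> r2"
  shows "\<bar>r1 / R1 - r2 / R2\<bar> \<le> 2 / a * \<bar>r1 - r2\<bar> + 6 / a * \<bar>R1 - R2\<bar>"
proof -
  have pos: "R1 > 0" "R2 > 0" using a R by auto
  have "r1 / R1 - r2 / R2 = (r1 - r2) / R1 + r2 * (R2 - R1) / (R1 * R2)"
    using pos by (simp add: field_simps)
  then have "\<bar>r1 / R1 - r2 / R2\<bar> \<le> \<bar>r1 - r2\<bar> / R1 + r2 * \<bar>R1 - R2\<bar> / (R1 * R2)"
    using abs_triangle_ineq[of "(r1 - r2) / R1" "r2 * (R2 - R1) / (R1 * R2)"] pos R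
    by (simp add: abs_mult abs_minus_commute)
  also have "\<dots> \<le> \<bar>r1 - r2\<bar> / (a / 2) + (3 * a / 2) * \<bar>R1 - R2\<bar> / ((a / 2) * (a / 2))"
    using a R by (intro add_mono frac_le mult_mono mult_nonneg_nonneg) auto
  also have "\<dots> = 2 / a * \<bar>r1 - r2\<bar> + 6 / a * \<bar>R1 - R2\<bar>"
    using a by (simp add: field_simps power2_eq_square)
  finally show ?thesis .
qed

text \<open>The coupling strength \<open>\<alpha>\<close> is fixed. The clipped radii lie within \<open>2 \<rho>\<close> of \<open>a\<close>, and there the
  amplitude equation differs from \<open>- \<mu> (r - a)\<close> by a function with small Lipschitz constant \<open>\<eta>0\<close>.\<close>

locale oscillators =
  fixes lam :: "real \<Rightarrow> real" and om1 :: "real \<Rightarrow> real \<Rightarrow> real" and rb tb :: "real \<Rightarrow> lattice_seq"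
    and \<alpha> a \<mu> \<rho> \<eta>0 Lw :: real
  assumes a: "a > 0" and \<mu>_pos: "\<mu> > 0" and \<alpha>: "\<alpha> \<ge> 0" and \<rho>: "\<rho> > 0" "\<rho> \<le> a / 4" and \<eta>0: "\<eta>0 \<ge> 0" and Lw: "Lw \<ge> 0"
    and radius: "\<bar>rb \<alpha> k - a\<bar> \<le> \<rho>"
    and amplitude: "\<lbrakk>\<bar>r - a\<bar> \<le> 2 * \<rho>; \<bar>r' - a\<bar> \<le> 2 * \<rho>\<rbrakk>
      \<Longrightarrow> \<bar>(r * lam r + \<mu> * r) - (r' * lam r' + \<mu> * r')\<bar> \<le> \<eta>0 * \<bar>r - r'\<bar>"
    and frequency: "\<lbrakk>\<bar>r - a\<bar> \<le> 2 * \<rho>; \<bar>r' - a\<bar> \<le> 2 * \<rho>\<rbrakk> \<Longrightarrow> \<bar>om1 r \<alpha> - om1 r' \<alpha>\<bar> \<le> Lw * \<bar>r - r'\<bar>"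
    and eq1: "\<alpha> * (\<Sum>k'\<in>nbrs k. rb \<alpha> k' * cos (tb \<alpha> k' - tb \<alpha> k) - rb \<alpha> k) + rb \<alpha> k * lam (rb \<alpha> k) = 0"
    and eq2: "(\<Sum>k'\<in>nbrs k. rb \<alpha> k' / rb \<alpha> k * sin (tb \<alpha> k' - tb \<alpha> k)) + om1 (rb \<alpha> k) \<alpha> = 0"
begin

text \<open>The linear term restores what is subtracted in \<open>- \<mu> s + N s \<psi>\<close>, so on \<open>\<bar>s k\<bar> \<le> \<rho>\<close> this gives the
  original equation.\<close>

definition fast_part :: "lattice_seq \<Rightarrow> lattice_seq \<Rightarrow> lattice_seq" where
  "fast_part s \<psi> = (\<lambda>k. F lam rb tb (\<lambda>j. clip \<rho> (s j)) \<psi> \<alpha> k + \<mu> * clip \<rho> (s k))"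

definition slow_part :: "lattice_seq \<Rightarrow> lattice_seq \<Rightarrow> lattice_seq" where
  "slow_part s \<psi> = (\<lambda>k. \<alpha> * G om1 rb tb (\<lambda>j. clip \<rho> (s j)) \<psi> \<alpha> k)"

definition rad :: "lattice_seq \<Rightarrow> lattice_seq" where
  "rad s k = rb \<alpha> k + clip \<rho> (s k)"

lemma rad: "\<bar>rad s k - a\<bar> \<le> 2 * \<rho>" "a / 2 \<le> rad s k" "rad s k \<le> 3 * a / 2"
  "\<bar>rad s k - rad s' k\<bar> \<le> \<bar>s k - s' k\<bar>"
proof -
  show 1: "\<bar>rad s k - a\<bar> \<le> 2 * \<rho>"
    using clip_abs_le[of \<rho> "s k"] radius[of k] \<rho> by (simp add: rad_def)
  show "a / 2 \<le> rad s k" "rad s k \<le> 3 * a / 2" using 1 \<rho> by (auto simp: abs_le_iff)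
  show "\<bar>rad s k - rad s' k\<bar> \<le> \<bar>s k - s' k\<bar>" using clip_diff_le by (simp add: rad_def)
qed

definition rel_nbr_diff :: "lattice_seq \<Rightarrow> lattice_seq \<Rightarrow> site \<Rightarrow> real" where
  "rel_nbr_diff \<psi> \<psi>' k = (\<Sum>k'\<in>nbrs k. \<bar>(\<psi> k' - \<psi>' k') - (\<psi> k - \<psi>' k)\<bar>)"

lemma fast_part_diff:
  "\<bar>fast_part s \<psi> k - fast_part s' \<psi>' k\<bar> \<le> (\<eta>0 + 4 * \<alpha>) * \<bar>s k - s' k\<bar>
     + \<alpha> * (\<Sum>k'\<in>nbrs k. \<bar>s k' - s' k'\<bar>) + 2 * a * \<alpha> * rel_nbr_diff \<psi> \<psi>' k"
proof -
  define T where "T s \<psi> k' = rad s k' * cos (tb \<alpha> k' + \<psi> k' - tb \<alpha> k - \<psi> k) - rad s k" for s \<psi> k'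
  define f where "f r = r * lam r + \<mu> * r" for r
  have eq: "fast_part s \<psi> k = \<alpha> * (\<Sum>k'\<in>nbrs k. T s \<psi> k') + f (rad s k) - \<mu> * rb \<alpha> k" for s \<psi>
    by (simp add: fast_part_def F_def T_def f_def rad_def algebra_simps)
  have T: "\<bar>T s \<psi> k' - T s' \<psi>' k'\<bar>
     \<le> \<bar>s k' - s' k'\<bar> + 2 * a * \<bar>(\<psi> k' - \<psi>' k') - (\<psi> k - \<psi>' k)\<bar> + \<bar>s k - s' k\<bar>" for k'
  proof -
    have "\<bar>rad s k' * cos (tb \<alpha> k' + \<psi> k' - tb \<alpha> k - \<psi> k) - rad s' k' * cos (tb \<alpha> k' + \<psi>' k' - tb \<alpha> k - \<psi>' k)\<bar>
      \<le> \<bar>rad s k' - rad s' k'\<bar> + 2 * a * \<bar>(tb \<alpha> k' + \<psi> k' - tb \<alpha> k - \<psi> k) - (tb \<alpha> k' + \<psi>' k' - tb \<alpha> k - \<psi>' k)\<bar>"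
      using rad(2,3)[where s = s' and k = k'] a by (intro mult_diff_le abs_cos_le_one abs_cos_diff_le) auto
    also have "(tb \<alpha> k' + \<psi> k' - tb \<alpha> k - \<psi> k) - (tb \<alpha> k' + \<psi>' k' - tb \<alpha> k - \<psi>' k) = (\<psi> k' - \<psi>' k') - (\<psi> k - \<psi>' k)"
      by simp
    finally show ?thesis
      using rad(4)[of s k' s'] rad(4)[of s k s'] unfolding T_def by linarith
  qed
  have "\<bar>(\<Sum>k'\<in>nbrs k. T s \<psi> k') - (\<Sum>k'\<in>nbrs k. T s' \<psi>' k')\<bar> \<le> (\<Sum>k'\<in>nbrs k. \<bar>T s \<psi> k' - T s' \<psi>' k'\<bar>)"
    unfolding sum_subtractf[symmetric] by (rule sum_abs)
  also have "\<dots> \<le> (\<Sum>k'\<in>nbrs k. \<bar>s k' - s' k'\<bar> + 2 * a * \<bar>(\<psi> k' - \<psi>' k') - (\<psi> k - \<psi>' k)\<bar> + \<bar>s k - s' k\<bar>)"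
    by (intro sum_mono T)
  also have "\<dots> = (\<Sum>k'\<in>nbrs k. \<bar>s k' - s' k'\<bar>) + 2 * a * rel_nbr_diff \<psi> \<psi>' k + 4 * \<bar>s k - s' k\<bar>"
    by (simp add: sum.distrib sum_distrib_left rel_nbr_diff_def)
  finally have 1: "\<alpha> * \<bar>(\<Sum>k'\<in>nbrs k. T s \<psi> k') - (\<Sum>k'\<in>nbrs k. T s' \<psi>' k')\<bar>
      \<le> \<alpha> * ((\<Sum>k'\<in>nbrs k. \<bar>s k' - s' k'\<bar>) + 2 * a * rel_nbr_diff \<psi> \<psi>' k + 4 * \<bar>s k - s' k\<bar>)"
    using \<alpha> by (rule mult_left_mono)
  have "\<bar>f (rad s k) - f (rad s' k)\<bar> \<le> \<eta>0 * \<bar>rad s k - rad s' k\<bar>"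
    unfolding f_def by (rule amplitude[OF rad(1) rad(1)])
  also have "\<dots> \<le> \<eta>0 * \<bar>s k - s' k\<bar>" using \<eta>0 by (intro mult_left_mono rad)
  finally have 2: "\<bar>f (rad s k) - f (rad s' k)\<bar> \<le> \<eta>0 * \<bar>s k - s' k\<bar>" .
  have "fast_part s \<psi> k - fast_part s' \<psi>' k = \<alpha> * ((\<Sum>k'\<in>nbrs k. T s \<psi> k') - (\<Sum>k'\<in>nbrs k. T s' \<psi>' k'))
      + (f (rad s k) - f (rad s' k))"
    unfolding eq by (simp add: algebra_simps)
  then have "\<bar>fast_part s \<psi> k - fast_part s' \<psi>' k\<bar> \<le> \<alpha> * \<bar>(\<Sum>k'\<in>nbrs k. T s \<psi> k') - (\<Sum>k'\<in>nbrs k. T s' \<psi>' k')\<bar>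
      + \<bar>f (rad s k) - f (rad s' k)\<bar>"
    using abs_triangle_ineq \<alpha> by (metis abs_mult abs_of_nonneg)
  then show ?thesis using 1 2 by (simp add: algebra_simps)
qed

lemma slow_part_diff:
  "\<bar>slow_part s \<psi> k - slow_part s' \<psi>' k\<bar> \<le> \<alpha> * ((24 / a + Lw) * \<bar>s k - s' k\<bar>
     + 2 / a * (\<Sum>k'\<in>nbrs k. \<bar>s k' - s' k'\<bar>) + 3 * rel_nbr_diff \<psi> \<psi>' k)"
proof -
  define T where "T s \<psi> k' = rad s k' / rad s k * sin (tb \<alpha> k' + \<psi> k' - tb \<alpha> k - \<psi> k)" for s \<psi> k'
  have eq: "slow_part s \<psi> k = \<alpha> * ((\<Sum>k'\<in>nbrs k. T s \<psi> k') + om1 (rad s k) \<alpha>)" for s \<psi>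
    by (simp add: slow_part_def G_def T_def rad_def)
  have T: "\<bar>T s \<psi> k' - T s' \<psi>' k'\<bar>
     \<le> 2 / a * \<bar>s k' - s' k'\<bar> + 6 / a * \<bar>s k - s' k\<bar> + 3 * \<bar>(\<psi> k' - \<psi>' k') - (\<psi> k - \<psi>' k)\<bar>" for k'
  proof -
    have "\<bar>T s \<psi> k' - T s' \<psi>' k'\<bar> \<le> \<bar>rad s k' / rad s k - rad s' k' / rad s' k\<bar>
      + 3 * \<bar>(tb \<alpha> k' + \<psi> k' - tb \<alpha> k - \<psi> k) - (tb \<alpha> k' + \<psi>' k' - tb \<alpha> k - \<psi>' k)\<bar>"
      unfolding T_def
    proof (intro mult_diff_le abs_sin_le_one abs_sin_diff_le)
      show "\<bar>rad s' k' / rad s' k\<bar> \<le> 3"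
        using rad(2)[of s' k] rad(2,3)[where s = s' and k = k'] a by (simp add: divide_le_eq)
    qed
    also have "(tb \<alpha> k' + \<psi> k' - tb \<alpha> k - \<psi> k) - (tb \<alpha> k' + \<psi>' k' - tb \<alpha> k - \<psi>' k) = (\<psi> k' - \<psi>' k') - (\<psi> k - \<psi>' k)"
      by simp
    also have "\<bar>rad s k' / rad s k - rad s' k' / rad s' k\<bar> \<le> 2 / a * \<bar>rad s k' - rad s' k'\<bar> + 6 / a * \<bar>rad s k - rad s' k\<bar>"
      using rad(2)[of s' k'] a by (intro ratio_diff_le rad) auto
    also have "\<dots> \<le> 2 / a * \<bar>s k' - s' k'\<bar> + 6 / a * \<bar>s k - s' k\<bar>"
      using a by (intro add_mono mult_left_mono rad) auto
    finally show ?thesis by simp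
  qed
  have "\<bar>(\<Sum>k'\<in>nbrs k. T s \<psi> k') - (\<Sum>k'\<in>nbrs k. T s' \<psi>' k')\<bar> \<le> (\<Sum>k'\<in>nbrs k. \<bar>T s \<psi> k' - T s' \<psi>' k'\<bar>)"
    unfolding sum_subtractf[symmetric] by (rule sum_abs)
  also have "\<dots> \<le> (\<Sum>k'\<in>nbrs k. 2 / a * \<bar>s k' - s' k'\<bar> + 6 / a * \<bar>s k - s' k\<bar> + 3 * \<bar>(\<psi> k' - \<psi>' k') - (\<psi> k - \<psi>' k)\<bar>)"
    by (intro sum_mono T)
  also have "\<dots> = 2 / a * (\<Sum>k'\<in>nbrs k. \<bar>s k' - s' k'\<bar>) + 24 / a * \<bar>s k - s' k\<bar> + 3 * rel_nbr_diff \<psi> \<psi>' k"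
    by (simp add: sum.distrib sum_distrib_left rel_nbr_diff_def)
  finally have 1: "\<bar>(\<Sum>k'\<in>nbrs k. T s \<psi> k') - (\<Sum>k'\<in>nbrs k. T s' \<psi>' k')\<bar>
    \<le> 2 / a * (\<Sum>k'\<in>nbrs k. \<bar>s k' - s' k'\<bar>) + 24 / a * \<bar>s k - s' k\<bar> + 3 * rel_nbr_diff \<psi> \<psi>' k" .
  have "\<bar>om1 (rad s k) \<alpha> - om1 (rad s' k) \<alpha>\<bar> \<le> Lw * \<bar>rad s k - rad s' k\<bar>"
    by (rule frequency[OF rad(1) rad(1)])
  also have "\<dots> \<le> Lw * \<bar>s k - s' k\<bar>" using Lw by (intro mult_left_mono rad)
  finally have 2: "\<bar>om1 (rad s k) \<alpha> - om1 (rad s' k) \<alpha>\<bar> \<le> Lw * \<bar>s k - s' k\<bar>" .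
  have "\<bar>((\<Sum>k'\<in>nbrs k. T s \<psi> k') + om1 (rad s k) \<alpha>) - ((\<Sum>k'\<in>nbrs k. T s' \<psi>' k') + om1 (rad s' k) \<alpha>)\<bar>
    \<le> (24 / a + Lw) * \<bar>s k - s' k\<bar> + 2 / a * (\<Sum>k'\<in>nbrs k. \<bar>s k' - s' k'\<bar>) + 3 * rel_nbr_diff \<psi> \<psi>' k"
    using 1 2 unfolding distrib_right by linarith
  then show ?thesis
    unfolding eq right_diff_distrib[symmetric] abs_mult using \<alpha> by (simp add: mult_left_mono)
qed

lemma fast_part_zero: "fast_part (\<lambda>_. 0) (\<lambda>_. 0) = (\<lambda>_. 0)"
  using eq1 \<rho> by (simp add: fast_part_def F_def clip_def)

lemma slow_part_zero: "slow_part (\<lambda>_. 0) (\<lambda>_. 0) = (\<lambda>_. 0)"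
  using eq2 \<rho> by (simp add: slow_part_def G_def clip_def)

text \<open>A phase change alters each cosine by at most 2, however large the phases are.\<close>

lemma fast_part_bounded: "\<bar>fast_part (\<lambda>_. 0) \<psi> k\<bar> \<le> 12 * a * \<alpha>"
proof -
  have rbk: "\<bar>rb \<alpha> j\<bar> \<le> 3 * a / 2" for j using radius[of j] \<rho> a by (auto simp: abs_le_iff)
  have "fast_part (\<lambda>_. 0) \<psi> k = fast_part (\<lambda>_. 0) \<psi> k - fast_part (\<lambda>_. 0) (\<lambda>_. 0) k" by (simp add: fast_part_zero)
  also have "\<dots> = \<alpha> * (\<Sum>k'\<in>nbrs k. rb \<alpha> k' * (cos (tb \<alpha> k' + \<psi> k' - tb \<alpha> k - \<psi> k) - cos (tb \<alpha> k' - tb \<alpha> k)))"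
    using \<rho> by (simp add: fast_part_def F_def clip_def right_diff_distrib[symmetric] sum_subtractf[symmetric])
  finally have "\<bar>fast_part (\<lambda>_. 0) \<psi> k\<bar> = \<alpha> * \<bar>\<Sum>k'\<in>nbrs k. rb \<alpha> k' * (cos (tb \<alpha> k' + \<psi> k' - tb \<alpha> k - \<psi> k) - cos (tb \<alpha> k' - tb \<alpha> k))\<bar>"
    using \<alpha> by (simp add: abs_mult)
  also have "\<dots> \<le> \<alpha> * (\<Sum>k'\<in>nbrs k. 3 * a / 2 * 2)"
  proof (intro mult_left_mono order_trans[OF sum_abs sum_mono] \<alpha>)
    fix k'
    have c: "\<bar>cos x - cos y\<bar> \<le> 2" for x y :: real
      using abs_cos_le_one[of x] abs_cos_le_one[of y] by linarith
    show "\<bar>rb \<alpha> k' * (cos (tb \<alpha> k' + \<psi> k' - tb \<alpha> k - \<psi> k) - cos (tb \<alpha> k' - tb \<alpha> k))\<bar> \<le> 3 * a / 2 * 2"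
      unfolding abs_mult using a by (intro mult_mono rbk c) auto
  qed
  also have "\<dots> = 12 * a * \<alpha>" by simp
  finally show ?thesis .
qed

end


text \<open>Site-wise estimates in terms of a site and its neighbours turn into estimates for \<open>S\<close> and \<open>P\<close>.\<close>

lemma admissible_dominated:
  assumes adm: "admissible S P" and pos: "A \<ge> 0" "B \<ge> 0" "C \<ge> 0"
    and le: "\<And>k. \<bar>seq z k\<bar> \<le> A * \<bar>seq d k\<bar> + B * seq (nbr_sum d) k + C * seq (nbr_diff e) k"
  shows "S z \<le> (A + 16 * B) * S d + 16 * C * P e"
proof -
  note S = bounded_seminormD[of S]
  have bS: "bounded_seminorm S" and mono: "\<And>x y. (\<And>k. \<bar>seq x k\<bar> \<le> \<bar>seq y k\<bar>) \<Longrightarrow> S x \<le> S y"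
    and n: "S (nbr_sum d) \<le> 16 * S d" and g: "S (nbr_diff e) \<le> 16 * P e"
    using adm unfolding admissible_def by blast+
  define d' where "d' = L1 (\<lambda>k. \<bar>seq d k\<bar>)"
  have d': "seq d' = (\<lambda>k. \<bar>seq d k\<bar>)" unfolding d'_def by (rule seq_L1) simp
  have "S z \<le> S (A *\<^sub>R d' + B *\<^sub>R nbr_sum d + C *\<^sub>R nbr_diff e)"
  proof (rule mono)
    fix k
    show "\<bar>seq z k\<bar> \<le> \<bar>seq (A *\<^sub>R d' + B *\<^sub>R nbr_sum d + C *\<^sub>R nbr_diff e) k\<bar>"
      using le[of k] by (simp add: d')
  qed
  also have "\<dots> \<le> S (A *\<^sub>R d') + S (B *\<^sub>R nbr_sum d) + S (C *\<^sub>R nbr_diff e)"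
    using S(1)[OF bS, of "A *\<^sub>R d' + B *\<^sub>R nbr_sum d" "C *\<^sub>R nbr_diff e"] S(1)[OF bS, of "A *\<^sub>R d'" "B *\<^sub>R nbr_sum d"] by simp
  also have "\<dots> = A * S d' + B * S (nbr_sum d) + C * S (nbr_diff e)"
    using pos by (simp add: S(2)[OF bS])
  also have "\<dots> \<le> A * S d + B * (16 * S d) + C * (16 * P e)"
    using pos n g by (intro add_mono mult_left_mono mono) (auto simp: d')
  finally show ?thesis by (simp add: algebra_simps)
qed

context oscillators
begin

definition N :: "site l1 \<Rightarrow> site l1 \<Rightarrow> site l1" where
  "N s \<psi> = L1 (fast_part (seq s) (seq \<psi>))"

definition g :: "site l1 \<Rightarrow> site l1 \<Rightarrow> site l1" where
  "g s \<psi> = L1 (slow_part (seq s) (seq \<psi>))"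

lemma rel_nbr_diff_seq: "rel_nbr_diff (seq \<psi>) (seq \<psi>') k = seq (nbr_diff (\<psi> - \<psi>')) k"
  by (simp add: rel_nbr_diff_def seq_nbr_diff)

lemma nbr_sum_diff_seq: "(\<Sum>k'\<in>nbrs k. \<bar>seq s k' - seq s' k'\<bar>) = seq (nbr_sum (s - s')) k"
  by (simp add: seq_nbr_sum)

lemma seq_N: "seq (N s \<psi>) = fast_part (seq s) (seq \<psi>)"
  unfolding N_def
proof (rule seq_L1, rule summable_abs_le)
  show "(\<lambda>k. (\<eta>0 + 4 * \<alpha>) * \<bar>seq s k\<bar> + \<alpha> * \<bar>seq (nbr_sum s) k\<bar> + 2 * a * \<alpha> * \<bar>seq (nbr_diff \<psi>) k\<bar>) summable_on UNIV"
    by (intro summable_on_add summable_on_cmult_right summable_seq)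
  fix k
  show "\<bar>fast_part (seq s) (seq \<psi>) k\<bar> \<le> (\<eta>0 + 4 * \<alpha>) * \<bar>seq s k\<bar> + \<alpha> * \<bar>seq (nbr_sum s) k\<bar> + 2 * a * \<alpha> * \<bar>seq (nbr_diff \<psi>) k\<bar>"
    using fast_part_diff[of "seq s" "seq \<psi>" k "\<lambda>_. 0" "\<lambda>_. 0"]
    by (simp add: fast_part_zero rel_nbr_diff_def seq_nbr_diff seq_nbr_sum sum_nonneg)
qed

lemma seq_g: "seq (g s \<psi>) = slow_part (seq s) (seq \<psi>)"
  unfolding g_def
proof (rule seq_L1, rule summable_abs_le)
  show "(\<lambda>k. \<alpha> * ((24 / a + Lw) * \<bar>seq s k\<bar> + 2 / a * \<bar>seq (nbr_sum s) k\<bar> + 3 * \<bar>seq (nbr_diff \<psi>) k\<bar>)) summable_on UNIV"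
    by (intro summable_on_add summable_on_cmult_right summable_seq)
  fix k
  show "\<bar>slow_part (seq s) (seq \<psi>) k\<bar> \<le> \<alpha> * ((24 / a + Lw) * \<bar>seq s k\<bar> + 2 / a * \<bar>seq (nbr_sum s) k\<bar> + 3 * \<bar>seq (nbr_diff \<psi>) k\<bar>)"
    using slow_part_diff[of "seq s" "seq \<psi>" k "\<lambda>_. 0" "\<lambda>_. 0"]
    by (simp add: slow_part_zero rel_nbr_diff_def seq_nbr_diff seq_nbr_sum sum_nonneg)
qed

definition drift_bound :: real where "drift_bound = 16 * (56 / a + Lw) + 768"

lemma N_seminorm:
  assumes "admissible S P"
  shows "S (N s \<psi> - N s' \<psi>') \<le> (\<eta>0 + 20 * \<alpha>) * S (s - s') + 32 * a * \<alpha> * P (\<psi> - \<psi>')"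
proof -
  have "S (N s \<psi> - N s' \<psi>') \<le> ((\<eta>0 + 4 * \<alpha>) + 16 * \<alpha>) * S (s - s') + 16 * (2 * a * \<alpha>) * P (\<psi> - \<psi>')"
  proof (rule admissible_dominated[OF assms])
    fix k
    show "\<bar>seq (N s \<psi> - N s' \<psi>') k\<bar> \<le> (\<eta>0 + 4 * \<alpha>) * \<bar>seq (s - s') k\<bar> + \<alpha> * seq (nbr_sum (s - s')) k
        + 2 * a * \<alpha> * seq (nbr_diff (\<psi> - \<psi>')) k"
      using fast_part_diff[of "seq s" "seq \<psi>" k "seq s'" "seq \<psi>'"]
      by (simp add: seq_N rel_nbr_diff_seq nbr_sum_diff_seq del: seq_minus) (simp add: seq_minus seq_N)
  qed (use \<eta>0 \<alpha> a in auto)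
  then show ?thesis by (simp add: algebra_simps)
qed

lemma g_seminorm:
  assumes "admissible S P"
  shows "S (g s \<psi> - g s' \<psi>') \<le> \<alpha> * ((56 / a + Lw) * S (s - s') + 48 * P (\<psi> - \<psi>'))"
proof -
  have "S (g s \<psi> - g s' \<psi>') \<le> (\<alpha> * (24 / a + Lw) + 16 * (\<alpha> * (2 / a))) * S (s - s') + 16 * (\<alpha> * 3) * P (\<psi> - \<psi>')"
  proof (rule admissible_dominated[OF assms])
    fix k
    show "\<bar>seq (g s \<psi> - g s' \<psi>') k\<bar> \<le> \<alpha> * (24 / a + Lw) * \<bar>seq (s - s') k\<bar> + \<alpha> * (2 / a) * seq (nbr_sum (s - s')) k
        + \<alpha> * 3 * seq (nbr_diff (\<psi> - \<psi>')) k"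
      using slow_part_diff[of "seq s" "seq \<psi>" k "seq s'" "seq \<psi>'"]
      unfolding seq_minus[of "g s \<psi>"] seq_g rel_nbr_diff_seq nbr_sum_diff_seq by (simp add: algebra_simps)
  qed (use Lw \<alpha> a in auto)
  also have "\<dots> = \<alpha> * ((56 / a + Lw) * S (s - s') + 48 * P (\<psi> - \<psi>'))"
    by (simp add: algebra_simps add_divide_distrib[symmetric])
  finally show ?thesis .
qed

lemma g_gradient_seminorm:
  assumes "admissible S P"
  shows "P (g s \<psi> - g s' \<psi>') \<le> \<alpha> * drift_bound * (S (s - s') + P (\<psi> - \<psi>'))"
proof -
  have pos: "S (s - s') \<ge> 0" "P (\<psi> - \<psi>') \<ge> 0"
    using assms bounded_seminormD(3)[of S] bounded_seminormD(3)[of P] by (auto simp: admissible_def)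
  have "P (g s \<psi> - g s' \<psi>') \<le> 16 * S (g s \<psi> - g s' \<psi>')" using assms by (simp add: admissible_def)
  also have "\<dots> \<le> 16 * (\<alpha> * ((56 / a + Lw) * S (s - s') + 48 * P (\<psi> - \<psi>')))"
    by (intro mult_left_mono g_seminorm assms) auto
  also have "\<dots> = \<alpha> * ((16 * (56 / a + Lw)) * S (s - s') + 768 * P (\<psi> - \<psi>'))" by (simp add: algebra_simps)
  also have "\<dots> \<le> \<alpha> * (drift_bound * S (s - s') + drift_bound * P (\<psi> - \<psi>'))"
    using pos \<alpha> a Lw by (intro mult_left_mono add_mono mult_right_mono) (auto simp: drift_bound_def)
  finally show ?thesis by (simp add: algebra_simps)
qed

lemma admissible_norm: "admissible norm (\<lambda>x. Q 1 (seq x))"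
  using admissible_lnorm[of 1] by (simp add: lnorm_1)

lemma Q1_le: "Q 1 (seq x) \<le> 16 * norm x"
  using admissible_norm by (simp add: admissible_def)

lemma N_norm: "norm (N s \<psi> - N s' \<psi>') \<le> (\<eta>0 + 20 * \<alpha>) * norm (s - s') + (\<alpha> * (512 * a + drift_bound)) * norm (\<psi> - \<psi>')"
proof -
  have drift_bound: "drift_bound \<ge> 0" using a Lw by (simp add: drift_bound_def)
  have "norm (N s \<psi> - N s' \<psi>') \<le> (\<eta>0 + 20 * \<alpha>) * norm (s - s') + 32 * a * \<alpha> * Q 1 (seq (\<psi> - \<psi>'))"
    by (rule N_seminorm[OF admissible_norm])
  also have "32 * a * \<alpha> * Q 1 (seq (\<psi> - \<psi>')) \<le> 32 * a * \<alpha> * (16 * norm (\<psi> - \<psi>'))"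
    using a \<alpha> by (intro mult_left_mono Q1_le) auto
  also have "\<dots> = \<alpha> * (512 * a) * norm (\<psi> - \<psi>')" by simp
  also have "\<dots> \<le> \<alpha> * (512 * a + drift_bound) * norm (\<psi> - \<psi>')"
    using \<alpha> drift_bound by (intro mult_right_mono mult_left_mono) auto
  finally show ?thesis by simp
qed

lemma g_norm: "norm (g s \<psi> - g s' \<psi>') \<le> (\<alpha> * (512 * a + drift_bound)) * (norm (s - s') + norm (\<psi> - \<psi>'))"
proof -
  have "norm (g s \<psi> - g s' \<psi>') \<le> \<alpha> * ((56 / a + Lw) * norm (s - s') + 48 * Q 1 (seq (\<psi> - \<psi>')))"
    by (rule g_seminorm[OF admissible_norm])
  also have "\<dots> \<le> \<alpha> * ((56 / a + Lw) * norm (s - s') + 48 * (16 * norm (\<psi> - \<psi>')))"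
    using \<alpha> by (intro mult_left_mono add_left_mono Q1_le) auto
  also have "\<dots> \<le> \<alpha> * ((512 * a + drift_bound) * norm (s - s') + (512 * a + drift_bound) * norm (\<psi> - \<psi>'))"
  proof (intro mult_left_mono add_mono \<alpha>)
    have "0 \<le> 56 / a" using a by simp
    then have "56 / a + Lw \<le> 512 * a + drift_bound" unfolding drift_bound_def distrib_left using a Lw by linarith
    then show "(56 / a + Lw) * norm (s - s') \<le> (512 * a + drift_bound) * norm (s - s')" by (rule mult_right_mono) simp
    have "768 \<le> 512 * a + drift_bound" using a Lw by (simp add: drift_bound_def)
    then show "48 * (16 * norm (\<psi> - \<psi>')) \<le> (512 * a + drift_bound) * norm (\<psi> - \<psi>')"
      using mult_right_mono[of 768 "512 * a + drift_bound" "norm (\<psi> - \<psi>')"] by simp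
  qed
  finally show ?thesis by (simp add: algebra_simps)
qed

lemma N_zero: "N 0 0 = 0" and g_zero: "g 0 0 = 0"
  by (rule l1_eqI, simp add: seq_N seq_g fast_part_zero slow_part_zero)+

end

text \<open>Apart from \<open>\<eta>0\<close>, all the quantities that \<open>fast_slow\<close> and \<open>ancient_cone\<close> require to be small
  compared with \<open>\<mu>\<close> are \<open>O(\<surd>\<alpha>)\<close>; the assumption \<open>small\<close> covers them together.\<close>

locale weakly_coupled = oscillators +
  assumes \<eta>0_le: "\<eta>0 \<le> \<mu> / 32" and \<alpha>_le: "\<alpha> \<le> 1" and sqrt_le: "sqrt \<alpha> \<le> \<rho> / 2"
    and small: "sqrt \<alpha> * (80 + 12 * (512 * a + drift_bound)) \<le> \<mu> / 8"
begin

lemma drift_bound_nonneg: "drift_bound \<ge> 0" using a Lw by (simp add: drift_bound_def)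

lemma \<alpha>_le_sqrt: "\<alpha> \<le> sqrt \<alpha>"
  using \<alpha> \<alpha>_le by (simp add: real_le_rsqrt power2_eq_square mult_left_le)

sublocale fast_slow N g \<mu> "\<eta>0 + 20 * \<alpha>" "\<alpha> * (512 * a + drift_bound)"
proof
  have "\<alpha> * (80 + 12 * (512 * a + drift_bound)) \<le> sqrt \<alpha> * (80 + 12 * (512 * a + drift_bound))"
    using a drift_bound_nonneg by (intro mult_right_mono \<alpha>_le_sqrt) auto
  then show "4 * (\<eta>0 + 20 * \<alpha>) + 12 * (\<alpha> * (512 * a + drift_bound)) \<le> \<mu>"
    using small \<eta>0_le \<mu>_pos by (simp add: algebra_simps)
qed (use \<mu>_pos \<eta>0 \<alpha> a drift_bound_nonneg N_norm g_norm in auto)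

lemma smallness: "(\<eta>0 + 20 * \<alpha>) + sqrt \<alpha> * (\<alpha> * drift_bound) + \<alpha> * drift_bound + 32 * a * sqrt \<alpha> \<le> \<mu> / 4"
proof -
  have "sqrt \<alpha> * (\<alpha> * drift_bound) \<le> sqrt \<alpha> * (1 * drift_bound)"
    using \<alpha> \<alpha>_le drift_bound_nonneg by (intro mult_left_mono mult_right_mono) auto
  moreover have "\<alpha> * drift_bound \<le> sqrt \<alpha> * drift_bound" "20 * \<alpha> \<le> 20 * sqrt \<alpha>"
    using drift_bound_nonneg \<alpha>_le_sqrt by (auto intro: mult_right_mono)
  moreover have "sqrt \<alpha> * (20 + 2 * drift_bound + 32 * a) \<le> sqrt \<alpha> * (80 + 12 * (512 * a + drift_bound))"
    using \<alpha> a drift_bound_nonneg by (intro mult_left_mono) auto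
  ultimately show ?thesis using small \<eta>0_le \<mu>_pos by (simp add: algebra_simps)
qed

text \<open>The phases act on the amplitudes with strength \<open>32 a \<alpha> = \<surd>\<alpha> (32 a \<surd>\<alpha>)\<close>. One factor
  \<open>\<surd>\<alpha>\<close> becomes the Lipschitz constant and the other one provides the smallness that the cone
  lemma requires.\<close>

lemma slaved_Q_lipschitz:
  assumes p: "p \<ge> 1"
  shows "lnorm p (seq (slaved \<xi> - slaved \<xi>')) \<le> sqrt \<alpha> * Q p (seq (\<xi> - \<xi>'))"
proof (rule slaved_lipschitz[where S = "\<lambda>x. lnorm p (seq x)" and P = "\<lambda>x. Q p (seq x)" and \<kappa> = "sqrt \<alpha>"
      and c = "32 * a * sqrt \<alpha>" and d = "\<alpha> * drift_bound"])
  note adm = admissible_lnorm[OF p]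
  show "bounded_seminorm (\<lambda>x. lnorm p (seq (x :: site l1)))" "bounded_seminorm (\<lambda>x. Q p (seq x))"
    using adm by (auto simp: admissible_def)
  show "\<eta>0 + 20 * \<alpha> + sqrt \<alpha> * (\<alpha> * drift_bound) + \<alpha> * drift_bound + 32 * a * sqrt \<alpha> \<le> \<mu> / 4" by (rule smallness)
  show "lnorm p (seq (N s y - N s' y')) \<le> (\<eta>0 + 20 * \<alpha>) * lnorm p (seq (s - s'))
      + sqrt \<alpha> * (32 * a * sqrt \<alpha>) * Q p (seq (y - y'))" for s y s' y'
  proof -
    have "sqrt \<alpha> * (32 * a * sqrt \<alpha>) = 32 * a * \<alpha>" using \<alpha> by simp
    then show ?thesis using N_seminorm[OF adm, of s y s' y'] by (simp only:)
  qed
  show "Q p (seq (g s y - g s' y')) \<le> \<alpha> * drift_bound * (lnorm p (seq (s - s')) + Q p (seq (y - y')))" for s y s' y'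
    by (rule g_gradient_seminorm[OF adm])
qed (use a \<alpha> drift_bound_nonneg in auto)

lemma slaved_sup_bound: "lnorm \<infinity> (seq (slaved \<xi>)) \<le> sqrt \<alpha>"
proof (rule slaved_bounded[where S = "\<lambda>x. lnorm \<infinity> (seq x)" and \<kappa> = "sqrt \<alpha>" and c = "12 * a * sqrt \<alpha>"])
  note adm = admissible_infinity
  show bS: "bounded_seminorm (\<lambda>x. lnorm \<infinity> (seq (x :: site l1)))"
    using adm by (auto simp: admissible_def)
  have "0 \<le> sqrt \<alpha> * (\<alpha> * drift_bound)" "0 \<le> \<alpha> * drift_bound" "0 \<le> a * sqrt \<alpha>" using \<alpha> a drift_bound_nonneg by auto
  then show "\<eta>0 + 20 * \<alpha> + 12 * a * sqrt \<alpha> \<le> \<mu> / 4" using smallness by linarith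
  show "lnorm \<infinity> (seq (N s y)) \<le> (\<eta>0 + 20 * \<alpha>) * lnorm \<infinity> (seq s) + sqrt \<alpha> * (12 * a * sqrt \<alpha>)" for s y
  proof -
    have "lnorm \<infinity> (seq (N s y)) \<le> lnorm \<infinity> (seq (N s y - N 0 y)) + lnorm \<infinity> (seq (N 0 y))"
      using bounded_seminormD(1)[OF bS, of "N s y - N 0 y" "N 0 y"] by simp
    also have "lnorm \<infinity> (seq (N s y - N 0 y)) \<le> (\<eta>0 + 20 * \<alpha>) * lnorm \<infinity> (seq s)"
      using N_seminorm[OF adm, of s y 0 y] bounded_seminormD(5)[of "\<lambda>x. Q \<infinity> (seq x)"] adm
      by (simp add: admissible_def)
    also have "lnorm \<infinity> (seq (N 0 y)) \<le> 12 * a * \<alpha>"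
      by (rule lnorm_infinity_leI) (simp add: seq_N fast_part_bounded)
    also have "12 * a * \<alpha> = sqrt \<alpha> * (12 * a * sqrt \<alpha>)" using \<alpha> by simp
    finally show ?thesis by simp
  qed
qed (use a \<alpha> N_zero g_zero in auto)

end

section \<open>Solutions in sequence form\<close>

lemma ell_1_iff: "x \<in> ell 1 \<longleftrightarrow> (\<lambda>k. \<bar>x k\<bar>) summable_on UNIV"
  by (simp add: ell_def)

lemma seq_in_ell_1 [simp]: "seq x \<in> ell 1"
  by (simp add: ell_1_iff)

lemma seq_L1_ell [simp]: "x \<in> ell 1 \<Longrightarrow> seq (L1 x) = x"
  by (simp add: ell_1_iff seq_L1)

lemma L1_seq [simp]: "L1 (seq x) = x"
  by (rule seq_inverse)

lemma lnorm_1_diff: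
  assumes "x \<in> ell 1" "y \<in> ell 1"
  shows "lnorm 1 (\<lambda>k. x k - y k) = norm (L1 x - L1 y)"
  using lnorm_1[of "L1 x - L1 y"] assms by simp

text \<open>Both sides say that the difference quotients converge in norm.\<close>

lemma has_l1_derivative_iff:
  assumes x: "\<And>\<tau>. \<tau> \<in> J \<Longrightarrow> x \<tau> \<in> ell 1" and t: "t \<in> J" and d: "d \<in> ell 1"
  shows "has_l1_derivative x d t J \<longleftrightarrow> ((\<lambda>\<tau>. L1 (x \<tau>)) has_vector_derivative L1 d) (at t within J)"
proof -
  define X where "X = (\<lambda>\<tau>. L1 (x \<tau>))"
  have eq: "lnorm 1 (\<lambda>k. (x \<tau> k - x t k) / (\<tau> - t) - d k)
      = norm ((1 / norm (\<tau> - t)) *\<^sub>R (X \<tau> - (X t + (\<tau> - t) *\<^sub>R L1 d)))" if "\<tau> \<in> J" "\<tau> \<noteq> t" for \<tau>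
  proof -
    have "lnorm 1 (\<lambda>k. (x \<tau> k - x t k) / (\<tau> - t) - d k) = norm ((1 / (\<tau> - t)) *\<^sub>R (X \<tau> - X t) - L1 d)"
      using lnorm_1[of "(1 / (\<tau> - t)) *\<^sub>R (X \<tau> - X t) - L1 d"] x[OF that(1)] x[OF t] d by (simp add: X_def)
    also have "(1 / (\<tau> - t)) *\<^sub>R (X \<tau> - X t) - L1 d = (1 / (\<tau> - t)) *\<^sub>R (X \<tau> - (X t + (\<tau> - t) *\<^sub>R L1 d))"
      using that(2) by (simp add: scaleR_diff_right scaleR_add_right)
    also have "norm \<dots> = norm ((1 / norm (\<tau> - t)) *\<^sub>R (X \<tau> - (X t + (\<tau> - t) *\<^sub>R L1 d)))" by simp
    finally show ?thesis .
  qed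
  have ev: "\<forall>\<^sub>F \<tau> in at t within J. lnorm 1 (\<lambda>k. (x \<tau> k - x t k) / (\<tau> - t) - d k)
      = norm ((1 / norm (\<tau> - t)) *\<^sub>R (X \<tau> - (X t + (\<tau> - t) *\<^sub>R L1 d)))"
    unfolding eventually_at_filter by (rule eventuallyI) (use eq in blast)
  have "has_l1_derivative x d t J \<longleftrightarrow>
     ((\<lambda>\<tau>. (1 / norm (\<tau> - t)) *\<^sub>R (X \<tau> - (X t + (\<tau> - t) *\<^sub>R L1 d))) \<longlongrightarrow> 0) (at t within J)"
    unfolding has_l1_derivative_def tendsto_cong[OF ev] tendsto_norm_zero_iff using d by blast
  also have "\<dots> \<longleftrightarrow> (X has_vector_derivative L1 d) (at t within J)"
    unfolding has_vector_derivative_def has_derivative_within by (simp add: bounded_linear_scaleR_left)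
  finally show ?thesis by (simp add: X_def)
qed

context weakly_coupled
begin

definition \<sigma> :: "lattice_seq \<Rightarrow> lattice_seq" where
  "\<sigma> \<psi> = seq (slaved (L1 \<psi>))"

abbreviation sol :: "real set \<Rightarrow> (real \<Rightarrow> lattice_seq) \<Rightarrow> (real \<Rightarrow> lattice_seq) \<Rightarrow> bool" where
  "sol \<equiv> solution lam om1 rb tb \<alpha>"

lemma unclipped:
  assumes "\<And>k. \<bar>seq s k\<bar> \<le> \<rho>"
  shows "F lam rb tb (seq s) (seq \<psi>) \<alpha> = seq (- \<mu> *\<^sub>R s + N s \<psi>)"
    and "(\<lambda>k. \<alpha> * G om1 rb tb (seq s) (seq \<psi>) \<alpha> k) = seq (g s \<psi>)"
    and "rb \<alpha> k + seq s k > 0"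
proof -
  have c: "(\<lambda>j. clip \<rho> (seq s j)) = seq s" using assms by (simp add: clip_id fun_eq_iff)
  show "F lam rb tb (seq s) (seq \<psi>) \<alpha> = seq (- \<mu> *\<^sub>R s + N s \<psi>)"
    using assms by (simp add: seq_N fast_part_def c clip_id fun_eq_iff)
  show "(\<lambda>k. \<alpha> * G om1 rb tb (seq s) (seq \<psi>) \<alpha> k) = seq (g s \<psi>)"
    by (simp add: seq_g slow_part_def c)
  show "rb \<alpha> k + seq s k > 0"
    using rad(2)[of "seq s" k] a assms[of k] by (simp add: rad_def clip_id)
qed

lemma solution_of_trajectory:
  assumes tr: "trajectory J s y" and small: "\<And>t k. t \<in> J \<Longrightarrow> \<bar>seq (s t) k\<bar> \<le> \<rho>"
  shows "sol J (\<lambda>t. seq (s t)) (\<lambda>t. seq (y t))"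
  unfolding solution_def
proof (intro ballI conjI allI)
  fix t assume t: "t \<in> J"
  note u = unclipped[OF small[OF t]]
  show "seq (s t) \<in> ell 1" "seq (y t) \<in> ell 1" by simp_all
  show "0 < rb \<alpha> k + seq (s t) k" for k by (rule u)
  show "has_l1_derivative (\<lambda>t. seq (s t)) (F lam rb tb (seq (s t)) (seq (y t)) \<alpha>) t J"
    using tr t by (simp only: u has_l1_derivative_iff[OF _ t] seq_in_ell_1 L1_seq) (simp add: trajectory_def)
  show "has_l1_derivative (\<lambda>t. seq (y t)) (\<lambda>k. \<alpha> * G om1 rb tb (seq (s t)) (seq (y t)) \<alpha> k) t J"
    using tr t by (simp only: u has_l1_derivative_iff[OF _ t] seq_in_ell_1 L1_seq) (simp add: trajectory_def)
qed

text \<open>A solution of the original system may a priori leave the region where clipping has no effect.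
  The open set \<open>U\<close> is that region.\<close>

lemma solution_unique:
  assumes J: "is_interval J" "t0 \<in> J" and sl: "sol J s \<psi>" and tr: "trajectory J s' y'"
    and small: "\<And>t. t \<in> J \<Longrightarrow> lnorm \<infinity> (seq (s' t)) < \<rho>"
    and init: "L1 (s t0) = s' t0" "L1 (\<psi> t0) = y' t0" and t: "t \<in> J"
  shows "s t = seq (s' t)" "\<psi> t = seq (y' t)"
proof -
  have ell: "\<And>t. t \<in> J \<Longrightarrow> s t \<in> ell 1" "\<And>t. t \<in> J \<Longrightarrow> \<psi> t \<in> ell 1"
    using sl by (auto simp: solution_def)
  define x where "x = (\<lambda>t. (L1 (s t), L1 (\<psi> t)))"
  define U where "U = {p :: site l1 \<times> site l1. lnorm \<infinity> (seq (fst p)) < \<rho>}"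
  have "bounded_seminorm (\<lambda>x. lnorm \<infinity> (seq (x :: site l1)))"
    using admissible_infinity by (simp add: admissible_def)
  then have "open U" unfolding U_def
    by (intro open_Collect_less continuous_on_const continuous_on_compose2[OF bounded_seminorm_continuous[of _ UNIV] continuous_on_fst[OF continuous_on_id]]) auto
  have dx: "(x has_vector_derivative (L1 (F lam rb tb (s t) (\<psi> t) \<alpha>), L1 (\<lambda>k. \<alpha> * G om1 rb tb (s t) (\<psi> t) \<alpha> k)))
      (at t within J)" if "t \<in> J" for t
  proof -
    have 1: "has_l1_derivative s (F lam rb tb (s t) (\<psi> t) \<alpha>) t J"
      and 2: "has_l1_derivative \<psi> (\<lambda>k. \<alpha> * G om1 rb tb (s t) (\<psi> t) \<alpha> k) t J"
      using sl that by (auto simp: solution_def)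
    have e: "F lam rb tb (s t) (\<psi> t) \<alpha> \<in> ell 1" "(\<lambda>k. \<alpha> * G om1 rb tb (s t) (\<psi> t) \<alpha> k) \<in> ell 1"
      using 1 2 by (auto simp: has_l1_derivative_def)
    show ?thesis unfolding x_def
      using 1 2 has_l1_derivative_iff[where x = s, OF ell(1) that e(1)] has_l1_derivative_iff[where x = \<psi>, OF ell(2) that e(2)]
      by (intro has_vector_derivative_Pair) auto
  qed
  have "x t = (s' t, y' t)"
  proof (rule ode_unique_in_open[where H = vfield and x = x and y = "\<lambda>t. (s' t, y' t)" and U = U,
        OF vfield_lip J \<open>open U\<close>])
    show "continuous_on J x" by (rule continuous_on_vector_derivative[OF dx])
    fix r assume r: "r \<in> J"
    show "(s' r, y' r) \<in> U" using small[OF r] by (simp add: U_def)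
    show "((\<lambda>t. (s' t, y' t)) has_vector_derivative vfield (s' r, y' r)) (at r within J)"
      using tr r unfolding trajectory_iff_vfield by blast
    assume "x r \<in> U"
    then have "\<bar>seq (L1 (s r)) k\<bar> \<le> \<rho>" for k
      using abs_seq_le_lnorm_infinity[of "L1 (s r)" k] by (simp add: U_def x_def)
    note u = unclipped(1,2)[OF this, of "L1 (\<psi> r)"]
    have "vfield (x r) = (L1 (F lam rb tb (s r) (\<psi> r) \<alpha>), L1 (\<lambda>k. \<alpha> * G om1 rb tb (s r) (\<psi> r) \<alpha> k))"
      using u ell[OF r] by (simp add: x_def vfield_def del: seq_plus seq_scaleR seq_minus seq_uminus)
    then show "(x has_vector_derivative vfield (x r)) (at r within J)" using dx[OF r] by simp
  qed (use init t in \<open>auto simp: x_def\<close>)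
  then show "s t = seq (s' t)" "\<psi> t = seq (y' t)"
    using ell[OF t] by (auto simp: x_def dest: arg_cong[where f = seq])
qed

lemma sqrt_less_\<rho>: "sqrt \<alpha> < \<rho>"
  using sqrt_le \<rho> by simp

lemma slaved_abs_le: "\<bar>seq (slaved \<xi>) k\<bar> \<le> sqrt \<alpha>"
  using abs_seq_le_lnorm_infinity[of "slaved \<xi>" k] slaved_sup_bound[of \<xi>] by linarith

lemma \<sigma>_in_ell: "\<sigma> \<psi> \<in> ell 1"
  by (simp add: \<sigma>_def)

lemma \<sigma>_zero: "\<sigma> (\<lambda>_. 0) = (\<lambda>_. 0)"
  using slaved_zero[OF N_zero g_zero] by (simp add: \<sigma>_def zero_l1_def[symmetric])

lemma \<sigma>_sup: "lnorm \<infinity> (\<sigma> \<psi>) \<le> sqrt \<alpha>"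
  by (simp add: \<sigma>_def slaved_sup_bound)

lemma \<sigma>_lipschitz:
  assumes "p \<ge> 1" "\<psi> \<in> ell 1" "\<phi> \<in> ell 1"
  shows "lnorm p (\<lambda>k. \<sigma> \<psi> k - \<sigma> \<phi> k) \<le> sqrt \<alpha> * Q p (\<lambda>k. \<psi> k - \<phi> k)"
  using slaved_Q_lipschitz[OF assms(1), of "L1 \<psi>" "L1 \<phi>"] assms(2,3) by (simp add: \<sigma>_def)

lemma \<sigma>_graph_lipschitz: "lipschitz_graph {(s, \<psi>). s = \<sigma> \<psi> \<and> \<psi> \<in> ell 1}"
  unfolding lipschitz_graph_def
proof (intro exI[of _ \<sigma>] exI[of _ 1] conjI ballI)
  fix \<psi> \<phi> assume "\<psi> \<in> ell 1" "\<phi> \<in> ell 1"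
  then show "lnorm 1 (\<lambda>k. \<sigma> \<psi> k - \<sigma> \<phi> k) \<le> 1 * lnorm 1 (\<lambda>k. \<psi> k - \<phi> k)"
    using slaved_norm_lipschitz[of "L1 \<psi>" "L1 \<phi>"] by (simp add: lnorm_1_diff \<sigma>_in_ell) (simp add: \<sigma>_def)
qed (auto simp: \<sigma>_in_ell)

lemma \<sigma>_graph_orbit:
  assumes "\<psi>0 \<in> ell 1"
  obtains s y where "trajectory UNIV s y" "y 0 = L1 \<psi>0" "\<And>t. s t = slaved (y t)"
    "\<And>t. lnorm \<infinity> (seq (s t)) < \<rho>"
proof -
  obtain s y where 1: "ancient s y" "y 0 = L1 \<psi>0" "\<And>t. s t = slaved (y t)"
    using ancient_on_graph[of "L1 \<psi>0"] by blast
  show ?thesis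
  proof (rule that)
    show "trajectory UNIV s y" using 1(1) by (simp add: ancient_def)
    show "lnorm \<infinity> (seq (s t)) < \<rho>" for t
      using slaved_sup_bound[of "y t"] sqrt_less_\<rho> by (simp add: 1(3))
  qed (rule 1)+
qed

lemma trajectory_subset: "trajectory J s y \<Longrightarrow> I \<subseteq> J \<Longrightarrow> trajectory I s y"
  unfolding trajectory_def by (blast intro: has_vector_derivative_within_subset)

theorem \<sigma>_invariant: "invariant_manifold sol {(s, \<psi>). s = \<sigma> \<psi> \<and> \<psi> \<in> ell 1}"
  unfolding invariant_manifold_def
proof (intro conjI)
  show "lipschitz_graph {(s, \<psi>). s = \<sigma> \<psi> \<and> \<psi> \<in> ell 1}" by (rule \<sigma>_graph_lipschitz)
  show "\<forall>(s0, \<psi>0)\<in>{(s, \<psi>). s = \<sigma> \<psi> \<and> \<psi> \<in> ell 1}.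
      \<exists>s \<psi>. sol UNIV s \<psi> \<and> s 0 = s0 \<and> \<psi> 0 = \<psi>0 \<and> (\<forall>t. (s t, \<psi> t) \<in> {(s, \<psi>). s = \<sigma> \<psi> \<and> \<psi> \<in> ell 1})"
  proof (clarify)
    fix \<psi>0 :: lattice_seq assume \<psi>0: "\<psi>0 \<in> ell 1"
    from \<sigma>_graph_orbit[OF this] obtain s y where o: "trajectory UNIV s y" "y 0 = L1 \<psi>0" "\<And>t. s t = slaved (y t)"
      "\<And>t. lnorm \<infinity> (seq (s t)) < \<rho>" by metis
    have "sol UNIV (\<lambda>t. seq (s t)) (\<lambda>t. seq (y t))"
    proof (rule solution_of_trajectory[OF o(1)])
      show "\<bar>seq (s t) k\<bar> \<le> \<rho>" for t k using abs_seq_le_lnorm_infinity[of "s t" k] o(4)[of t] by linarith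
    qed
    then show "\<exists>s \<psi>. sol UNIV s \<psi> \<and> s 0 = \<sigma> \<psi>0 \<and> \<psi> 0 = \<psi>0 \<and> (\<forall>t. (s t, \<psi> t) \<in> {(s, \<psi>). s = \<sigma> \<psi> \<and> \<psi> \<in> ell 1})"
      by (intro exI[of _ "\<lambda>t. seq (s t)"] exI[of _ "\<lambda>t. seq (y t)"]) (use \<psi>0 in \<open>simp add: o(2,3) \<sigma>_def\<close>)
  qed
  show "\<forall>J s \<psi>. is_interval J \<and> 0 \<in> J \<and> sol J s \<psi> \<and> (s 0, \<psi> 0) \<in> {(s, \<psi>). s = \<sigma> \<psi> \<and> \<psi> \<in> ell 1} \<longrightarrow>
      (\<forall>t\<in>J. (s t, \<psi> t) \<in> {(s, \<psi>). s = \<sigma> \<psi> \<and> \<psi> \<in> ell 1})"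
  proof (intro allI impI ballI)
    fix J s \<psi> t
    assume A: "is_interval J \<and> 0 \<in> J \<and> sol J s \<psi> \<and> (s 0, \<psi> 0) \<in> {(s, \<psi>). s = \<sigma> \<psi> \<and> \<psi> \<in> ell 1}" and t: "t \<in> J"
    then have \<psi>0: "\<psi> 0 \<in> ell 1" and s0: "s 0 = \<sigma> (\<psi> 0)" by auto
    from \<sigma>_graph_orbit[OF \<psi>0] obtain s' y' where o: "trajectory UNIV s' y'" "y' 0 = L1 (\<psi> 0)" "\<And>t. s' t = slaved (y' t)"
      "\<And>t. lnorm \<infinity> (seq (s' t)) < \<rho>" by metis
    have J: "is_interval J" "0 \<in> J" "sol J s \<psi>" using A by auto
    have "L1 (s 0) = s' 0" by (simp add: s0 \<sigma>_def o)
    from solution_unique[OF J trajectory_subset[OF o(1)] o(4) this o(2)[symmetric] t]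
    have "s t = seq (s' t)" "\<psi> t = seq (y' t)" by simp_all
    then show "(s t, \<psi> t) \<in> {(s, \<psi>). s = \<sigma> \<psi> \<and> \<psi> \<in> ell 1}" by (simp add: \<sigma>_def o(3))
  qed
qed

text \<open>The clipped system has a global solution with the given initial value. It decays towards the
  manifold, so its amplitudes stay below \<open>\<surd>\<alpha> + \<delta> < \<rho>\<close>. Hence it solves the original system, and it
  extends the given solution by uniqueness.\<close>

theorem \<sigma>_attracted:
  assumes \<delta>: "0 < \<delta>" "\<delta> \<le> \<rho> / 4"
  shows "attracted sol \<sigma> \<delta> (\<mu> / 2)"
  unfolding attracted_def
proof (intro allI impI)
  fix J s \<psi>
  assume A: "is_interval J \<and> 0 \<in> J \<and> J \<subseteq> {0..} \<and> sol J s \<psi> \<and> lnorm 1 (\<lambda>k. s 0 k - \<sigma> (\<psi> 0) k) \<le> \<delta>"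
  then have ell: "s 0 \<in> ell 1" "\<psi> 0 \<in> ell 1" by (auto simp: solution_def)
  obtain s' y' where tr: "trajectory UNIV s' y'" "s' 0 = L1 (s 0)" "y' 0 = L1 (\<psi> 0)"
    by (rule trajectory_exists)
  have "norm (L1 (s 0) - slaved (L1 (\<psi> 0))) \<le> \<delta>"
    using A ell by (simp add: lnorm_1_diff \<sigma>_in_ell) (simp add: \<sigma>_def)
  then have init: "norm (s' 0 - slaved (y' 0)) \<le> \<delta>" by (simp add: tr)
  have decay: "norm (s' t - slaved (y' t)) \<le> exp (- (\<mu> / 2) * t) * \<delta>" if "t \<ge> 0" for t
  proof -
    have "norm (s' t - slaved (y' t)) \<le> exp (- (\<mu> / 2) * t) * norm (s' 0 - slaved (y' 0))"
      by (rule slaved_attracts[OF trajectory_subset[OF tr(1)] that]) simp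
    also have "\<dots> \<le> exp (- (\<mu> / 2) * t) * \<delta>" using init by (intro mult_left_mono) auto
    finally show ?thesis .
  qed
  have small: "\<bar>seq (s' t) k\<bar> \<le> 3 / 4 * \<rho>" if "t \<ge> 0" for t k
  proof -
    have "exp (- (\<mu> / 2) * t) * \<delta> \<le> 1 * \<delta>" using that \<mu>_pos \<delta> by (intro mult_right_mono) auto
    then have "\<bar>seq (s' t - slaved (y' t)) k\<bar> \<le> \<delta>"
      using abs_seq_le_norm[of "s' t - slaved (y' t)" k] decay[OF that] by linarith
    then show ?thesis using slaved_abs_le[of "y' t" k] sqrt_le \<delta> by simp
  qed
  have sol': "sol {0..} (\<lambda>t. seq (s' t)) (\<lambda>t. seq (y' t))"
  proof (rule solution_of_trajectory[OF trajectory_subset[OF tr(1)]])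
    show "\<bar>seq (s' t) k\<bar> \<le> \<rho>" if "t \<in> {0..}" for t k using small[of t k] that \<rho> by simp
  qed simp
  have sup: "lnorm \<infinity> (seq (s' t)) < \<rho>" if "t \<in> J" for t
  proof -
    have "lnorm \<infinity> (seq (s' t)) \<le> 3 / 4 * \<rho>" by (rule lnorm_infinity_leI) (use small that A in auto)
    then show ?thesis using \<rho> by simp
  qed
  have J: "is_interval J" "0 \<in> J" "sol J s \<psi>" using A by auto
  have "s t = seq (s' t) \<and> \<psi> t = seq (y' t)" if "t \<in> J" for t
    using solution_unique[OF J trajectory_subset[OF tr(1)] sup tr(2,3)[symmetric] that] by simp
  moreover have "lnorm 1 (\<lambda>k. seq (s' t) k - \<sigma> (seq (y' t)) k) \<le> 2 * \<delta> * exp (- (\<mu> / 2) * t)" if "t \<ge> 0" for t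
  proof -
    have "lnorm 1 (\<lambda>k. seq (s' t) k - \<sigma> (seq (y' t)) k) = norm (s' t - slaved (y' t))"
      by (simp add: lnorm_1_diff \<sigma>_in_ell) (simp add: \<sigma>_def)
    also have "\<dots> \<le> exp (- (\<mu> / 2) * t) * \<delta>" by (rule decay[OF that])
    also have "\<dots> \<le> 2 * \<delta> * exp (- (\<mu> / 2) * t)" using \<delta> by simp
    finally show ?thesis .
  qed
  ultimately show "\<exists>s' \<psi>'. sol {0..} s' \<psi>' \<and> (\<forall>t\<in>J. s' t = s t \<and> \<psi>' t = \<psi> t) \<and>
      (\<forall>t\<ge>0. lnorm 1 (\<lambda>k. s' t k - \<sigma> (\<psi>' t) k) \<le> 2 * \<delta> * exp (- (\<mu> / 2) * t))"
    using sol' by (intro exI[of _ "\<lambda>t. seq (s' t)"] exI[of _ "\<lambda>t. seq (y' t)"]) auto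
qed

end

section \<open>Constants from the hypotheses\<close>

lemma c1_on_real:
  fixes f :: "real \<Rightarrow> real"
  assumes "c1_on f {0..}"
  obtains f' where "\<And>x. x > 0 \<Longrightarrow> (f has_real_derivative f' x) (at x)" "continuous_on {0..} f'" "continuous_on {0..} f"
proof -
  obtain F where F: "\<And>x. x \<in> {0..} \<Longrightarrow> (f has_derivative blinfun_apply (F x)) (at x within {0..})"
    "continuous_on {0..} F" using assms unfolding c1_on_def by blast
  have lin: "blinfun_apply (F x) = (*) (blinfun_apply (F x) 1)" for x
  proof
    fix h show "blinfun_apply (F x) h = blinfun_apply (F x) 1 * h"
      using blinfun.scaleR_right[of "F x" h 1] by simp
  qed
  show ?thesis
  proof (rule that[of "\<lambda>x. blinfun_apply (F x) 1"])
    fix x :: real assume x: "x > 0"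
    then have "at x within {0..} = at x" by (intro at_within_interior) (simp add: interior_real_atLeast)
    then show "(f has_real_derivative blinfun_apply (F x) 1) (at x)"
      using F(1)[of x] x lin[of x] by (simp add: has_field_derivative_def)
  next
    show "continuous_on {0..} (\<lambda>x. blinfun_apply (F x) 1)" by (intro continuous_intros F)
    show "continuous_on {0..} f"
      using F(1) by (intro has_derivative_continuous_on) auto
  qed
qed

text \<open>The derivative of \<open>r \<lambda>(r) + \<mu> r\<close> at \<open>a\<close> is \<open>a \<lambda>'(a) + \<mu> = 0\<close>, hence small near \<open>a\<close>.\<close>

lemma amplitude_contraction:
  fixes lam :: "real \<Rightarrow> real" and a e :: real
  assumes lam: "c1_on lam {0..}" and a: "a > 0" "lam a = 0" and e: "e > 0"
  defines "\<mu> \<equiv> - a * deriv lam a"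
  obtains \<rho> where "0 < \<rho>" "\<rho> \<le> a / 4"
    "\<And>r r'. \<bar>r - a\<bar> \<le> 2 * \<rho> \<Longrightarrow> \<bar>r' - a\<bar> \<le> 2 * \<rho> \<Longrightarrow>
      \<bar>(r * lam r + \<mu> * r) - (r' * lam r' + \<mu> * r')\<bar> \<le> e * \<bar>r - r'\<bar>"
proof -
  obtain l' where l': "\<And>x. x > 0 \<Longrightarrow> (lam has_real_derivative l' x) (at x)" "continuous_on {0..} l'" "continuous_on {0..} lam"
    using c1_on_real[OF lam] by blast
  have la: "deriv lam a = l' a" using l'(1)[OF a(1)] by (rule DERIV_imp_deriv)
  define h where "h r = lam r + r * l' r + \<mu>" for r
  have "continuous_on {0..} h" unfolding h_def by (intro continuous_intros l')
  then have "\<exists>d>0. \<forall>r\<in>{0..}. dist r a < d \<longrightarrow> dist (h r) (h a) < e"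
    using a(1) e by (intro continuous_on_iff[THEN iffD1, rule_format]) auto
  moreover have "h a = 0" by (simp add: h_def \<mu>_def la a)
  ultimately obtain d where d: "d > 0" "\<And>r. r \<ge> 0 \<Longrightarrow> \<bar>r - a\<bar> < d \<Longrightarrow> \<bar>h r\<bar> < e"
    by (auto simp: dist_real_def)
  define \<rho> where "\<rho> = min (a / 4) (d / 4)"
  show ?thesis
  proof (rule that[of \<rho>])
    show "0 < \<rho>" "\<rho> \<le> a / 4" using a d by (auto simp: \<rho>_def)
    fix r r' assume r: "\<bar>r - a\<bar> \<le> 2 * \<rho>" "\<bar>r' - a\<bar> \<le> 2 * \<rho>"
    have "norm ((r * lam r + \<mu> * r) - (r' * lam r' + \<mu> * r')) \<le> e * norm (r - r')"
    proof (rule field_differentiable_bound[of "{a - 2 * \<rho>..a + 2 * \<rho>}" "\<lambda>r. r * lam r + \<mu> * r" h])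
      fix z assume z: "z \<in> {a - 2 * \<rho>..a + 2 * \<rho>}"
      then have "\<bar>z - a\<bar> \<le> 2 * \<rho>" by (auto simp: abs_le_iff)
      moreover have "2 * \<rho> \<le> a / 2" "2 * \<rho> < d" using d(1) by (auto simp: \<rho>_def)
      ultimately have z': "z > 0" "\<bar>z - a\<bar> < d" using a by (auto simp: abs_le_iff)
      have "((\<lambda>r. r * lam r + \<mu> * r) has_real_derivative h z) (at z)"
        using l'(1)[OF z'(1)] by (auto intro!: derivative_eq_intros simp: h_def)
      then show "((\<lambda>r. r * lam r + \<mu> * r) has_field_derivative h z) (at z within {a - 2 * \<rho>..a + 2 * \<rho>})"
        by (rule has_field_derivative_at_within)
      show "norm (h z) \<le> e" using d(2)[of z] z' by simp
    qed (use r in \<open>auto simp: abs_le_iff\<close>)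
    then show "\<bar>(r * lam r + \<mu> * r) - (r' * lam r' + \<mu> * r')\<bar> \<le> e * \<bar>r - r'\<bar>" by simp
  qed
qed

text \<open>The derivative is bounded on the compact convex set \<open>[a/2, 3a/2] \<times> [0, as]\<close>, so the constant is
  uniform in \<open>\<alpha>\<close>.\<close>

lemma frequency_lipschitz:
  fixes om1 :: "real \<Rightarrow> real \<Rightarrow> real" and a as :: real
  assumes om1: "c2_on (\<lambda>(R, \<alpha>). om1 R \<alpha>) ({0..} \<times> UNIV)" and a: "a > 0"
  obtains L where "L \<ge> 0" "\<And>r r' \<alpha>. r \<in> {a / 2..3 * a / 2} \<Longrightarrow> r' \<in> {a / 2..3 * a / 2} \<Longrightarrow> \<alpha> \<in> {0..as} \<Longrightarrow>
    \<bar>om1 r \<alpha> - om1 r' \<alpha>\<bar> \<le> L * \<bar>r - r'\<bar>"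
proof -
  define f where "f = (\<lambda>(R, \<alpha>). om1 R \<alpha> :: real)"
  define K where "K = {a / 2..3 * a / 2} \<times> {0..as}"
  have K: "compact K" "convex K" "K \<subseteq> {0..} \<times> UNIV"
    using a by (auto simp: K_def intro!: compact_Times convex_Times)
  obtain f' where f': "\<And>x. x \<in> {0..} \<times> UNIV \<Longrightarrow> (f has_derivative blinfun_apply (f' x)) (at x within {0..} \<times> UNIV)"
    "c1_on f' ({0..} \<times> UNIV)" using om1 unfolding c2_on_def f_def by blast
  obtain f'' where f'': "\<And>x. x \<in> {0..} \<times> UNIV \<Longrightarrow> (f' has_derivative blinfun_apply (f'' x)) (at x within {0..} \<times> UNIV)"
    using f'(2) unfolding c1_on_def by blast
  have "continuous_on ({0..} \<times> UNIV) f'"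
    by (rule has_derivative_continuous_on[OF f''])
  then have "continuous_on K f'" using K(3) by (rule continuous_on_subset)
  then have "bounded (f' ` K)" by (intro compact_imp_bounded compact_continuous_image K)
  then obtain B where "\<forall>y\<in>f' ` K. norm y \<le> B" unfolding bounded_iff by blast
  then have B: "norm (f' x) \<le> B" if "x \<in> K" for x using that by simp
  show ?thesis
  proof (rule that[of "\<bar>B\<bar>"])
    fix r r' \<alpha> assume r: "r \<in> {a / 2..3 * a / 2}" "r' \<in> {a / 2..3 * a / 2}" "\<alpha> \<in> {0..as}"
    have "norm (f (r, \<alpha>) - f (r', \<alpha>)) \<le> \<bar>B\<bar> * norm ((r, \<alpha>) - (r', \<alpha>))"
    proof (rule differentiable_bound[OF K(2)])
      fix x assume x: "x \<in> K"
      show "(f has_derivative blinfun_apply (f' x)) (at x within K)"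
        using x K(3) by (intro has_derivative_subset[OF f'(1) K(3)]) auto
      show "onorm (blinfun_apply (f' x)) \<le> \<bar>B\<bar>" using B[OF x] by (simp add: norm_blinfun.rep_eq)
    qed (use r in \<open>auto simp: K_def\<close>)
    then show "\<bar>om1 r \<alpha> - om1 r' \<alpha>\<bar> \<le> \<bar>B\<bar> * \<bar>r - r'\<bar>" by (simp add: f_def norm_Pair)
  qed simp
qed

lemma (in weakly_coupled) slaved_manifold:
  "\<exists>h. (\<forall>\<psi>\<in>ell 1. h \<psi> \<in> ell 1) \<and>
     invariant_manifold (solution lam om1 rb tb \<alpha>) {(s, \<psi>). s = h \<psi> \<and> \<psi> \<in> ell 1} \<and>
     h (\<lambda>_. 0) = (\<lambda>_. 0) \<and>
     (\<forall>\<psi>\<in>ell 1. lnorm \<infinity> (h \<psi>) \<le> sqrt \<alpha>) \<and>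
     (\<forall>p\<ge>1. \<forall>\<psi>\<in>ell 1. \<forall>\<phi>\<in>ell 1. lnorm p (\<lambda>k. h \<psi> k - h \<phi> k) \<le> sqrt \<alpha> * Q p (\<lambda>k. \<psi> k - \<phi> k)) \<and>
     (\<forall>\<delta>\<in>{0<..\<rho> / 4}. attracted (solution lam om1 rb tb \<alpha>) h \<delta> (\<mu> / 2))"
  by (rule exI[of _ \<sigma>])
    (simp add: \<sigma>_in_ell \<sigma>_invariant \<sigma>_zero \<sigma>_sup \<sigma>_lipschitz \<sigma>_attracted)

theorem theorem3p1:
  fixes lam :: "real \<Rightarrow> real" and om om1 :: "real \<Rightarrow> real \<Rightarrow> real" and om0 :: "real \<Rightarrow> real"
    and a as :: real and rb tb :: "real \<Rightarrow> lattice_seq"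
  assumes "hypothesis1 lam om om0 om1 a"
    and "hypothesis2 lam om1 a rb tb as"
  shows "\<exists>\<alpha>0. 0 < \<alpha>0 \<and> \<alpha>0 \<le> as \<and>
    (\<exists>\<sigma> :: lattice_seq \<Rightarrow> real \<Rightarrow> lattice_seq.
       (\<forall>\<psi>\<in>ell 1. \<forall>\<alpha>\<in>{0..\<alpha>0}. \<sigma> \<psi> \<alpha> \<in> ell 1) \<and>
       (\<forall>\<alpha>\<in>{0..\<alpha>0}. invariant_manifold (solution lam om1 rb tb \<alpha>)
                        {(s, \<psi>). s = \<sigma> \<psi> \<alpha> \<and> \<psi> \<in> ell 1}) \<and>
       (\<forall>\<alpha>\<in>{0..\<alpha>0}. \<sigma> (\<lambda>_. 0) \<alpha> = (\<lambda>_. 0)) \<and>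
       (\<forall>\<alpha>\<in>{0..\<alpha>0}. \<forall>\<psi>\<in>ell 1. lnorm \<infinity> (\<sigma> \<psi> \<alpha>) \<le> sqrt \<alpha>) \<and>
       (\<forall>p\<ge>1. \<forall>\<alpha>\<in>{0..\<alpha>0}. \<forall>\<psi>\<in>ell 1. \<forall>\<phi>\<in>ell 1.
          lnorm p (\<lambda>k. \<sigma> \<psi> \<alpha> k - \<sigma> \<phi> \<alpha> k) \<le> sqrt \<alpha> * Q p (\<lambda>k. \<psi> k - \<phi> k)) \<and>
       (\<exists>ds>0. \<exists>\<beta>>0. \<forall>\<delta>\<in>{0<..ds}. \<forall>\<alpha>\<in>{0..\<alpha>0}.
          attracted (solution lam om1 rb tb \<alpha>) (\<lambda>\<psi>. \<sigma> \<psi> \<alpha>) \<delta> \<beta>))"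
proof -
  have h1: "c1_on lam {0..}" "a > 0" "lam a = 0" "deriv lam a < 0" "c2_on (\<lambda>(R, \<alpha>). om1 R \<alpha>) ({0..} \<times> UNIV)"
    using assms(1) by (auto simp: hypothesis1_def)
  have as: "as > 0" using assms(2) by (simp add: hypothesis2_def)
  have equilibrium: "0 = \<alpha> * (\<Sum>k'\<in>nbrs k. rb \<alpha> k' * cos (tb \<alpha> k' - tb \<alpha> k) - rb \<alpha> k)
              + rb \<alpha> k * lam (rb \<alpha> k) \<and>
        0 = (\<Sum>k'\<in>nbrs k. rb \<alpha> k' / rb \<alpha> k * sin (tb \<alpha> k' - tb \<alpha> k)) + om1 (rb \<alpha> k) \<alpha>"
    if "\<alpha> \<in> {0..as}" for \<alpha> k
    using assms(2) that unfolding hypothesis2_def by blast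
  obtain C where C: "C > 0" "\<And>\<alpha> k. \<alpha> \<in> {0..as} \<Longrightarrow> \<bar>rb \<alpha> k - a\<bar> \<le> C * \<alpha>"
    using assms(2) unfolding hypothesis2_def by blast
  define \<mu> where "\<mu> = - a * deriv lam a"
  have \<mu>: "\<mu> > 0" using h1 by (simp add: \<mu>_def mult_pos_neg)
  obtain \<rho> where \<rho>: "0 < \<rho>" "\<rho> \<le> a / 4"
    "\<And>r r'. \<bar>r - a\<bar> \<le> 2 * \<rho> \<Longrightarrow> \<bar>r' - a\<bar> \<le> 2 * \<rho> \<Longrightarrow>
      \<bar>(r * lam r + \<mu> * r) - (r' * lam r' + \<mu> * r')\<bar> \<le> \<mu> / 32 * \<bar>r - r'\<bar>"
    using amplitude_contraction[OF h1(1-3), of "\<mu> / 32"] \<mu> unfolding \<mu>_def by auto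
  obtain L where L: "L \<ge> 0" "\<And>r r' \<alpha>. r \<in> {a / 2..3 * a / 2} \<Longrightarrow> r' \<in> {a / 2..3 * a / 2} \<Longrightarrow> \<alpha> \<in> {0..as} \<Longrightarrow>
      \<bar>om1 r \<alpha> - om1 r' \<alpha>\<bar> \<le> L * \<bar>r - r'\<bar>"
    using frequency_lipschitz[OF h1(5,2), of as] by blast
  define K where "K = 80 + 12 * (512 * a + (16 * (56 / a + L) + 768))"
  have K: "K > 0" using h1(2) L(1) by (auto simp: K_def intro!: add_pos_nonneg)
  \<comment> \<open>An upper bound for \<open>sqrt \<alpha>\<close>. The third entry gives the smallness condition of \<open>weakly_coupled\<close>,
    the second one keeps the manifold at half the clipping height, which leaves room for a tube of
    width \<open>\<rho> / 4\<close> around it.\<close>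
  define q where "q = min 1 (min (\<rho> / 2) (\<mu> / (8 * K)))"
  have q: "0 < q" "q \<le> 1" "q \<le> \<rho> / 2" "q * K \<le> \<mu> / 8"
  proof -
    show "0 < q" "q \<le> 1" "q \<le> \<rho> / 2" using \<rho> \<mu> K by (auto simp: q_def)
    have "q * K \<le> \<mu> / (8 * K) * K" using K by (intro mult_right_mono) (auto simp: q_def)
    then show "q * K \<le> \<mu> / 8" using K by simp
  qed
  \<comment> \<open>The last entry keeps the equilibrium radii within \<open>\<rho>\<close> of \<open>a\<close>.\<close>
  define \<alpha>0 where "\<alpha>0 = min as (min (q\<^sup>2) (\<rho> / C))"
  have \<alpha>0: "0 < \<alpha>0" "\<alpha>0 \<le> as" using as q(1) \<rho>(1) C(1) by (auto simp: \<alpha>0_def)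
  have wc: "weakly_coupled lam om1 rb tb \<alpha> a \<mu> \<rho> (\<mu> / 32) L" if \<alpha>: "\<alpha> \<in> {0..\<alpha>0}" for \<alpha>
  proof -
    have \<alpha>': "\<alpha> \<in> {0..as}" "\<alpha> \<le> q\<^sup>2" "C * \<alpha> \<le> \<rho>"
      using \<alpha> C(1) by (auto simp: \<alpha>0_def pos_le_divide_eq mult.commute)
    have sq: "sqrt \<alpha> \<le> q" using real_sqrt_le_mono[OF \<alpha>'(2)] q(1) by simp
    have osc: "oscillators lam om1 rb tb \<alpha> a \<mu> \<rho> (\<mu> / 32) L"
    proof
      show "\<bar>rb \<alpha> k - a\<bar> \<le> \<rho>" for k using C(2)[OF \<alpha>'(1), of k] \<alpha>'(3) by simp
      show "\<bar>om1 r \<alpha> - om1 r' \<alpha>\<bar> \<le> L * \<bar>r - r'\<bar>" if "\<bar>r - a\<bar> \<le> 2 * \<rho>" "\<bar>r' - a\<bar> \<le> 2 * \<rho>" for r r'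
        using that \<rho>(2) \<alpha>'(1) by (intro L(2)) (auto simp: abs_le_iff)
      show "\<alpha> * (\<Sum>k'\<in>nbrs k. rb \<alpha> k' * cos (tb \<alpha> k' - tb \<alpha> k) - rb \<alpha> k) + rb \<alpha> k * lam (rb \<alpha> k) = 0" for k
        using equilibrium[OF \<alpha>'(1), of k] by simp
      show "(\<Sum>k'\<in>nbrs k. rb \<alpha> k' / rb \<alpha> k * sin (tb \<alpha> k' - tb \<alpha> k)) + om1 (rb \<alpha> k) \<alpha> = 0" for k
        using equilibrium[OF \<alpha>'(1), of k] by simp
    qed (use h1 \<mu> \<rho> L \<alpha>' in auto)
    show ?thesis
    proof (intro weakly_coupled.intro[OF osc] weakly_coupled_axioms.intro)
      have "sqrt \<alpha> * K \<le> q * K" using sq K by (intro mult_right_mono) auto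
      then show "sqrt \<alpha> * (80 + 12 * (512 * a + oscillators.drift_bound a L)) \<le> \<mu> / 8"
        unfolding oscillators.drift_bound_def[OF osc] K_def[symmetric] using q(4) by linarith
      show "\<alpha> \<le> 1" using \<alpha>'(2) q(1,2) power_le_one[of q 2] by linarith
      show "sqrt \<alpha> \<le> \<rho> / 2" using sq q(3) by simp
    qed simp
  qed
  have "\<forall>\<alpha>\<in>{0..\<alpha>0}. \<exists>h. (\<forall>\<psi>\<in>ell 1. h \<psi> \<in> ell 1) \<and>
     invariant_manifold (solution lam om1 rb tb \<alpha>) {(s, \<psi>). s = h \<psi> \<and> \<psi> \<in> ell 1} \<and>
     h (\<lambda>_. 0) = (\<lambda>_. 0) \<and>
     (\<forall>\<psi>\<in>ell 1. lnorm \<infinity> (h \<psi>) \<le> sqrt \<alpha>) \<and>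
     (\<forall>p\<ge>1. \<forall>\<psi>\<in>ell 1. \<forall>\<phi>\<in>ell 1. lnorm p (\<lambda>k. h \<psi> k - h \<phi> k) \<le> sqrt \<alpha> * Q p (\<lambda>k. \<psi> k - \<phi> k)) \<and>
     (\<forall>\<delta>\<in>{0<..\<rho> / 4}. attracted (solution lam om1 rb tb \<alpha>) h \<delta> (\<mu> / 2))"
    using weakly_coupled.slaved_manifold[OF wc] by blast
  from bchoice[OF this] obtain H where H: "\<forall>\<alpha>\<in>{0..\<alpha>0}. (\<forall>\<psi>\<in>ell 1. H \<alpha> \<psi> \<in> ell 1) \<and>
     invariant_manifold (solution lam om1 rb tb \<alpha>) {(s, \<psi>). s = H \<alpha> \<psi> \<and> \<psi> \<in> ell 1} \<and>
     H \<alpha> (\<lambda>_. 0) = (\<lambda>_. 0) \<and>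
     (\<forall>\<psi>\<in>ell 1. lnorm \<infinity> (H \<alpha> \<psi>) \<le> sqrt \<alpha>) \<and>
     (\<forall>p\<ge>1. \<forall>\<psi>\<in>ell 1. \<forall>\<phi>\<in>ell 1. lnorm p (\<lambda>k. H \<alpha> \<psi> k - H \<alpha> \<phi> k) \<le> sqrt \<alpha> * Q p (\<lambda>k. \<psi> k - \<phi> k)) \<and>
     (\<forall>\<delta>\<in>{0<..\<rho> / 4}. attracted (solution lam om1 rb tb \<alpha>) (H \<alpha>) \<delta> (\<mu> / 2))" ..
  note H' = H[THEN bspec]
  note H_ell = H'[THEN conjunct1] and H_inv = H'[THEN conjunct2, THEN conjunct1]
    and H_zero = H'[THEN conjunct2, THEN conjunct2, THEN conjunct1]
    and H_sup = H'[THEN conjunct2, THEN conjunct2, THEN conjunct2, THEN conjunct1]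
    and H_lip = H'[THEN conjunct2, THEN conjunct2, THEN conjunct2, THEN conjunct2, THEN conjunct1]
    and H_attr = H'[THEN conjunct2, THEN conjunct2, THEN conjunct2, THEN conjunct2, THEN conjunct2]
  show ?thesis
  proof (rule exI[of _ \<alpha>0], intro conjI \<alpha>0, rule exI[of _ "\<lambda>\<psi> \<alpha>. H \<alpha> \<psi>"], intro conjI)
    show "\<exists>ds>0. \<exists>\<beta>>0. \<forall>\<delta>\<in>{0<..ds}. \<forall>\<alpha>\<in>{0..\<alpha>0}. attracted (solution lam om1 rb tb \<alpha>) (\<lambda>\<psi>. H \<alpha> \<psi>) \<delta> \<beta>"
    proof (rule exI[of _ "\<rho> / 4"], rule conjI)
      show "\<rho> / 4 > 0" using \<rho>(1) by simp
      show "\<exists>\<beta>>0. \<forall>\<delta>\<in>{0<..\<rho> / 4}. \<forall>\<alpha>\<in>{0..\<alpha>0}. attracted (solution lam om1 rb tb \<alpha>) (\<lambda>\<psi>. H \<alpha> \<psi>) \<delta> \<beta>"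
      proof (rule exI[of _ "\<mu> / 2"], rule conjI)
        show "\<mu> / 2 > 0" using \<mu> by simp
        show "\<forall>\<delta>\<in>{0<..\<rho> / 4}. \<forall>\<alpha>\<in>{0..\<alpha>0}. attracted (solution lam om1 rb tb \<alpha>) (\<lambda>\<psi>. H \<alpha> \<psi>) \<delta> (\<mu> / 2)"
          using H_attr by blast
      qed
    qed
    show "\<forall>\<psi>\<in>ell 1. \<forall>\<alpha>\<in>{0..\<alpha>0}. H \<alpha> \<psi> \<in> ell 1"
      using H_ell by blast
    show "\<forall>\<alpha>\<in>{0..\<alpha>0}. invariant_manifold (solution lam om1 rb tb \<alpha>) {(s, \<psi>). s = H \<alpha> \<psi> \<and> \<psi> \<in> ell 1}"
      using H_inv by (rule ballI)
    show "\<forall>\<alpha>\<in>{0..\<alpha>0}. H \<alpha> (\<lambda>_. 0) = (\<lambda>_. 0)"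
      using H_zero by (rule ballI)
    show "\<forall>\<alpha>\<in>{0..\<alpha>0}. \<forall>\<psi>\<in>ell 1. lnorm \<infinity> (H \<alpha> \<psi>) \<le> sqrt \<alpha>"
      using H_sup by (rule ballI)
    show "\<forall>p\<ge>1. \<forall>\<alpha>\<in>{0..\<alpha>0}. \<forall>\<psi>\<in>ell 1. \<forall>\<phi>\<in>ell 1.
        lnorm p (\<lambda>k. H \<alpha> \<psi> k - H \<alpha> \<phi> k) \<le> sqrt \<alpha> * Q p (\<lambda>k. \<psi> k - \<phi> k)"
      using H_lip by simp
  qed
qed

end
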